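(* Let $T>0$, $\kappa^0\in\mathrm{Lip}(\mathbb{R})$ and $\rho^0\in C_0^\infty(\mathbb{R})$ with $\kappa^0_x\ge|\rho^0_x|$ a.e. in $\mathbb{R}$, and let $\rho$ solve $\rho_t=\rho_{xx}$ in $Q_T$, $\rho(\cdot,0)=\rho^0$. Then there exists a viscosity solution $\kappa\in\mathrm{Lip}(\overline{Q}_T)$ of $\kappa_t\kappa_x=\rho_t\rho_x$ in $Q_T$, $\kappa(\cdot,0)=\kappa^0$, satisfying $\kappa_x\ge|\rho_x|$ a.e. in $\overline{Q}_T$.
   Context: $Q_T=\mathbb{R}\times(0,T)$; $\mathrm{Lip}$ denotes Lipschitz continuous functions. The equation $\kappa_t\kappa_x=\rho_t\rho_x$ is understood in the viscosity sense as $F((x,t),\nabla\kappa)=0$ with $F((x,t),(p_1,p_2))=p_1p_2-\rho_x(x,t)\rho_{xx}(x,t)$ (Crandall–Lions viscosity solutions, continuous up to $t=0$ with the given initial datum).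
   Formalization: Here $\rho$ is taken to be the bounded classical solution of the heat equation, continuous on $\overline{Q}_T$; for unbounded (Tychonoff-type) solutions $\rho_x$ is unbounded and no Lipschitz $\kappa$ can satisfy $\kappa_x\ge|\rho_x|$. *)

theory Defs
  imports "HOL-Analysis.Analysis"
begin

definition QT :: "real \<Rightarrow> (real \<times> real) set" where
  "QT T = UNIV \<times> {0<..<T}"

definition QT_closed :: "real \<Rightarrow> (real \<times> real) set" where
  "QT_closed T = UNIV \<times> {0..T}"

definition smooth_real :: "(real \<Rightarrow> real) \<Rightarrow> bool" where
  "smooth_real f \<longleftrightarrow> (\<forall>n x. ((deriv ^^ n) f) differentiable (at x))"

definition compact_support :: "(real \<Rightarrow> real) \<Rightarrow> bool" where
  "compact_support f \<longleftrightarrow> compact (closure {x. f x \<noteq> 0})"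

definition C1_on :: "(real \<times> real) set \<Rightarrow> (real \<times> real \<Rightarrow> real)
                      \<Rightarrow> (real \<times> real \<Rightarrow> real \<times> real \<Rightarrow> real) \<Rightarrow> bool" where
  "C1_on S phi Dphi \<longleftrightarrow>
     (\<forall>q\<in>S. (phi has_derivative Dphi q) (at q)) \<and>
     continuous_on S (\<lambda>q. Dphi q (1,0)) \<and> continuous_on S (\<lambda>q. Dphi q (0,1))"

text \<open>Crandall--Lions viscosity sub/supersolutions of F(z, \<nabla>u(z)) = 0 in the open set \<Omega>,
  where \<nabla>u = (u_x, u_t), tested with C^1 functions touching from above/below.\<close>
definition viscosity_subsolution ::
  "(real \<times> real) set \<Rightarrow> (real \<times> real \<Rightarrow> real \<times> real \<Rightarrow> real) \<Rightarrow> (real \<times> real \<Rightarrow> real) \<Rightarrow> bool" where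
  "viscosity_subsolution \<Omega> F u \<longleftrightarrow> continuous_on \<Omega> u \<and>
     (\<forall>phi Dphi z e. z \<in> \<Omega> \<and> e > 0 \<and> ball z e \<subseteq> \<Omega> \<and> C1_on (ball z e) phi Dphi \<and>
        (\<forall>q\<in>ball z e. u q - phi q \<le> u z - phi z)
        \<longrightarrow> F z (Dphi z (1,0), Dphi z (0,1)) \<le> 0)"

definition viscosity_supersolution ::
  "(real \<times> real) set \<Rightarrow> (real \<times> real \<Rightarrow> real \<times> real \<Rightarrow> real) \<Rightarrow> (real \<times> real \<Rightarrow> real) \<Rightarrow> bool" where
  "viscosity_supersolution \<Omega> F u \<longleftrightarrow> continuous_on \<Omega> u \<and>
     (\<forall>phi Dphi z e. z \<in> \<Omega> \<and> e > 0 \<and> ball z e \<subseteq> \<Omega> \<and> C1_on (ball z e) phi Dphi \<and>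
        (\<forall>q\<in>ball z e. u q - phi q \<ge> u z - phi z)
        \<longrightarrow> F z (Dphi z (1,0), Dphi z (0,1)) \<ge> 0)"

definition viscosity_solution ::
  "(real \<times> real) set \<Rightarrow> (real \<times> real \<Rightarrow> real \<times> real \<Rightarrow> real) \<Rightarrow> (real \<times> real \<Rightarrow> real) \<Rightarrow> bool" where
  "viscosity_solution \<Omega> F u \<longleftrightarrow> viscosity_subsolution \<Omega> F u \<and> viscosity_supersolution \<Omega> F u"

end

(* Write the equation as kappa_t = rho_xx (rho_x / kappa_x). Then kappa - rho and kappa + rho are transported with
   opposite velocities, so both stay nondecreasing in x, i.e. kappa_x >= |rho_x|, and |kappa_t| <= |rho_xx|.
   On a grid of width h the equation is discretised by the explicit scheme
     K' = K + l D2 K + (1/4) D2 R (R+ - R-) / (K+ - K-),   R' = R + (1/4 + l) D2 R,   tau = h^2 / 4,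
   where R is a discrete heat flow and l -> 0 is a vanishing viscosity. The scheme for the increments of K is monotone
   as long as these are at least e > 0, and sqrt(m^2 + e^2), m the increments of R, is a subsolution of it because its
   flux is exactly its own gradient and the norm is convex. This yields bounds uniform in h, hence a Lipschitz limit
   kappa; the maximum principle gives R -> rho together with the difference quotients. Monotonicity makes the limit a
   viscosity solution: for a test function with positive slope the denominators stay away from 0, and if the slope
   vanishes then so does rho_x and there is nothing to prove.
   Almost everywhere differentiability of Lipschitz functions of one variable, needed both for the initial datum
   and for the conclusion, is derived from Vitali's covering theorem. *)

theory Submission
  imports Defs "HOL-Complex_Analysis.Great_Picard"
begin

section \<open>Lipschitz functions of one real variable\<close>

text \<open>The quotient \<open>rho_x / kappa_x\<close> degenerates where \<open>kappa_x\<close>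
  vanishes; the constraint bounds it there but gives no continuity. A floor \<open>e\<close> under
  the increments repairs this, yet the derivative of \<open>A / theta\<close> in
  \<open>theta\<close> can then be as large as \<open>A / e^2\<close>, which threatens monotonicity;
  the viscosity \<open>l\<close> is there to dominate exactly this term. Since both \<open>l\<close>
  and the slope \<open>e / h\<close> have to vanish in the limit, \<open>h\<close> is a high power
  of a common parameter \<open>s\<close>. The discrete heat flow has coefficient
  \<open>1/4 + l\<close> rather than \<open>1/4\<close>: a step of the scheme turns
  \<open>q = sqrt (m^2 + e^2)\<close> into \<open>q + 1/4 D2 q\<close> by the flux plus
  \<open>l D2 q\<close> by the viscosity, and \<open>m\<close> has to move by the same averaging for
  convexity of the norm to compare the two. Over one time step the viscosity can move a merely
  Lipschitz profile too fast for a direct Lipschitz bound in time, so continuity in time is proved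
  only up to an error vanishing with \<open>s\<close>. The viscosity term also asks for bounded
  second differences of the test function. Hence quadratic test functions come in first, and
  doubling of variables passes to those of class \<open>C^1\<close>.\<close>

lemma emeasure_image_le:
  fixes F :: "real \<Rightarrow> real"
  assumes lip: "L-lipschitz_on UNIV F" and inj: "inj F" and E: "E \<in> sets borel" and FE: "F ` E \<in> sets borel"
    and p: "p \<ge> 0"
    and small: "\<And>x d. x \<in> E \<Longrightarrow> d > 0 \<Longrightarrow>
      \<exists>c r c'. 0 < r \<and> r < d \<and> x \<in> cball c r \<and> F ` cball c r \<subseteq> cball c' (p * r)"
  shows "emeasure lborel (F ` E) \<le> ennreal p * emeasure lborel E"
proof -
  have main: "emeasure lborel (F ` E) \<le> ennreal p * (emeasure lborel E + ennreal e)" if "e > 0" for e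
  proof -
    obtain U where U: "open U" "E \<subseteq> U" "emeasure lborel (U - E) < e"
      by (rule outer_regular_lborel[OF E \<open>e > 0\<close>])
    \<comment> \<open>Candidate balls stay inside an open \<open>U\<close> barely larger than
      \<open>E\<close>, so disjoint ones have total length at most that of \<open>U\<close>; each
      has an image shorter by the factor \<open>p\<close>.\<close>
    define K where "K = {cr :: real \<times> real. 0 < snd cr \<and> cball (fst cr) (snd cr) \<subseteq> U \<and>
       (\<exists>c'. F ` cball (fst cr) (snd cr) \<subseteq> cball c' (p * snd cr))}"
    have cov: "\<exists>i. i \<in> K \<and> x \<in> cball (fst i) (snd i) \<and> snd i < d" if "x \<in> E" "0 < d" for x d
    proof -
      obtain e' where e': "e' > 0" "cball x e' \<subseteq> U"
        using U \<open>x \<in> E\<close> by (meson open_contains_cball subsetD)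
      have "min d (e'/2) > 0" using \<open>e' > 0\<close> \<open>0 < d\<close> by simp
      from small[OF \<open>x \<in> E\<close> this] obtain c r c' where c: "0 < r" "r < min d (e'/2)" "x \<in> cball c r" "F ` cball c r \<subseteq> cball c' (p * r)"
        by blast
      have "cball c r \<subseteq> cball x e'"
      proof
        fix y assume "y \<in> cball c r"
        then have "dist x y \<le> r + r" using c(3) dist_triangle[of x y c] by (auto simp: dist_commute)
        then show "y \<in> cball x e'" using c(2) by auto
      qed
      then have "(c,r) \<in> K" using c e' by (auto simp: K_def)
      then show ?thesis using c by (intro exI[of _ "(c,r)"]) auto
    qed
    obtain C where C: "countable C" "C \<subseteq> K"
      "pairwise (\<lambda>i j. disjnt (cball (fst i) (snd i)) (cball (fst j) (snd j))) C"
      "negligible (E - (\<Union>i\<in>C. cball (fst i) (snd i)))"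
      by (rule Vitali_covering_theorem_cballs[of K snd E fst]) (use cov in \<open>auto simp: K_def\<close>)
    let ?B = "\<lambda>i. cball (fst i) (snd i)"
    \<comment> \<open>Vitali leaves only a null set of \<open>E\<close> uncovered, and a Lipschitz
      map keeps it null.\<close>
    define N where "N = E - (\<Union>i\<in>C. ?B i)"
    have "negligible (F ` N)"
    proof (rule negligible_locally_Lipschitz_image)
      show "negligible N" using C(4) by (simp add: N_def)
      fix x assume "x \<in> N"
      show "\<exists>T B. open T \<and> x \<in> T \<and> (\<forall>y\<in>N \<inter> T. norm (F y - F x) \<le> B * norm (y - x))"
        using lipschitz_onD[OF lip] by (intro exI[of _ UNIV] exI[of _ L]) (auto simp: dist_norm)
    qed simp
    then have FN: "F ` N \<in> null_sets lebesgue" by (simp add: negligible_iff_null_sets)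
    have bI: "emeasure lebesgue (F ` ?B i) \<le> ennreal p * emeasure lebesgue (?B i)" "F ` ?B i \<in> sets borel" if i: "i \<in> C" for i
    proof -
      obtain c' where r: "0 < snd i" and c': "F ` ?B i \<subseteq> cball c' (p * snd i)"
        using C(2) i by (auto simp: K_def)
      have "compact (F ` ?B i)"
        by (intro compact_continuous_image continuous_on_subset[OF lipschitz_on_continuous_on[OF lip]]) auto
      then show "F ` ?B i \<in> sets borel" by (simp add: borel_compact)
      have "emeasure lebesgue (F ` ?B i) \<le> emeasure lebesgue (cball c' (p * snd i))"
        by (intro emeasure_mono c') auto
      also have "\<dots> = ennreal (2 * (p * snd i))"
        using p r by (simp add: cball_eq_atLeastAtMost)
      also have "\<dots> = ennreal p * emeasure lebesgue (?B i)"
        using p r by (simp add: cball_eq_atLeastAtMost ennreal_mult[symmetric] mult_ac)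
      finally show "emeasure lebesgue (F ` ?B i) \<le> ennreal p * emeasure lebesgue (?B i)" .
    qed
    have "E \<subseteq> (\<Union>i\<in>C. ?B i) \<union> N" by (auto simp: N_def)
    then have sub: "F ` E \<subseteq> (\<Union>i\<in>C. F ` ?B i) \<union> F ` N" by blast
    have UB: "(\<Union>i\<in>C. F ` ?B i) \<in> sets lebesgue"
      using bI(2) by (intro sets.countable_UN' C(1)) auto
    have "emeasure lebesgue (F ` E) \<le> emeasure lebesgue ((\<Union>i\<in>C. F ` ?B i) \<union> F ` N)"
      by (intro emeasure_mono sub sets.Un UB) (use FN in auto)
    also have "\<dots> = emeasure lebesgue (\<Union>i\<in>C. F ` ?B i)"
      by (intro emeasure_Un_null_set FN UB)
    also have "\<dots> = (\<integral>\<^sup>+i. emeasure lebesgue (F ` ?B i) \<partial>count_space C)"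
    proof (intro emeasure_UN_countable)
      show "disjoint_family_on (\<lambda>i. F ` ?B i) C"
        using C(3) by (auto simp: disjoint_family_on_def pairwise_def disjnt_def image_Int[OF inj, symmetric])
    qed (use C(1) bI in auto)
    also have "\<dots> \<le> (\<integral>\<^sup>+i. ennreal p * emeasure lebesgue (?B i) \<partial>count_space C)"
      by (intro nn_integral_mono) (use bI in auto)
    also have "\<dots> = ennreal p * (\<integral>\<^sup>+i. emeasure lebesgue (?B i) \<partial>count_space C)"
      by (rule nn_integral_cmult) auto
    also have "(\<integral>\<^sup>+i. emeasure lebesgue (?B i) \<partial>count_space C) = emeasure lebesgue (\<Union>i\<in>C. ?B i)"
      by (intro emeasure_UN_countable[symmetric])
        (use C(1,3) in \<open>auto simp: disjoint_family_on_def pairwise_def disjnt_def\<close>)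
    also have "\<dots> \<le> emeasure lebesgue U"
      by (intro emeasure_mono) (use C(2) U in \<open>auto simp: K_def\<close>)
    also have "\<dots> = emeasure lebesgue (E \<union> (U - E))" using U by (simp add: Un_absorb1)
    also have "\<dots> \<le> emeasure lebesgue E + emeasure lebesgue (U - E)"
      by (intro emeasure_subadditive) (use E U in auto)
    also have "\<dots> \<le> emeasure lborel E + ennreal e"
      using U E by (auto intro!: add_mono)
    finally show ?thesis using FE E by (auto simp: mult_left_mono)
  qed
  show ?thesis
  proof (rule ennreal_le_epsilon)
    fix e :: real assume "e > 0"
    \<comment> \<open>Division by \<open>p + 1\<close> rather than \<open>p\<close> covers the case
      \<open>p = 0\<close>.\<close>
    have "emeasure lborel (F ` E) \<le> ennreal p * (emeasure lborel E + ennreal (e / (p + 1)))"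
      using p \<open>e > 0\<close> by (intro main) auto
    also have "\<dots> = ennreal p * emeasure lborel E + ennreal (p * (e/(p+1)))"
      unfolding distrib_left using p \<open>e > 0\<close> by (subst ennreal_mult) auto
    also have "\<dots> \<le> ennreal p * emeasure lborel E + ennreal e"
      using p \<open>e > 0\<close> by (intro add_mono ennreal_leI) (auto simp: field_simps)
    finally show "emeasure lborel (F ` E) \<le> ennreal p * emeasure lborel E + ennreal e" .
  qed
qed

text \<open>Contains every point whose lower derivate (liminf of the quotients, \<open>h\<close> of
  either sign) is below \<open>p\<close>, and only points where it is at most \<open>p\<close>.
  Strict inequalities at the scales \<open>inverse (Suc n)\<close> make it a countable intersection
  of open sets when \<open>f\<close> is continuous.\<close>

definition slope_below :: "(real \<Rightarrow> real) \<Rightarrow> real \<Rightarrow> real set" where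
  "slope_below f p = {x. \<forall>n. \<exists>h. 0 < \<bar>h\<bar> \<and> \<bar>h\<bar> < inverse (Suc n) \<and> (f (x + h) - f x) / h < p}"

definition slope_above :: "(real \<Rightarrow> real) \<Rightarrow> real \<Rightarrow> real set" where
  "slope_above f q = {x. \<forall>n. \<exists>h. 0 < \<bar>h\<bar> \<and> \<bar>h\<bar> < inverse (Suc n) \<and> (f (x + h) - f x) / h > q}"

section \<open>Gaps between lower and upper derivates\<close>

lemma bilipschitz_inverse:
  fixes F :: "real \<Rightarrow> real"
  assumes lip: "M-lipschitz_on UNIV F" and low: "\<And>x y. x \<le> y \<Longrightarrow> y - x \<le> F y - F x"
  obtains G where "\<And>x. G (F x) = x" "\<And>y. F (G y) = y" "1-lipschitz_on UNIV G"
proof -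
  have inj: "inj F"
  proof (rule injI)
    fix x y assume "F x = F y"
    then show "x = y" using low[of x y] low[of y x] by linarith
  qed
  have surj: "\<exists>x. F x = y" for y
  proof -
    define m where "m = \<bar>y - F 0\<bar>"
    have "F (-m) \<le> y" "y \<le> F m" using low[of "-m" 0] low[of 0 m] by (auto simp: m_def)
    then show ?thesis
      using IVT'[of F "-m" y m] continuous_on_subset[OF lipschitz_on_continuous_on[OF lip]] by (auto simp: m_def)
  qed
  define G where "G = inv F"
  have GF: "G (F x) = x" for x using inj by (simp add: G_def)
  have FG: "F (G y) = y" for y using surj by (metis GF)
  have "1-lipschitz_on UNIV G"
  proof (rule lipschitz_onI)
    fix x y :: real
    show "dist (G x) (G y) \<le> 1 * dist x y"
      using low[of "G x" "G y"] low[of "G y" "G x"] by (cases "G x \<le> G y") (auto simp: FG dist_real_def)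
  qed simp
  with GF FG that show ?thesis by blast
qed

lemma continuous_image_inverse_borel:
  fixes F G :: "real \<Rightarrow> real"
  assumes "\<And>x. G (F x) = x" "\<And>y. F (G y) = y" "continuous_on UNIV G" "E \<in> sets borel"
  shows "F ` E \<in> sets borel"
proof -
  have "F ` E = G -` E" using assms(1,2) by (auto simp: image_iff) (metis)
  also have "\<dots> = G -` E \<inter> space borel" by simp
  also have "\<dots> \<in> sets borel"
    by (rule measurable_sets[OF borel_measurable_continuous_onI[OF assms(3)] assms(4)])
  finally show ?thesis .
qed

text \<open>Monotonicity lets the two endpoints control everything between them, so a single small
  difference quotient yields a ball of the kind the covering estimate asks for. The ball is the
  interval between \<open>x\<close> and \<open>x + h\<close>, for either sign of
  \<open>h\<close>.\<close>

lemma mono_image_cball: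
  fixes F :: "real \<Rightarrow> real"
  assumes mono: "mono F" and h: "\<bar>F (x + h) - F x\<bar> \<le> p * \<bar>h\<bar>"
  shows "\<exists>c'. F ` cball (x + h/2) (\<bar>h\<bar>/2) \<subseteq> cball c' (p * (\<bar>h\<bar>/2))"
proof -
  define l u where "l = min x (x+h)" and "u = max x (x+h)"
  have c: "cball (x + h/2) (\<bar>h\<bar>/2) = {l..u}" by (auto simp: cball_eq_atLeastAtMost l_def u_def abs_if field_simps)
  have *: "F u - F l = \<bar>F (x+h) - F x\<bar>" using monoD[OF mono, of l u]
    by (cases "h \<ge> 0") (auto simp: l_def u_def)
  have "F ` {l..u} \<subseteq> {F l..F u}" using monoD[OF mono] by auto
  also have "\<dots> \<subseteq> cball ((F l + F u)/2) (p * (\<bar>h\<bar>/2))"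
    using h * by (auto simp: cball_eq_atLeastAtMost field_simps)
  finally show ?thesis unfolding c by blast
qed

lemma emeasure_image_slope_below:
  fixes F :: "real \<Rightarrow> real"
  assumes lip: "M-lipschitz_on UNIV F" and inj: "inj F" and mono: "mono F" and p: "p \<ge> 0"
   and E: "E \<in> sets borel" "F ` E \<in> sets borel" "E \<subseteq> slope_below F p"
  shows "emeasure lborel (F ` E) \<le> ennreal p * emeasure lborel E"
proof (rule emeasure_image_le[OF lip inj E(1,2) p])
  fix x d :: real assume "x \<in> E" "d > 0"
  obtain n where n: "inverse (Suc n) < d" using reals_Archimedean[OF \<open>d > 0\<close>] by blast
  obtain h where h: "0 < \<bar>h\<bar>" "\<bar>h\<bar> < inverse (Suc n)" "(F (x + h) - F x) / h < p"
    using \<open>x \<in> E\<close> E(3) by (force simp: slope_below_def)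
  have "\<bar>F (x+h) - F x\<bar> \<le> p * \<bar>h\<bar>"
    using h monoD[OF mono, of x "x+h"] monoD[OF mono, of "x+h" x]
    by (cases "h > 0") (auto simp: field_simps)
  then obtain c' where "F ` cball (x + h/2) (\<bar>h\<bar>/2) \<subseteq> cball c' (p * (\<bar>h\<bar>/2))"
    using mono_image_cball[OF mono] by blast
  moreover have "0 < \<bar>h\<bar>/2" "\<bar>h\<bar>/2 < d" "x \<in> cball (x + h/2) (\<bar>h\<bar>/2)"
    using h n by (auto simp: dist_real_def)
  ultimately show "\<exists>c r c'. 0 < r \<and> r < d \<and> x \<in> cball c r \<and> F ` cball c r \<subseteq> cball c' (p * r)"
    by blast
qed

text \<open>Small slopes of \<open>F\<close> give \<open>|F E| \<le> p |E|\<close>. Large slopes of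
  \<open>F\<close> are small slopes of the inverse \<open>G\<close>, which gives
  \<open>|E| \<le> (1/q) |F E|\<close>. Together \<open>|E| \<le> (p/q) |E|\<close> with
  \<open>p/q < 1\<close>, and finiteness of \<open>|E|\<close> allows cancelling.\<close>

lemma null_slope_gap_mono:
  fixes F :: "real \<Rightarrow> real"
  assumes lip: "M-lipschitz_on UNIV F" and low: "\<And>x y. x \<le> y \<Longrightarrow> y - x \<le> F y - F x"
    and E: "E \<in> sets borel" "E \<subseteq> slope_below F p \<inter> slope_above F q" and pq: "p < q"
    and fin: "emeasure lborel E < \<infinity>"
  shows "emeasure lborel E = 0"
proof (cases "E = {}")
  case False
  obtain G where G: "\<And>x. G (F x) = x" "\<And>y. F (G y) = y" "1-lipschitz_on UNIV G"
    using bilipschitz_inverse[OF lip low] by blast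
  have injF: "inj F" using G(1) by (metis injI)
  have injG: "inj G" using G(2) by (metis injI)
  have monoF: "mono F" using low by (force intro!: monoI)
  have monoG: "mono G"
  proof (rule monoI)
    fix x y :: real assume "x \<le> y"
    then show "G x \<le> G y" using low[of "G y" "G x"] by (cases "G y \<le> G x") (auto simp: G)
  qed
  have M: "M \<ge> 0" using lip by (auto simp: lipschitz_on_def)
  have FE: "F ` E \<in> sets borel"
    using continuous_image_inverse_borel[OF G(1,2) lipschitz_on_continuous_on[OF G(3)] E(1)] .
  have GFE: "G ` F ` E = E" by (auto simp: G image_image)
  \<comment> \<open>One point suffices for \<open>p > 0\<close>: the slopes of the increasing
    \<open>F\<close> are nonnegative and one of them lies below \<open>p\<close>.\<close>
  obtain x0 where "x0 \<in> E" using False by auto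
  then obtain h0 where h0: "0 < \<bar>h0\<bar>" "(F (x0 + h0) - F x0) / h0 < p"
    using E(2) by (force simp: slope_below_def)
  have "(F (x0 + h0) - F x0) / h0 \<ge> 0"
    using h0 monoD[OF monoF, of x0 "x0+h0"] monoD[OF monoF, of "x0+h0" x0]
    by (cases "h0 > 0") (auto simp: field_simps)
  with h0 have p: "p > 0" by linarith
  with pq have q: "q > 0" by simp
  have 1: "emeasure lborel (F ` E) \<le> ennreal p * emeasure lborel E"
    using emeasure_image_slope_below[OF lip injF monoF _ E(1) FE] p E(2) by auto
  have "emeasure lborel (G ` F ` E) \<le> ennreal (1/q) * emeasure lborel (F ` E)"
  proof (rule emeasure_image_le[OF G(3) injG FE])
    show "G ` F ` E \<in> sets borel" using E(1) GFE by simp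
    show "0 \<le> 1/q" using q by simp
    fix y d :: real assume "y \<in> F ` E" "d > 0"
    then obtain x where x: "y = F x" "x \<in> E" by auto
    \<comment> \<open>The ball for \<open>G\<close> has radius \<open>|k|/2\<close> with
      \<open>|k| \<le> M |h|\<close>, so \<open>h\<close> is taken short enough to bring
      \<open>|k|\<close> below \<open>d\<close>; the \<open>+1\<close> keeps the divisor
      positive.\<close>
    have "d / (M+1) > 0" using M \<open>d > 0\<close> by simp
    then obtain n where n: "inverse (Suc n) < d / (M+1)" using reals_Archimedean by blast
    obtain h where h: "0 < \<bar>h\<bar>" "\<bar>h\<bar> < inverse (Suc n)" "(F (x + h) - F x) / h > q"
      using x E(2) by (force simp: slope_above_def)
    define k where "k = F (x+h) - F x"
    have Gk: "G (y + k) - G y = h" by (simp add: k_def x G)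
    have qk: "\<bar>h\<bar> \<le> (1/q) * \<bar>k\<bar>" using h q monoD[OF monoF, of x "x+h"] monoD[OF monoF, of "x+h" x]
      by (cases "h > 0") (auto simp: field_simps k_def)
    then have kpos: "\<bar>k\<bar> > 0" using h by auto
    have "\<bar>k\<bar> \<le> M * \<bar>h\<bar>" using lipschitz_onD[OF lip, of "x+h" x] by (auto simp: k_def dist_real_def)
    also have "\<dots> \<le> (M+1) * \<bar>h\<bar>" using h by (simp add: mult_right_mono)
    also have "\<dots> < (M+1) * (d / (M+1))" using h n M by (intro mult_strict_left_mono) auto
    also have "\<dots> = d" using M by simp
    finally have kd: "\<bar>k\<bar> < d" .
    obtain c' where "G ` cball (y + k/2) (\<bar>k\<bar>/2) \<subseteq> cball c' (1/q * (\<bar>k\<bar>/2))"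
      using mono_image_cball[OF monoG, of y k "1/q"] Gk qk by auto
    moreover have "0 < \<bar>k\<bar>/2" "\<bar>k\<bar>/2 < d" "y \<in> cball (y + k/2) (\<bar>k\<bar>/2)"
      using kd kpos by (auto simp: dist_real_def)
    ultimately show "\<exists>c r c'. 0 < r \<and> r < d \<and> y \<in> cball c r \<and> G ` cball c r \<subseteq> cball c' (1/q * r)"
      by blast
  qed
  then have "emeasure lborel E \<le> ennreal (1/q) * (ennreal p * emeasure lborel E)"
    unfolding GFE using 1 by (meson mult_left_mono order_trans zero_le)
  then have 2: "emeasure lborel E \<le> ennreal (p/q) * emeasure lborel E"
    using p q by (simp add: ennreal_mult[symmetric] mult.assoc[symmetric])
  obtain r where r: "emeasure lborel E = ennreal r" "r \<ge> 0" using fin by (cases "emeasure lborel E") auto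
  have "r \<le> p/q * r" using 2 r p q by (simp add: ennreal_mult[symmetric])
  then have "r * (q - p) \<le> 0" using q by (simp add: field_simps)
  then have "r = 0" using r pq by (simp add: mult_le_0_iff)
  then show ?thesis using r by simp
qed simp

lemma slope_sets_borel:
  fixes f :: "real \<Rightarrow> real"
  assumes "continuous_on UNIV f"
  shows "slope_below f p \<in> sets borel" "slope_above f p \<in> sets borel"
proof -
  have cont: "continuous_on UNIV (\<lambda>x. (f (x+h) - f x)/h)" if "h \<noteq> 0" for h
    using that assms by (intro continuous_intros continuous_on_compose2[OF assms]) auto
  have "slope_below f p = (\<Inter>n. \<Union>h\<in>{h. 0 < \<bar>h\<bar> \<and> \<bar>h\<bar> < inverse (Suc n)}. {x. (f (x + h) - f x) / h < p})"
    by (auto simp: slope_below_def)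
  also have "\<dots> \<in> sets borel"
    by (intro sets.countable_INT image_subsetI borel_open open_UN ballI open_Collect_less cont continuous_on_const) auto
  finally show "slope_below f p \<in> sets borel" .
  have "slope_above f p = (\<Inter>n. \<Union>h\<in>{h. 0 < \<bar>h\<bar> \<and> \<bar>h\<bar> < inverse (Suc n)}. {x. (f (x + h) - f x) / h > p})"
    by (auto simp: slope_above_def)
  also have "\<dots> \<in> sets borel"
    by (intro sets.countable_INT image_subsetI borel_open open_UN ballI open_Collect_less cont continuous_on_const) auto
  finally show "slope_above f p \<in> sets borel" .
qed

text \<open>Adding \<open>(L + 1) x\<close> makes the function grow at rate at least 1 and shifts
  every slope by \<open>L + 1\<close>, so the gap survives; the windows \<open>[-n, n]\<close>
  provide finite measure.\<close>

lemma null_slope_gap: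
  fixes f :: "real \<Rightarrow> real"
  assumes lip: "L-lipschitz_on UNIV f" and pq: "p < q"
  shows "emeasure lborel (slope_below f p \<inter> slope_above f q) = 0"
proof -
  have L: "L \<ge> 0" using lip by (auto simp: lipschitz_on_def)
  define F where "F x = f x + (L+1) * x" for x
  have lipF: "(L + (L+1))-lipschitz_on UNIV F"
  proof (rule lipschitz_onI)
    fix x y :: real
    have "\<bar>f x - f y\<bar> \<le> L * \<bar>x - y\<bar>" using lipschitz_onD[OF lip, of x y] by (simp add: dist_real_def)
    moreover have "\<bar>(L+1) * x - (L+1) * y\<bar> = (L+1) * \<bar>x - y\<bar>" using L
      by (simp add: abs_mult right_diff_distrib[symmetric])
    moreover have "(L + (L+1)) * \<bar>x - y\<bar> = L * \<bar>x - y\<bar> + (L+1) * \<bar>x - y\<bar>" by (simp add: distrib_right)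
    ultimately show "dist (F x) (F y) \<le> (L + (L+1)) * dist x y"
      unfolding F_def dist_real_def by linarith
  qed (use L in simp)
  have lowF: "y - x \<le> F y - F x" if "x \<le> y" for x y
    using lipschitz_onD[OF lip, of x y] that by (auto simp: F_def dist_real_def algebra_simps abs_le_iff)
  have "(F (x + h) - F x) / h = (f (x + h) - f x) / h + (L+1)" if "h \<noteq> 0" for x h
    using that by (simp add: F_def field_simps)
  then have sb: "slope_below F (p+(L+1)) = slope_below f p" "slope_above F (q+(L+1)) = slope_above f q"
    by (simp_all add: slope_below_def slope_above_def cong: conj_cong)
  have cont: "continuous_on UNIV f" by (rule lipschitz_on_continuous_on[OF lip])
  define E where "E = slope_below f p \<inter> slope_above f q"
  have E: "E \<in> sets borel" unfolding E_def using slope_sets_borel[OF cont] by blast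
  have nul: "emeasure lborel (E \<inter> {-real n..real n}) = 0" for n
  proof (rule null_slope_gap_mono[OF lipF lowF, where p="p+(L+1)" and q="q+(L+1)"])
    show "E \<inter> {- real n..real n} \<in> sets borel" using E by auto
    show "E \<inter> {- real n..real n} \<subseteq> slope_below F (p + (L + 1)) \<inter> slope_above F (q + (L + 1))"
      using sb by (auto simp: E_def)
    have "emeasure lborel (E \<inter> {- real n..real n}) \<le> emeasure lborel {- real n..real n}"
      by (intro emeasure_mono) auto
    also have "\<dots> < \<infinity>" by simp
    finally show "emeasure lborel (E \<inter> {- real n..real n}) < \<infinity>" .
  qed (use pq in auto)
  have "E = (\<Union>n. E \<inter> {-real n..real n})"
  proof
    show "E \<subseteq> (\<Union>n. E \<inter> {-real n..real n})"
    proof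
      fix x assume "x \<in> E"
      obtain n where "\<bar>x\<bar> \<le> real n" using real_arch_simple by blast
      then show "x \<in> (\<Union>n. E \<inter> {-real n..real n})" using \<open>x \<in> E\<close> by (auto intro!: exI[of _ n])
    qed
  qed auto
  also have "emeasure lborel \<dots> = 0"
    by (rule emeasure_UN_eq_0) (use nul E in auto)
  finally show ?thesis by (simp add: E_def)
qed

text \<open>The infimum \<open>D\<close> of the levels \<open>p\<close> with \<open>x\<close> in
  \<open>slope_below f p\<close> is the lower derivate. If quotients exceeded \<open>D\<close> by a
  fixed amount at arbitrarily small scales, two rationals would fit into the gap.\<close>

lemma differentiable_if_no_slope_gap:
  fixes f :: "real \<Rightarrow> real"
  assumes lip: "L-lipschitz_on UNIV f"
    and gap: "\<And>p q. p \<in> \<rat> \<Longrightarrow> q \<in> \<rat> \<Longrightarrow> p < q \<Longrightarrow> x \<notin> slope_below f p \<inter> slope_above f q"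
  shows "\<exists>D. (f has_real_derivative D) (at x)"
proof -
  define Q where "Q h = (f (x+h) - f x)/h" for h
  have bd: "\<bar>Q h\<bar> \<le> L" if "h \<noteq> 0" for h
    using lipschitz_onD[OF lip, of "x+h" x] that by (auto simp: Q_def dist_real_def abs_divide field_simps)
  define A where "A = {p. x \<in> slope_below f p}"
  have up: "p' \<in> A" if "p \<in> A" "p \<le> p'" for p p'
    using that unfolding A_def slope_below_def by (force intro: order.strict_trans2)
  have "\<exists>h::real. 0 < \<bar>h\<bar> \<and> \<bar>h\<bar> < inverse (real (Suc n))" for n
    by (intro exI[of _ "inverse (real (Suc n))/2"]) (simp add: divide_simps)
  then have "\<exists>h. 0 < \<bar>h\<bar> \<and> \<bar>h\<bar> < inverse (real (Suc n)) \<and> Q h < L + 1" for n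
    using bd by (fastforce simp: abs_le_iff)
  then have ne: "L + 1 \<in> A" by (auto simp: A_def slope_below_def Q_def)
  have lb: "-L \<le> p" if "p \<in> A" for p
  proof (rule ccontr)
    assume "\<not> -L \<le> p"
    obtain h where "0 < \<bar>h\<bar>" "Q h < p" using \<open>p \<in> A\<close> unfolding A_def slope_below_def Q_def by blast
    then show False using bd[of h] \<open>\<not> -L \<le> p\<close> by auto
  qed
  have bdd: "bdd_below A" using lb by (auto simp: bdd_below_def)
  define D where "D = Inf A"
  have "((\<lambda>h. Q h) \<longlongrightarrow> D) (at 0)"
  proof (rule LIM_I)
    fix e :: real assume e: "e > 0"
    have "Inf A < D + e/3" using e by (simp add: D_def)
    then obtain p0 where p0: "p0 \<in> A" "p0 < D + e/3" using cInf_less_iff[OF _ bdd] ne by blast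
    obtain p where p: "p \<in> \<rat>" "D + e/3 < p" "p < D + 2*e/3" using Rats_dense_in_real[of "D+e/3" "D+2*e/3"] e by auto
    obtain q where q: "q \<in> \<rat>" "p < q" "q < D + e" using Rats_dense_in_real[of p "D+e"] p e by auto
    have "x \<in> slope_below f p" using up[OF p0(1), of p] p0 p by (auto simp: A_def)
    then have "x \<notin> slope_above f q" using gap[of p q] p q by auto
    then have "\<exists>n. \<forall>h. 0 < \<bar>h\<bar> \<and> \<bar>h\<bar> < inverse (Suc n) \<longrightarrow> Q h \<le> q"
      unfolding slope_above_def Q_def mem_Collect_eq by (meson not_less)
    then obtain n where n: "\<And>h. 0 < \<bar>h\<bar> \<Longrightarrow> \<bar>h\<bar> < inverse (Suc n) \<Longrightarrow> Q h \<le> q" by blast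
    have "D - e/2 \<notin> A" using cInf_lower[OF _ bdd, of "D - e/2"] e by (auto simp: D_def)
    then have "\<exists>n. \<forall>h. 0 < \<bar>h\<bar> \<and> \<bar>h\<bar> < inverse (Suc n) \<longrightarrow> Q h \<ge> D - e/2"
      unfolding A_def slope_below_def Q_def mem_Collect_eq by (meson not_less)
    then obtain m where m: "\<And>h. 0 < \<bar>h\<bar> \<Longrightarrow> \<bar>h\<bar> < inverse (Suc m) \<Longrightarrow> Q h \<ge> D - e/2" by blast
    show "\<exists>s>0. \<forall>h. h \<noteq> 0 \<and> norm (h - 0) < s \<longrightarrow> norm (Q h - D) < e"
    proof (intro exI[of _ "min (inverse (real (Suc n))) (inverse (real (Suc m)))"] conjI allI impI)
      fix h :: real assume h: "h \<noteq> 0 \<and> norm (h - 0) < min (inverse (real (Suc n))) (inverse (real (Suc m)))"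
      then have "Q h \<le> q" "Q h \<ge> D - e/2" using n[of h] m[of h] by auto
      then show "norm (Q h - D) < e" using q e by auto
    qed auto
  qed
  then show ?thesis unfolding DERIV_def Q_def by blast
qed

lemma Union_slope_gap_null:
  fixes f :: "real \<Rightarrow> real"
  assumes lip: "L-lipschitz_on UNIV f"
  shows "(\<Union>(p,q)\<in>{(p,q). p \<in> \<rat> \<and> q \<in> \<rat> \<and> p < q}. slope_below f p \<inter> slope_above f q) \<in> null_sets lborel"
proof (rule null_sets_UN')
  have "countable ((\<rat>::real set) \<times> (\<rat>::real set))" using countable_rat by (intro countable_SIGMA) 
  then show "countable {(p,q). (p::real) \<in> \<rat> \<and> q \<in> \<rat> \<and> p < q}" by (rule countable_subset[rotated]) auto
  fix pq assume "pq \<in> {(p,q). (p::real) \<in> \<rat> \<and> q \<in> \<rat> \<and> p < q}"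
  then show "(case pq of (p, q) \<Rightarrow> slope_below f p \<inter> slope_above f q) \<in> null_sets lborel"
    using null_slope_gap[OF lip] slope_sets_borel[OF lipschitz_on_continuous_on[OF lip]]
    by (auto simp: null_sets_def)
qed

theorem lipschitz_AE_differentiable:
  fixes f :: "real \<Rightarrow> real"
  assumes lip: "L-lipschitz_on UNIV f"
  shows "AE x in lborel. \<exists>D. (f has_real_derivative D) (at x)"
  by (rule AE_I'[OF Union_slope_gap_null[OF lip]]) (use differentiable_if_no_slope_gap[OF lip] in blast)

text \<open>The increasing function \<open>F x = (L + 1) x - f x\<close> has derivative at most
  \<open>L + 1\<close> off a null set whose image is null, so it maps \<open>[a, b]\<close> onto an
  interval of length at most \<open>(L + 1) (b - a)\<close>. That length is
  \<open>F b - F a\<close>, which leaves \<open>f a \<le> f b\<close>. The covering estimate thus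
  replaces integration of the derivative.\<close>

lemma lipschitz_AE_deriv_nonneg_imp_mono:
  fixes f :: "real \<Rightarrow> real"
  assumes lip: "L-lipschitz_on UNIV f"
    and ae: "AE x in lborel. \<exists>D\<ge>0. (f has_real_derivative D) (at x)"
  shows "mono f"
proof (rule monoI)
  fix a b :: real assume ab: "a \<le> b"
  have L: "L \<ge> 0" using lip by (auto simp: lipschitz_on_def)
  define F where "F x = (L+1) * x - f x" for x
  have lipF: "((L+1)+L)-lipschitz_on UNIV F"
  proof (rule lipschitz_onI)
    fix x y :: real
    have "\<bar>f x - f y\<bar> \<le> L * \<bar>x - y\<bar>" using lipschitz_onD[OF lip, of x y] by (simp add: dist_real_def)
    moreover have "\<bar>(L+1) * x - (L+1) * y\<bar> = (L+1) * \<bar>x - y\<bar>" using L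
      by (simp add: abs_mult right_diff_distrib[symmetric])
    moreover have "((L+1)+L) * \<bar>x - y\<bar> = L * \<bar>x - y\<bar> + (L+1) * \<bar>x - y\<bar>" by (simp add: distrib_right)
    ultimately show "dist (F x) (F y) \<le> ((L+1)+L) * dist x y"
      unfolding F_def dist_real_def by linarith
  qed (use L in simp)
  have lowF: "y - x \<le> F y - F x" if "x \<le> y" for x y
    using lipschitz_onD[OF lip, of x y] that by (auto simp: F_def dist_real_def algebra_simps abs_le_iff)
  obtain G where G: "\<And>x. G (F x) = x" "\<And>y. F (G y) = y" "1-lipschitz_on UNIV G"
    using bilipschitz_inverse[OF lipF lowF] by blast
  have injF: "inj F" using G(1) by (metis injI)
  have monoF: "mono F" using lowF by (force intro!: monoI)
  obtain N where N: "{x. \<not> (\<exists>D\<ge>0. (f has_real_derivative D) (at x))} \<subseteq> N" "N \<in> null_sets lborel"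
    using ae by (force elim!: AE_E simp: null_sets_def)
  define E where "E = {a..b} - N"
  have E: "E \<in> sets borel" using N by (auto simp: E_def null_sets_def)
  have FE: "F ` E \<in> sets borel"
    by (rule continuous_image_inverse_borel[OF G(1,2) lipschitz_on_continuous_on[OF G(3)] E])
  have negN: "negligible N" using N(2) by (simp add: negligible_iff_null_sets null_sets_completionI)
  have "negligible (F ` N)"
  proof (rule negligible_locally_Lipschitz_image[OF _ negN])
    fix x assume "x \<in> N"
    show "\<exists>T B. open T \<and> x \<in> T \<and> (\<forall>y\<in>N \<inter> T. norm (F y - F x) \<le> B * norm (y - x))"
      using lipschitz_onD[OF lipF] by (intro exI[of _ UNIV] exI[of _ "(L+1)+L"]) (auto simp: dist_norm)
  qed simp
  then have FN: "F ` N \<in> null_sets lebesgue" by (simp add: negligible_iff_null_sets)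
  have cube: "{F a..F b} \<subseteq> F ` E \<union> F ` N"
  proof
    fix y assume y: "y \<in> {F a..F b}"
    have "a \<le> G y" using y lowF[of "G y" a] by (force simp: G)
    moreover have "G y \<le> b" using y lowF[of b "G y"] by (force simp: G)
    ultimately have "G y \<in> E \<union> N" by (auto simp: E_def)
    then have "F (G y) \<in> F ` E \<union> F ` N" by blast
    then show "y \<in> F ` E \<union> F ` N" by (simp add: G)
  qed
  \<comment> \<open>The slack \<open>e\<close> is due to the strict inequality in
    \<open>slope_below\<close>: the derivative \<open>L + 1 - D\<close> of \<open>F\<close> may
    equal \<open>L + 1\<close>.\<close>
  have slope: "E \<subseteq> slope_below F (L + 1 + e)" if e: "e > 0" for e
  proof
    fix x assume "x \<in> E"
    then obtain D where D: "D \<ge> 0" "(f has_real_derivative D) (at x)" using N(1) by (auto simp: E_def)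
    have "(F has_real_derivative (L+1) - D) (at x)"
      unfolding F_def by (auto intro!: derivative_eq_intros D(2))
    then have "((\<lambda>h. (F (x + h) - F x) / h) \<longlongrightarrow> (L+1) - D) (at 0)" by (simp add: DERIV_def)
    from LIM_D[OF this e] obtain s where s: "s > 0"
       "\<And>h. h \<noteq> 0 \<Longrightarrow> \<bar>h\<bar> < s \<Longrightarrow> \<bar>(F (x + h) - F x) / h - (L + 1 - D)\<bar> < e" by auto
    have "\<exists>h. 0 < \<bar>h\<bar> \<and> \<bar>h\<bar> < inverse (Suc n) \<and> (F (x + h) - F x) / h < L + 1 + e" for n
    proof -
      define h where "h = min s (inverse (real (Suc n))) / 2"
      have h: "0 < h" "h < s" "h < inverse (real (Suc n))" using s(1) by (auto simp: h_def min_def field_simps)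
      have "\<bar>(F (x + h) - F x) / h - (L + 1 - D)\<bar> < e" using s(2)[of h] h by auto
      then show ?thesis using h D(1) by (intro exI[of _ h]) (auto simp: abs_less_iff)
    qed
    then show "x \<in> slope_below F (L + 1 + e)" by (auto simp: slope_below_def)
  qed
  have "f a - f b \<le> e * (b - a)" if e: "e > 0" for e
  proof -
    have "ennreal (F b - F a) = emeasure lebesgue {F a..F b}" using monoD[OF monoF ab] by simp
    also have "\<dots> \<le> emeasure lebesgue (F ` E \<union> F ` N)"
      by (intro emeasure_mono cube) (use FE FN in auto)
    also have "\<dots> = emeasure lebesgue (F ` E)"
      by (intro emeasure_Un_null_set FN) (use FE in auto)
    also have "\<dots> = emeasure lborel (F ` E)" using FE by simp
    also have "\<dots> \<le> ennreal (L+1+e) * emeasure lborel E"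
      using emeasure_image_slope_below[OF lipF injF monoF _ E FE slope[OF e]] L e by simp
    also have "\<dots> \<le> ennreal (L+1+e) * emeasure lborel {a..b}"
      by (intro mult_left_mono emeasure_mono) (auto simp: E_def)
    also have "\<dots> = ennreal ((L+1+e) * (b - a))" using ab L e by (simp add: ennreal_mult)
    finally have "F b - F a \<le> (L+1+e) * (b-a)" using ab L e by (subst (asm) ennreal_le_iff) auto
    then show ?thesis by (simp add: F_def algebra_simps)
  qed
  then show "f a \<le> f b"
  proof (cases "a = b")
    case False
    with ab have "b - a > 0" by simp
    show ?thesis
    proof (rule field_le_epsilon)
      fix e :: real assume "e > 0"
      then show "f a \<le> f b + e" using \<open>\<And>e. e > 0 \<Longrightarrow> f a - f b \<le> e * (b - a)\<close>[of "e/(b-a)"] \<open>b - a > 0\<close> by simp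
    qed
  qed simp
qed

section \<open>The discrete scheme\<close>

definition diff2 :: "real \<Rightarrow> (real \<Rightarrow> real) \<Rightarrow> real \<Rightarrow> real" where
  "diff2 h f x = f (x + h) - 2 * f x + f (x - h)"

lemma abs_diff_le_of_deriv_bound:
  fixes f f' :: "real \<Rightarrow> real"
  assumes "\<And>x. (f has_real_derivative f' x) (at x)" "\<And>x. \<bar>f' x\<bar> \<le> B"
  shows "\<bar>f x - f y\<bar> \<le> B * \<bar>x - y\<bar>"
proof -
  have "norm (f x - f y) \<le> B * norm (x - y)"
    by (rule field_differentiable_bound[of UNIV f f']) (use assms in \<open>auto intro: DERIV_subset\<close>)
  then show ?thesis by simp
qed

text \<open>Two mean value steps, for the forward difference \<open>g\<close> and then for
  \<open>f1\<close>; the intermediate point stays within \<open>h\<close> of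
  \<open>x\<close>.\<close>

lemma diff2_mean_value:
  fixes f f1 f2 :: "real \<Rightarrow> real"
  assumes d1: "\<And>y. \<bar>y - x\<bar> \<le> h \<Longrightarrow> (f has_real_derivative f1 y) (at y)"
    and d2: "\<And>y. \<bar>y - x\<bar> \<le> h \<Longrightarrow> (f1 has_real_derivative f2 y) (at y)" and h: "h > 0"
  shows "\<exists>z. \<bar>z - x\<bar> \<le> h \<and> diff2 h f x = h\<^sup>2 * f2 z"
proof -
  define g where "g y = f (y + h) - f y" for y
  have "(g has_real_derivative f1 (y + h) - f1 y) (at y)" if "x - h \<le> y" "y \<le> x" for y
    unfolding g_def using that h
    by (auto intro!: derivative_eq_intros d1 DERIV_shift[THEN iffD1, of f _ y h] simp: abs_le_iff)
  then obtain y where y: "x - h < y" "y < x" "g x - g (x - h) = (x - (x - h)) * (f1 (y + h) - f1 y)"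
    using MVT2[of "x - h" x g "\<lambda>y. f1 (y+h) - f1 y"] h by auto
  have "\<exists>z>y. z < y + h \<and> f1 (y + h) - f1 y = (y + h - y) * f2 z"
    by (rule MVT2) (use h y in \<open>auto intro!: d2\<close>)
  then obtain z where z: "y < z" "z < y + h" "f1 (y + h) - f1 y = h * f2 z" by auto
  have "diff2 h f x = g x - g (x - h)" by (simp add: diff2_def g_def)
  also have "\<dots> = h\<^sup>2 * f2 z" using y(3) z(3) by (simp add: power2_eq_square)
  finally show ?thesis using y z h by (intro exI[of _ z]) auto
qed

text \<open>Iterated on functions of a real variable instead of grid sequences, so that the step
  commutes with differentiation and bounds on derivatives of the datum pass to all iterates.\<close>

fun heat_iter :: "real \<Rightarrow> real \<Rightarrow> nat \<Rightarrow> (real \<Rightarrow> real) \<Rightarrow> real \<Rightarrow> real" where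
  "heat_iter h c 0 f = f"
| "heat_iter h c (Suc n) f = (\<lambda>x. heat_iter h c n f x + c * diff2 h (heat_iter h c n f) x)"

text \<open>For \<open>c \<le> 1/2\<close> a step is a convex combination of three values.\<close>

lemma heat_iter_bound:
  assumes c: "0 \<le> c" "c \<le> 1/2" and B: "\<And>x. \<bar>f x\<bar> \<le> B"
  shows "\<bar>heat_iter h c n f x\<bar> \<le> B"
proof (induction n arbitrary: x)
  case (Suc n)
  let ?g = "heat_iter h c n f"
  have "heat_iter h c (Suc n) f x = (1 - 2*c) * ?g x + c * ?g (x + h) + c * ?g (x - h)"
    by (simp add: diff2_def algebra_simps)
  also have "\<bar>\<dots>\<bar> \<le> \<bar>(1 - 2*c) * ?g x\<bar> + \<bar>c * ?g (x + h)\<bar> + \<bar>c * ?g (x - h)\<bar>" by linarith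
  also have "\<dots> \<le> (1 - 2*c) * B + c * B + c * B"
    unfolding abs_mult using c Suc by (intro add_mono mult_mono) auto
  finally show ?case by (simp add: algebra_simps)
qed (use B in simp)

lemma heat_iter_deriv:
  assumes "\<And>x. (f has_real_derivative f' x) (at x)"
  shows "(heat_iter h c n f has_real_derivative heat_iter h c n f' x) (at x)"
proof (induction n arbitrary: x)
  case (Suc n)
  have 1: "((\<lambda>x. heat_iter h c n f (x + h)) has_real_derivative heat_iter h c n f' (x + h)) (at x)"
    using Suc[of "x+h"] by (simp add: DERIV_shift)
  have 2: "((\<lambda>x. heat_iter h c n f (x - h)) has_real_derivative heat_iter h c n f' (x - h)) (at x)"
    using Suc[of "x-h"] DERIV_shift[of "heat_iter h c n f" _ x "-h"] by simp
  show ?case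
    unfolding heat_iter.simps diff2_def
    by (auto intro!: derivative_eq_intros Suc 1 2)
qed (use assms in simp)

text \<open>Changing a denominator from \<open>u\<close> to \<open>v\<close> costs
  \<open>-\<alpha> (v - u)\<close> with \<open>|\<alpha>| = |A| / (4 u v)\<close>; as
  \<open>u, v \<ge> 2 e\<close>, the constant 16 makes this at most \<open>l\<close>. The difference
  of the two sides is a combination of \<open>bp - ap\<close>, \<open>b - a\<close>,
  \<open>bm - am\<close> with weights \<open>l - \<alpha>\<close>,
  \<open>1 - 2 l - \<alpha> + \<beta>\<close>, \<open>l + \<beta>\<close>, nonnegative because
  \<open>4 l \<le> 1\<close>.\<close>

lemma diff2_quotient_monotone_flux:
  fixes a b :: "real"
  assumes e: "e > 0" and l: "0 \<le> l" "4 * l \<le> 1"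
    and A: "\<bar>A1\<bar> \<le> 16 * l * e\<^sup>2" "\<bar>A0\<bar> \<le> 16 * l * e\<^sup>2"
    and a: "e \<le> ap" "e \<le> a" "e \<le> am" and ab: "ap \<le> bp" "a \<le> b" "am \<le> bm"
  shows "a + l * (ap - 2*a + am) + 1/4 * (A1 / (ap + a) - A0 / (a + am))
       \<le> b + l * (bp - 2*b + bm) + 1/4 * (A1 / (bp + b) - A0 / (b + bm))"
proof -
  have key: "\<exists>\<alpha>. \<bar>\<alpha>\<bar> \<le> l \<and> 1/4 * (A / v - A / u) = - \<alpha> * (v - u)"
    if "2*e \<le> u" "u \<le> v" "\<bar>A\<bar> \<le> 16 * l * e\<^sup>2" for A u v
  proof (intro exI[of _ "A / (4 * u * v)"] conjI)
    have uv: "0 < u" "0 < v" using that e by auto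
    have "(2*e) * (2*e) \<le> u * v" using that e by (intro mult_mono) auto
    then have "l * (4 * e\<^sup>2) \<le> l * (u * v)" using l by (intro mult_left_mono) (auto simp: power2_eq_square)
    then have "\<bar>A\<bar> \<le> l * (4 * u * v)" using that(3) by (simp add: algebra_simps)
    then show "\<bar>A / (4 * u * v)\<bar> \<le> l" using uv by (simp add: abs_divide abs_mult pos_divide_le_eq)
    show "1/4 * (A / v - A / u) = - (A / (4 * u * v)) * (v - u)" using uv by (simp add: field_simps)
  qed
  obtain \<alpha> where 1: "\<bar>\<alpha>\<bar> \<le> l" "1/4 * (A1 / (bp + b) - A1 / (ap + a)) = - \<alpha> * ((bp + b) - (ap + a))"
    using key[of "ap + a" "bp + b" A1] a ab A by auto
  obtain \<beta> where 2: "\<bar>\<beta>\<bar> \<le> l" "1/4 * (A0 / (b + bm) - A0 / (a + am)) = - \<beta> * ((b + bm) - (a + am))"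
    using key[of "a + am" "b + bm" A0] a ab A by auto
  have "0 \<le> (l - \<alpha>) * (bp - ap) + (1 - 2*l - \<alpha> + \<beta>) * (b - a) + (l + \<beta>) * (bm - am)"
  proof -
    have "0 \<le> (l - \<alpha>) * (bp - ap)" "0 \<le> (1 - 2*l - \<alpha> + \<beta>) * (b - a)" "0 \<le> (l + \<beta>) * (bm - am)"
      using 1(1) 2(1) l ab by (auto simp: abs_le_iff)
    then show ?thesis by linarith
  qed
  also have "\<dots> = (b + l * (bp - 2*b + bm)) - (a + l * (ap - 2*a + am))
      + 1/4 * (A1 / (bp + b) - A1 / (ap + a)) - 1/4 * (A0 / (b + bm) - A0 / (a + am))"
    unfolding 1(2) 2(2) by (simp add: algebra_simps)
  finally show ?thesis by (simp add: algebra_simps)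
qed

text \<open>The same linearisation for \<open>K\<close> itself. The central difference skips the
  middle value, whose weight is therefore \<open>1 - 2 l\<close>; the numerator \<open>G\<close> is
  common to both sides because it depends on \<open>R\<close> alone.\<close>

lemma diff2_quotient_monotone:
  fixes a b :: "real"
  assumes e: "e > 0" and l: "0 \<le> l" "4 * l \<le> 1"
    and G: "\<bar>G\<bar> \<le> 16 * l * e\<^sup>2"
    and a: "2 * e \<le> ap - am" "2 * e \<le> bp - bm" and ab: "ap \<le> bp" "a \<le> b" "am \<le> bm"
  shows "a + l * (ap - 2*a + am) + 1/4 * (G / (ap - am)) \<le> b + l * (bp - 2*b + bm) + 1/4 * (G / (bp - bm))"
proof -
  define u v where "u = ap - am" and "v = bp - bm"
  have uv: "0 < u" "0 < v" using a e by (auto simp: u_def v_def)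
  define \<alpha> where "\<alpha> = G / (4 * u * v)"
  have "(2*e) * (2*e) \<le> u * v" using a e by (intro mult_mono) (auto simp: u_def v_def)
  then have "l * (4 * e\<^sup>2) \<le> l * (u * v)" using l by (intro mult_left_mono) (auto simp: power2_eq_square)
  then have "\<bar>G\<bar> \<le> l * (4 * u * v)" using G by (simp add: algebra_simps)
  then have \<alpha>: "\<bar>\<alpha>\<bar> \<le> l" using uv by (simp add: \<alpha>_def abs_divide abs_mult pos_divide_le_eq)
  have eq: "1/4 * (G / v - G / u) = - \<alpha> * (v - u)" using uv by (simp add: \<alpha>_def field_simps)
  have "0 \<le> (l - \<alpha>) * (bp - ap) + (1 - 2*l) * (b - a) + (l + \<alpha>) * (bm - am)"
  proof -
    have "0 \<le> (l - \<alpha>) * (bp - ap)" "0 \<le> (1 - 2*l) * (b - a)" "0 \<le> (l + \<alpha>) * (bm - am)"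
      using \<alpha> l ab by (auto simp: abs_le_iff)
    then show ?thesis by linarith
  qed
  also have "\<dots> = (b + l * (bp - 2*b + bm)) - (a + l * (ap - 2*a + am)) + 1/4 * (G / v - G / u)"
    unfolding eq by (simp add: u_def v_def algebra_simps)
  finally show ?thesis by (simp add: algebra_simps u_def v_def)
qed

section \<open>The scheme and its bounds uniform in the mesh\<close>

locale scheme =
  fixes s C L :: real and f0 f1 f2 f3 f4 k0 :: "real \<Rightarrow> real"
  assumes s: "0 < s" "s \<le> 1/2" and C: "C \<ge> 1" and L: "L \<ge> 0"
    and f0: "\<And>x. (f0 has_real_derivative f1 x) (at x)"
    and f1: "\<And>x. (f1 has_real_derivative f2 x) (at x)"
    and f2: "\<And>x. (f2 has_real_derivative f3 x) (at x)"
    and f3: "\<And>x. (f3 has_real_derivative f4 x) (at x)"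
    and f1_bound: "\<And>x. \<bar>f1 x\<bar> \<le> C" and f2_bound: "\<And>x. \<bar>f2 x\<bar> \<le> C"
    and f3_bound: "\<And>x. \<bar>f3 x\<bar> \<le> C" and f4_bound: "\<And>x. \<bar>f4 x\<bar> \<le> C"
    and k0_lower: "\<And>x y. x \<le> y \<Longrightarrow> \<bar>f0 y - f0 x\<bar> \<le> k0 y - k0 x"
    and k0_upper: "\<And>x y. x \<le> y \<Longrightarrow> k0 y - k0 x \<le> L * (y - x)"
begin

text \<open>Monotonicity asks for \<open>|m(x)^2 - m(x-h)^2| \<le> 16 l e^2\<close>. The left side
  is at most \<open>2 C^2 h^3\<close>, the right side equals \<open>16 C^2 s^4 h^2\<close>, and
  \<open>h = s^4\<close> balances the powers. The slope floor \<open>e / h = C s\<close> and the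
  effective viscosity \<open>l h^2 / \<tau> = 4 s^2\<close> both vanish with
  \<open>s\<close>.\<close>

definition "h = s^4"
definition "\<tau> = h\<^sup>2 / 4"
definition "l = s\<^sup>2"
definition "e = C * s * h"
definition "cf = 1/4 + l"

abbreviation "R n \<equiv> heat_iter h cf n f0"
abbreviation "R1 n \<equiv> heat_iter h cf n f1"
abbreviation "R2 n \<equiv> heat_iter h cf n f2"
abbreviation "R3 n \<equiv> heat_iter h cf n f3"
abbreviation "R4 n \<equiv> heat_iter h cf n f4"

text \<open>The tilt \<open>C s x\<close> adds exactly \<open>e\<close> to every initial increment.
  The factor 1/4 is \<open>\<tau> / h^2\<close>, the factors \<open>2 h\<close> of the two central
  differences having cancelled.\<close>

fun K :: "nat \<Rightarrow> real \<Rightarrow> real" where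
  "K 0 x = k0 x + C * s * x"
| "K (Suc n) x = K n x + l * diff2 h (K n) x
     + 1/4 * (diff2 h (R n) x * (R n (x + h) - R n (x - h)) / (K n (x + h) - K n (x - h)))"

declare K.simps(2) [simp del]

definition "m n x = R n (x + h) - R n x"
definition "\<theta> n x = K n (x + h) - K n x"
definition "q n x = sqrt ((m n x)\<^sup>2 + e\<^sup>2)"

lemma h_pos: "0 < h" and tau_pos: "0 < \<tau>" and l_pos: "0 < l" and e_pos: "0 < e"
  using s C by (auto simp: h_def \<tau>_def l_def e_def)

lemma l_le: "4 * l \<le> 1"
proof -
  have "s\<^sup>2 \<le> (1/2)\<^sup>2" using s by (intro power_mono) auto
  then show ?thesis by (simp add: l_def power2_eq_square)
qed

lemma cf: "0 \<le> cf" "cf \<le> 1/2" using l_pos l_le by (auto simp: cf_def)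

lemma R_deriv: "(R n has_real_derivative R1 n x) (at x)" "(R1 n has_real_derivative R2 n x) (at x)"
  "(R2 n has_real_derivative R3 n x) (at x)" "(R3 n has_real_derivative R4 n x) (at x)"
  by (intro heat_iter_deriv f0 f1 f2 f3)+

lemma R_bound: "\<bar>R1 n x\<bar> \<le> C" "\<bar>R2 n x\<bar> \<le> C" "\<bar>R3 n x\<bar> \<le> C" "\<bar>R4 n x\<bar> \<le> C"
  by (intro heat_iter_bound cf f1_bound f2_bound f3_bound f4_bound)+

lemma R_lip: "\<bar>R n x - R n y\<bar> \<le> C * \<bar>x - y\<bar>" "\<bar>R1 n x - R1 n y\<bar> \<le> C * \<bar>x - y\<bar>" "\<bar>R2 n x - R2 n y\<bar> \<le> C * \<bar>x - y\<bar>"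
  by (rule abs_diff_le_of_deriv_bound, rule R_deriv, rule R_bound)+

lemma diff2_R_bound: "\<bar>diff2 d (R n) x\<bar> \<le> C * d\<^sup>2" if d: "d > 0"
proof -
  obtain z where "diff2 d (R n) x = d\<^sup>2 * R2 n z"
    using diff2_mean_value[of x d "R n" "R1 n" "R2 n"] R_deriv d by auto
  then show ?thesis using mult_left_mono[OF R_bound(2)[of n z], of "d\<^sup>2"] by (simp add: abs_mult mult.commute)
qed

lemma diff2_R2_bound: "\<bar>diff2 d (R2 n) x\<bar> \<le> C * d\<^sup>2" if d: "d > 0"
proof -
  obtain z where "diff2 d (R2 n) x = d\<^sup>2 * R4 n z"
    using diff2_mean_value[of x d "R2 n" "R3 n" "R4 n"] R_deriv d by auto
  then show ?thesis using mult_left_mono[OF R_bound(4)[of n z], of "d\<^sup>2"] by (simp add: abs_mult mult.commute)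
qed

lemma diff2_R_approx: "\<bar>diff2 d (R n) x / d\<^sup>2 - R2 n x\<bar> \<le> C * d" if d: "d > 0"
proof -
  obtain z where z: "\<bar>z - x\<bar> \<le> d" "diff2 d (R n) x = d\<^sup>2 * R2 n z"
    using diff2_mean_value[of x d "R n" "R1 n" "R2 n"] R_deriv d by auto
  have "\<bar>R2 n z - R2 n x\<bar> \<le> C * \<bar>z - x\<bar>" by (rule R_lip)
  also have "\<dots> \<le> C * d" using z C by (intro mult_left_mono) auto
  finally show ?thesis using z that by simp
qed

lemma diff_R_approx: "\<bar>(R n (x + d) - R n (x - d)) / (2 * d) - R1 n x\<bar> \<le> C * d" if "d > 0"
proof -
  have "\<exists>z>x-d. z < x+d \<and> R n (x+d) - R n (x-d) = (x+d - (x-d)) * R1 n z"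
    by (rule MVT2) (use that R_deriv in auto)
  then obtain z where z: "x - d < z" "z < x + d" "R n (x+d) - R n (x-d) = 2 * d * R1 n z" by auto
  have "\<bar>R1 n z - R1 n x\<bar> \<le> C * \<bar>z - x\<bar>" by (rule R_lip)
  also have "\<dots> \<le> C * d" using z C by (intro mult_left_mono) auto
  finally show ?thesis using z that by simp
qed

lemma m_diff: "diff2 h (R n) x = m n x - m n (x - h)" "R n (x + h) - R n (x - h) = m n x + m n (x - h)"
  by (auto simp: diff2_def m_def)

lemma m_bound: "\<bar>m n x\<bar> \<le> C * h"
  unfolding m_def using R_lip(1)[of n "x+h" x] h_pos by simp

lemma m_square_diff_bound: "\<bar>(m n x)\<^sup>2 - (m n (x - h))\<^sup>2\<bar> \<le> 16 * l * e\<^sup>2"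
proof -
  have "\<bar>(m n x)\<^sup>2 - (m n (x - h))\<^sup>2\<bar> = \<bar>m n x - m n (x - h)\<bar> * \<bar>m n x + m n (x - h)\<bar>"
    by (simp add: abs_mult[symmetric] power2_eq_square algebra_simps)
  also have "\<dots> \<le> (C * h\<^sup>2) * (2 * C * h)"
    using diff2_R_bound[OF h_pos, of n x] m_bound[of n x] m_bound[of n "x-h"] C
    by (intro mult_mono) (auto simp: m_diff)
  also have "\<dots> \<le> 16 * l * e\<^sup>2"
    using C s by (simp add: l_def e_def h_def power2_eq_square power4_eq_xxxx mult_ac)
  finally show ?thesis .
qed

text \<open>The product \<open>R_xx R_x\<close> is a derivative of \<open>R_x^2 / 2\<close>, and
  these particular differences keep this exact. The increments of \<open>K\<close> thereby obey a
  scheme in conservation form.\<close>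

lemma R_flux: "diff2 h (R n) x * (R n (x + h) - R n (x - h)) = (m n x)\<^sup>2 - (m n (x - h))\<^sup>2"
  unfolding m_diff by (simp add: power2_eq_square algebra_simps)

text \<open>One step for the increments of \<open>K\<close>, with \<open>m\<close> frozen and
  \<open>f\<close> in the role of the unknown, so that sub- and supersolutions can be
  inserted.\<close>

definition "\<Phi> n f x = f x + l * diff2 h f x
   + 1/4 * (((m n (x + h))\<^sup>2 - (m n x)\<^sup>2) / (f (x + h) + f x) - ((m n x)\<^sup>2 - (m n (x - h))\<^sup>2) / (f x + f (x - h)))"

lemma theta_Suc: "\<theta> (Suc n) x = \<Phi> n (\<theta> n) x"
proof -
  have *: "K n (x + h + h) - K n x = \<theta> n (x + h) + \<theta> n x" "K n (x + h) - K n (x - h) = \<theta> n x + \<theta> n (x - h)"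
    by (auto simp: \<theta>_def)
  have **: "diff2 h (K n) (x + h) - diff2 h (K n) x = diff2 h (\<theta> n) x"
    by (simp add: diff2_def \<theta>_def)
  have "\<theta> (Suc n) x = \<theta> n x + l * (diff2 h (K n) (x + h) - diff2 h (K n) x)
    + 1/4 * (((m n (x + h))\<^sup>2 - (m n x)\<^sup>2) / (K n (x + h + h) - K n x) - ((m n x)\<^sup>2 - (m n (x - h))\<^sup>2) / (K n (x + h) - K n (x - h)))"
    unfolding \<theta>_def K.simps R_flux by (simp add: algebra_simps)
  then show ?thesis unfolding * ** \<Phi>_def .
qed

lemma Phi_mono:
  assumes "\<And>x. e \<le> f x" "\<And>x. f x \<le> g x"
  shows "\<Phi> n f x \<le> \<Phi> n g x"
  unfolding \<Phi>_def diff2_def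
  by (intro diff2_quotient_monotone_flux[OF e_pos] order.strict_implies_order[OF l_pos] l_le assms
      m_square_diff_bound m_square_diff_bound[of n "x+h", simplified])

lemma q_eq_norm: "q n x = norm (m n x, e)"
  by (simp add: q_def norm_Pair)

lemma q_ge: "e \<le> q n x" "\<bar>m n x\<bar> \<le> q n x"
  using e_pos by (auto simp: q_def intro!: real_le_rsqrt)

lemma m_Suc: "m (Suc n) x = (1 - 2*cf) * m n x + cf * m n (x + h) + cf * m n (x - h)"
  by (simp add: m_def diff2_def algebra_simps)

text \<open>The flux of \<open>q\<close> is exactly its discrete gradient, so the scheme maps \<open>q n\<close> to a discrete heat step
  of \<open>q n\<close>, which dominates \<open>q (Suc n)\<close> by convexity of the norm.\<close>
lemma q_Suc_le: "q (Suc n) x \<le> \<Phi> n (q n) x"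
proof -
  have "(m (Suc n) x, e) = (1 - 2*cf) *\<^sub>R (m n x, e) + cf *\<^sub>R (m n (x+h), e) + cf *\<^sub>R (m n (x-h), e)"
    by (simp add: m_Suc algebra_simps)
  then have "q (Suc n) x \<le> norm ((1 - 2*cf) *\<^sub>R (m n x, e)) + norm (cf *\<^sub>R (m n (x+h), e)) + norm (cf *\<^sub>R (m n (x-h), e))"
    unfolding q_eq_norm by (metis norm_triangle_le norm_triangle_ineq add_right_mono)
  also have "\<dots> = (1 - 2*cf) * q n x + cf * q n (x+h) + cf * q n (x-h)"
    unfolding norm_scaleR q_eq_norm using cf by simp
  also have "\<dots> = \<Phi> n (q n) x"
  proof -
    have sq: "(m n y)\<^sup>2 = (q n y)\<^sup>2 - e\<^sup>2" for y by (simp add: q_def)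
    have pos: "q n y > 0" for y using q_ge(1)[of n y] e_pos by linarith
    have dv: "(u\<^sup>2 - e\<^sup>2 - (v\<^sup>2 - e\<^sup>2)) / (u + v) = u - v" if "u > 0" "v > 0" for u v :: real
      using that by (simp add: field_simps power2_eq_square)
    show ?thesis unfolding \<Phi>_def sq by (subst dv[OF pos pos])+ (simp add: cf_def diff2_def algebra_simps)
  qed
  finally show ?thesis .
qed

text \<open>Discrete comparison: \<open>q\<close> is a subsolution lying above the floor
  \<open>e\<close>, where \<open>\<Phi>\<close> is monotone. At the start
  \<open>q \<le> |m| + e\<close>, and the tilt pays for \<open>e\<close>.\<close>

lemma q_le_theta: "q n x \<le> \<theta> n x"
proof (induction n arbitrary: x)
  case 0
  have "q 0 x \<le> \<bar>m 0 x\<bar> + \<bar>e\<bar>" by (simp add: q_def sqrt_sum_squares_le_sum_abs)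
  also have "\<dots> \<le> \<theta> 0 x"
    using k0_lower[of x "x+h"] h_pos e_pos by (simp add: \<theta>_def m_def e_def algebra_simps)
  finally show ?case .
next
  case (Suc n)
  have "q (Suc n) x \<le> \<Phi> n (q n) x" by (rule q_Suc_le)
  also have "\<dots> \<le> \<Phi> n (\<theta> n) x" by (intro Phi_mono q_ge Suc)
  finally show ?case by (simp add: theta_Suc)
qed

lemma theta_ge: "e \<le> \<theta> n x" "\<bar>m n x\<bar> \<le> \<theta> n x"
  using q_le_theta[of n x] q_ge[of n x] by linarith+

text \<open>\<open>L\<close> bounds the slope of \<open>k0\<close>; \<open>C\<close> absorbs the
  tilt and keeps the bound above the slopes of \<open>R\<close>; \<open>2 C t\<close> is the growth
  rate produced by \<open>theta_le\<close>.\<close>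

definition "slope_bound t = L + C + 2 * C * t"

text \<open>A step raises a constant \<open>b\<close> by \<open>D2 (m^2) / (8 b)\<close> only. With
  \<open>D2 (m^2) \<le> 4 C^2 h^4\<close> and \<open>b \<ge> C h\<close> this is at most
  \<open>C h^3 / 2 = 2 C \<tau> h\<close>, one time step of the growth in
  \<open>slope_bound\<close>.\<close>

lemma theta_le: "\<theta> n x \<le> slope_bound (real n * \<tau>) * h"
proof (induction n arbitrary: x)
  case 0
  have "C * s * h \<le> C * 1 * h" using s C h_pos by (intro mult_right_mono mult_left_mono) auto
  then show ?case using k0_upper[of x "x+h"] h_pos by (simp add: \<theta>_def slope_bound_def algebra_simps)
next
  case (Suc n)
  define b where "b = slope_bound (real n * \<tau>) * h"
  have nt: "0 \<le> real n * \<tau>" using tau_pos by simp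
  have "C * h \<le> slope_bound (real n * \<tau>) * h"
    unfolding slope_bound_def using L C nt h_pos by (intro mult_right_mono) auto
  then have b: "C * h \<le> b" by (simp add: b_def)
  have Ch: "C * h > 0" using C h_pos by simp
  have "\<theta> (Suc n) x \<le> \<Phi> n (\<lambda>_. b) x"
    unfolding theta_Suc by (intro Phi_mono theta_ge) (simp add: b_def Suc)
  also have "\<dots> = b + ((m n (x+h))\<^sup>2 - 2 * (m n x)\<^sup>2 + (m n (x-h))\<^sup>2) / (8 * b)"
    using Ch b by (simp add: \<Phi>_def diff2_def field_simps)
  also have "(m n (x+h))\<^sup>2 - 2 * (m n x)\<^sup>2 + (m n (x-h))\<^sup>2 \<le> 4 * (C * h) * (C * h^3)"
  proof -
    have *: "\<exists>z. \<bar>z - x\<bar> \<le> h \<and> diff2 h (m n) x = h\<^sup>2 * (R2 n (z + h) - R2 n z)"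
    proof (rule diff2_mean_value[OF _ _ h_pos])
      fix y
      show "(m n has_real_derivative (R1 n (y+h) - R1 n y)) (at y)"
        unfolding m_def[abs_def] using R_deriv(1)[of n "y+h"] R_deriv(1)[of n y]
        by (intro DERIV_diff) (auto simp: DERIV_shift)
      show "((\<lambda>y. R1 n (y+h) - R1 n y) has_real_derivative (R2 n (y+h) - R2 n y)) (at y)"
        using R_deriv(2)[of n "y+h"] R_deriv(2)[of n y]
        by (intro DERIV_diff) (auto simp: DERIV_shift)
    qed
    then obtain z where z: "diff2 h (m n) x = h\<^sup>2 * (R2 n (z + h) - R2 n z)" by blast
    have "\<bar>R2 n (z + h) - R2 n z\<bar> \<le> C * h" using R_lip(3)[of n "z+h" z] h_pos by simp
    then have d2: "\<bar>diff2 h (m n) x\<bar> \<le> h\<^sup>2 * (C * h)" unfolding z abs_mult by (auto intro!: mult_left_mono)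
    have d1: "\<bar>m n (x+h) - m n x\<bar> \<le> C * h\<^sup>2" "\<bar>m n x - m n (x-h)\<bar> \<le> C * h\<^sup>2"
      using diff2_R_bound[OF h_pos, of n "x+h"] diff2_R_bound[OF h_pos, of n x] m_diff(1)[of n "x+h"] m_diff(1)[of n x] by auto
    have sq: "u\<^sup>2 \<le> (C * h\<^sup>2)\<^sup>2" if "\<bar>u\<bar> \<le> C * h\<^sup>2" for u
      using that by (metis abs_ge_zero power2_abs power_mono)
    \<comment> \<open>Discrete product rule: \<open>D2 (m^2)\<close> is \<open>2 m D2 m\<close> plus
      the squares of the forward and the backward difference; each of the four units in the bound is
      \<open>C^2 h^4\<close>.\<close>
    have "(m n (x+h))\<^sup>2 - 2 * (m n x)\<^sup>2 + (m n (x-h))\<^sup>2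
      = 2 * (m n x * diff2 h (m n) x) + (m n (x+h) - m n x)\<^sup>2 + (m n x - m n (x-h))\<^sup>2"
      by (simp add: diff2_def power2_eq_square algebra_simps)
    also have "m n x * diff2 h (m n) x \<le> (C * h) * (h\<^sup>2 * (C * h))"
    proof -
      have "m n x * diff2 h (m n) x \<le> \<bar>m n x\<bar> * \<bar>diff2 h (m n) x\<bar>" by (metis abs_ge_self abs_mult)
      also have "\<dots> \<le> (C * h) * (h\<^sup>2 * (C * h))" using m_bound d2 Ch by (intro mult_mono) auto
      finally show ?thesis .
    qed
    finally show ?thesis using sq[OF d1(1)] sq[OF d1(2)] by (simp add: power2_eq_square power3_eq_cube algebra_simps)
  qed
  also have "b + 4 * (C * h) * (C * h^3) / (8 * b) \<le> b + 4 * (C * h) * (C * h^3) / (8 * (C * h))"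
    using b Ch C h_pos order.strict_trans2[OF Ch b]
    by (intro add_left_mono divide_left_mono mult_left_mono mult_pos_pos) auto
  also have "\<dots> = slope_bound (real (Suc n) * \<tau>) * h"
    using Ch C h_pos by (simp add: b_def slope_bound_def \<tau>_def field_simps power2_eq_square power3_eq_cube)
  finally show ?case using Ch b by (simp add: divide_right_mono)
qed

text \<open>The increments of \<open>R\<close> are dominated by those of \<open>K\<close>, so the
  quotient has modulus at most 1 and the nonlinear term is at most
  \<open>C h^2 / 4 = C \<tau>\<close>.\<close>

lemma K_step: "\<bar>K (Suc n) x - (K n x + l * diff2 h (K n) x)\<bar> \<le> C * \<tau>"
proof -
  have d: "\<bar>R n (x + h) - R n (x - h)\<bar> \<le> K n (x + h) - K n (x - h)"
    using theta_ge(2)[of n x] theta_ge(2)[of n "x-h"] by (simp add: \<theta>_def m_def)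
  have pos: "K n (x + h) - K n (x - h) > 0"
    using theta_ge(1)[of n x] theta_ge(1)[of n "x-h"] e_pos by (simp add: \<theta>_def)
  have "\<bar>diff2 h (R n) x\<bar> * (\<bar>R n (x + h) - R n (x - h)\<bar> / (K n (x + h) - K n (x - h))) \<le> (C * h\<^sup>2) * 1"
    using d pos diff2_R_bound[OF h_pos] C by (intro mult_mono) auto
  then have "\<bar>diff2 h (R n) x * (R n (x + h) - R n (x - h)) / (K n (x + h) - K n (x - h))\<bar> \<le> C * h\<^sup>2"
    using pos by (simp add: abs_mult)
  moreover have "\<bar>K (Suc n) x - (K n x + l * diff2 h (K n) x)\<bar>
      = 1/4 * \<bar>diff2 h (R n) x * (R n (x + h) - R n (x - h)) / (K n (x + h) - K n (x - h))\<bar>"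
    unfolding K.simps(2) by (simp add: abs_mult del: times_divide_eq_left times_divide_eq_right)
  ultimately show ?thesis by (simp add: \<tau>_def)
qed

lemma K_multiple: "j \<ge> 0 \<Longrightarrow> 0 \<le> K n (x + real_of_int j * h) - K n x \<and> K n (x + real_of_int j * h) - K n x \<le> slope_bound (real n * \<tau>) * h * real_of_int j"
proof (induction j rule: int_ge_induct)
  case (step j)
  have "K n (x + real_of_int (j+1) * h) - K n x = \<theta> n (x + real_of_int j * h) + (K n (x + real_of_int j * h) - K n x)"
    by (simp add: \<theta>_def algebra_simps)
  with step theta_ge(1)[of n "x + real_of_int j * h"] e_pos theta_le[of n "x + real_of_int j * h"]
  show ?case by (simp add: algebra_simps)
qed simp

lemma slope_bound_ge: "t \<ge> 0 \<Longrightarrow> slope_bound t \<ge> 1"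
  unfolding slope_bound_def using L C mult_nonneg_nonneg[of C t] by linarith

lemma K_multiple_abs: "\<bar>K n (x + real_of_int j * h) - K n x\<bar> \<le> slope_bound (real n * \<tau>) * (h * \<bar>real_of_int j\<bar>)"
proof (cases "j \<ge> 0")
  case True then show ?thesis using K_multiple[OF True, of n x] by (simp add: mult.assoc)
next
  case False
  then show ?thesis using K_multiple[of "-j" n "x + real_of_int j * h"] by (simp add: mult.assoc)
qed

text \<open>A Lipschitz bound in time that survives the vanishing viscosity: the profile at step \<open>n\<close> lies below the
  parabola \<open>h M (\<delta>/2 + i\<^sup>2/(2\<delta>))\<close> with \<open>\<delta> = s/h\<close>, and the averaging steps raise this parabola
  only slowly.\<close>
lemma K_time_aux:
  fixes n :: nat
  assumes S: "S = 1 \<or> S = -1"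
  defines "M \<equiv> slope_bound (real n * \<tau>)"
  shows "S * (K (n + k) (x + real_of_int j * h) - K n x)
     \<le> M * (s/2 + h\<^sup>2 * ((real_of_int j)\<^sup>2 + 2 * l * real k) / (2 * s)) + C * \<tau> * real k"
proof (induction k arbitrary: j)
  case 0
  have M: "M \<ge> 0" using slope_bound_ge[of "real n * \<tau>"] tau_pos by (simp add: M_def)
  have "S * (K (n + 0) (x + real_of_int j * h) - K n x) \<le> M * (h * \<bar>real_of_int j\<bar>)"
    using K_multiple_abs[of n x j] S by (auto simp: M_def)
  \<comment> \<open>Young's inequality trades the corner of \<open>|j|\<close> for a parabola, whose
    second difference is bounded.\<close>
  also have "h * \<bar>real_of_int j\<bar> \<le> s/2 + (h * \<bar>real_of_int j\<bar>)\<^sup>2 / (2 * s)"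
  proof -
    have "0 \<le> (s - h * \<bar>real_of_int j\<bar>)\<^sup>2" by simp
    then have "2 * s * (h * \<bar>real_of_int j\<bar>) \<le> s\<^sup>2 + (h * \<bar>real_of_int j\<bar>)\<^sup>2" by (simp add: power2_eq_square algebra_simps)
    then show ?thesis using s by (simp add: field_simps power2_eq_square)
  qed
  finally show ?case using M by (simp add: power_mult_distrib mult_left_mono)
next
  case (Suc k)
  define B where "B i = M * (s/2 + h\<^sup>2 * ((real_of_int i)\<^sup>2 + 2 * l * real k) / (2 * s)) + C * \<tau> * real k" for i
  define y where "y = x + real_of_int j * h"
  define g where "g i = S * (K (n + k) (x + real_of_int i * h) - K n x)" for i
  have yy: "y + h = x + real_of_int (j+1) * h" "y - h = x + real_of_int (j-1) * h" by (auto simp: y_def algebra_simps)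
  have "S * (K (n + Suc k) y - K n x) \<le> S * (K (n+k) y + l * diff2 h (K (n+k)) y - K n x) + C * \<tau>"
    using K_step[of "n+k" y] S by (auto simp: abs_le_iff)
  also have "S * (K (n+k) y + l * diff2 h (K (n+k)) y - K n x) = (1 - 2*l) * g j + l * g (j+1) + l * g (j-1)"
    unfolding g_def diff2_def yy[symmetric] by (simp add: y_def algebra_simps)
  also have "\<dots> \<le> (1 - 2*l) * B j + l * B (j+1) + l * B (j-1)"
    using Suc[of j] Suc[of "j+1"] Suc[of "j-1"] l_pos l_le unfolding g_def B_def
    by (intro add_mono mult_left_mono) auto
  \<comment> \<open>The second difference of \<open>j^2\<close> is 2, so averaging adds
    \<open>2 l\<close> inside the bracket, which is the passage from \<open>k\<close> to
    \<open>Suc k\<close>.\<close>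
  also have "\<dots> = B j + M * (h\<^sup>2 * (2*l) / (2 * s))"
    using s by (simp add: B_def field_simps power2_eq_square)
  finally show ?case using s by (simp add: y_def B_def field_simps)
qed

text \<open>At \<open>j = 0\<close> the parabola has risen by
  \<open>h^2 2 l k / (2 s) = 4 s (\<tau> k)\<close>. This and the offset \<open>s / 2\<close> are
  the cost of the viscosity; \<open>C (\<tau> k)\<close> is the genuine speed.\<close>

lemma K_time: "\<bar>K (n + k) x - K n x\<bar> \<le> C * (\<tau> * real k) + slope_bound (real n * \<tau>) * (s/2 + 4 * s * (\<tau> * real k))"
proof -
  have "h\<^sup>2 * (2 * l * real k) / (2 * s) = 4 * s * (\<tau> * real k)"
    using s by (simp add: \<tau>_def l_def field_simps power2_eq_square)
  then have "S * (K (n + k) x - K n x) \<le> slope_bound (real n * \<tau>) * (s/2 + 4 * s * (\<tau> * real k)) + C * \<tau> * real k"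
    if "S = 1 \<or> S = -1" for S
    using K_time_aux[OF that, of n k x 0] by simp
  from this[of 1] this[of "-1"] show ?thesis by (simp add: abs_le_iff algebra_simps)
qed

end

section \<open>Convergence of the discrete heat flow\<close>

lemma second_deriv_nonpos_at_max:
  fixes f f' :: "real \<Rightarrow> real"
  assumes d: "\<And>y. (f has_real_derivative f' y) (at y)" and d2: "(f' has_real_derivative D) (at x)"
    and r: "r > 0" and mx: "\<And>y. \<bar>y - x\<bar> < r \<Longrightarrow> f y \<le> f x"
  shows "D \<le> 0"
proof (rule ccontr)
  assume "\<not> D \<le> 0"
  then obtain \<delta> where \<delta>: "\<delta> > 0" "\<And>h. 0 < h \<Longrightarrow> h < \<delta> \<Longrightarrow> f' x < f' (x + h)"
    using DERIV_pos_inc_right[OF d2] by auto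
  have "f' x = 0" by (rule DERIV_local_max[OF d r]) (use mx in \<open>auto simp: abs_minus_commute\<close>)
  define y where "y = x + min \<delta> r / 2"
  have y: "x < y" "y < x + \<delta>" "y < x + r" using \<delta> r by (auto simp: y_def min_def field_simps)
  obtain z where z: "x < z" "z < y" "f y - f x = (y - x) * f' z" using MVT2[OF y(1) d] by blast
  have "f' z > 0" using \<delta>(2)[of "z - x"] z y \<open>f' x = 0\<close> by simp
  then have "f y - f x > 0" using z y by simp
  then show False using mx[of y] y by simp
qed

text \<open>The barrier \<open>\<beta> (x^2 + 3 (t - a))\<close> has heat operator
  \<open>3 \<beta> - 2 \<beta> = \<beta> > 0\<close>, which makes the inequality strict at a
  maximum, and its growth together with the bound on \<open>v\<close> confines that maximum to a
  bounded box.\<close>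

lemma strip_max_principle:
  fixes v :: "real \<times> real \<Rightarrow> real"
  assumes cont: "continuous_on (UNIV \<times> {a..b}) v"
    and bound: "\<And>x t. t \<in> {a..b} \<Longrightarrow> v (x,t) \<le> B"
    and init: "\<And>x. v (x,a) \<le> E"
    and vx: "\<And>x t. t \<in> {a<..b} \<Longrightarrow> ((\<lambda>y. v (y,t)) has_real_derivative vx x t) (at x)"
    and vxx: "\<And>x t. t \<in> {a<..b} \<Longrightarrow> ((\<lambda>y. vx y t) has_real_derivative vxx x t) (at x)"
    and vt: "\<And>x t. t \<in> {a<..b} \<Longrightarrow> ((\<lambda>r. v (x,r)) has_real_derivative vt x t) (at t)"
    and sub: "\<And>x t. t \<in> {a<..b} \<Longrightarrow> vt x t - vxx x t \<le> err"
    and t: "t \<in> {a..b}"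
  shows "v (x,t) \<le> E + err * (t - a)"
proof (rule ccontr)
  assume neg: "\<not> v (x,t) \<le> E + err * (t - a)"
  define \<gamma> where "\<gamma> = v (x,t) - (E + err * (t - a))"
  have \<gamma>: "\<gamma> > 0" using neg by (simp add: \<gamma>_def)
  \<comment> \<open>The extra 1 leaves the penalised function strictly positive at
    \<open>(x, t)\<close>.\<close>
  define w where "w = x\<^sup>2 + 3 * (t - a) + 1"
  have w: "w > 0" using t by (simp add: w_def add_nonneg_pos)
  define \<beta> where "\<beta> = \<gamma> / w"
  have \<beta>: "\<beta> > 0" using \<gamma> w by (simp add: \<beta>_def)
  define \<Phi> where "\<Phi> p = v p - E - err * (snd p - a) - \<beta> * ((fst p)\<^sup>2 + 3 * (snd p - a))" for p
  have "\<beta> * w = \<gamma>" using w by (simp add: \<beta>_def)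
  then have "\<beta> * (x\<^sup>2 + 3 * (t - a)) < \<gamma>" using \<beta> unfolding w_def by (simp add: algebra_simps)
  then have \<Phi>pos: "\<Phi> (x,t) > 0" by (simp add: \<Phi>_def \<gamma>_def algebra_simps)
  define W where "W = \<bar>B\<bar> + \<bar>E\<bar> + \<bar>err\<bar> * (b - a)"
  have W: "W \<ge> 0" using t by (simp add: W_def)
  \<comment> \<open>Chosen so that \<open>\<beta> X^2 \<ge> \<beta> X > W\<close> on the lateral
    sides, where \<open>W\<close> bounds all remaining terms.\<close>
  define X where "X = \<bar>x\<bar> + 1 + W / \<beta>"
  have X: "X \<ge> 1" "\<bar>x\<bar> \<le> X" "W / \<beta> < X" using W \<beta> divide_nonneg_pos[OF W \<beta>] by (auto simp: X_def)
  have out: "\<Phi> (y,r) \<le> 0" if "\<bar>y\<bar> = X" "r \<in> {a..b}" for y r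
  proof -
    have "W < \<beta> * X" using X(3) \<beta> by (simp add: field_simps)
    also have "\<dots> \<le> \<beta> * y\<^sup>2"
    proof -
      have "X * 1 \<le> X * X" using X by (intro mult_left_mono) auto
      also have "X * X = y\<^sup>2" using that(1) by (metis abs_power2 power2_abs power2_eq_square)
      finally show ?thesis using \<beta> by simp
    qed
    finally have 1: "W < \<beta> * y\<^sup>2" .
    have "- err * (r - a) \<le> \<bar>err\<bar> * (b - a)"
    proof -
      have "- err * (r - a) \<le> \<bar>err\<bar> * (r - a)" using that(2) by (intro mult_right_mono) auto
      also have "\<dots> \<le> \<bar>err\<bar> * (b - a)" using that(2) by (intro mult_left_mono) auto
      finally show ?thesis .
    qed
    moreover have "v (y,r) \<le> \<bar>B\<bar>" using bound[OF that(2), of y] by linarith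
    moreover have "- E \<le> \<bar>E\<bar>" by simp
    moreover have "\<beta> * (3 * (r - a)) \<ge> 0" using \<beta> that(2) by simp
    ultimately show ?thesis using 1 unfolding \<Phi>_def W_def by (simp add: algebra_simps)
  qed
  have cont\<Phi>: "continuous_on ({-X..X} \<times> {a..b}) \<Phi>"
    unfolding \<Phi>_def by (intro continuous_intros continuous_on_subset[OF cont]) auto
  have "(x,t) \<in> {-X..X} \<times> {a..b}" using X(2) t by auto
  then obtain p where p: "p \<in> {-X..X} \<times> {a..b}" and pmax: "\<And>q. q \<in> {-X..X} \<times> {a..b} \<Longrightarrow> \<Phi> q \<le> \<Phi> p"
    using continuous_attains_sup[OF compact_Times[OF compact_Icc compact_Icc] _ cont\<Phi>] by blast
  obtain y r where yr: "p = (y,r)" by force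
  have pos: "\<Phi> (y,r) > 0" using pmax[of "(x,t)"] \<Phi>pos \<open>(x,t) \<in> _\<close> yr by auto
  have "r \<noteq> a"
  proof
    assume "r = a"
    then have "\<Phi> (y,r) \<le> - \<beta> * y\<^sup>2" using init[of y] by (simp add: \<Phi>_def)
    also have "\<dots> \<le> 0" using \<beta> by simp
    finally show False using pos by simp
  qed
  then have r: "r \<in> {a<..b}" using p yr by auto
  have "\<bar>y\<bar> \<noteq> X" using out[of y r] pos r by auto
  then have y: "\<bar>y\<bar> < X" using p yr by auto
  have "vxx y r - 2 * \<beta> \<le> 0"
  proof (rule second_deriv_nonpos_at_max)
    show "((\<lambda>z. \<Phi> (z,r)) has_real_derivative (vx z r - 2 * \<beta> * z)) (at z)" for z
      unfolding \<Phi>_def by (auto intro!: derivative_eq_intros vx r)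
    show "((\<lambda>z. vx z r - 2 * \<beta> * z) has_real_derivative (vxx y r - 2 * \<beta>)) (at y)"
      by (auto intro!: derivative_eq_intros vxx r)
    show "X - \<bar>y\<bar> > 0" using y by simp
    show "\<Phi> (z,r) \<le> \<Phi> (y,r)" if "\<bar>z - y\<bar> < X - \<bar>y\<bar>" for z
    proof -
      have "z \<in> {-X..X}" using that unfolding atLeastAtMost_iff by linarith
      then show ?thesis using pmax[of "(z,r)"] r by (auto simp: yr)
    qed
  qed
  \<comment> \<open>The maximum may sit at the final time \<open>r = b\<close>, so the comparison
    uses earlier times only.\<close>
  moreover have "vt y r - err - 3 * \<beta> \<ge> 0"
  proof (rule ccontr)
    assume "\<not> 0 \<le> vt y r - err - 3 * \<beta>"
    then have neg: "vt y r - err - 3 * \<beta> < 0" by simp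
    have "((\<lambda>r. \<Phi> (y,r)) has_real_derivative (vt y r - err - 3 * \<beta>)) (at r)"
      unfolding \<Phi>_def by (auto intro!: derivative_eq_intros vt r)
    from DERIV_neg_dec_left[OF this neg] obtain d where d: "d > 0"
      "\<And>h. 0 < h \<Longrightarrow> h < d \<Longrightarrow> \<Phi> (y,r) < \<Phi> (y,r - h)" by auto
    define k where "k = min d (r - a) / 2"
    have k: "0 < k" "k < d" "k < r - a" using d r by (auto simp: k_def min_def field_simps)
    have "(y,r-k) \<in> {-X..X} \<times> {a..b}" using p k r by (auto simp: yr)
    then have "\<Phi> (y,r - k) \<le> \<Phi> (y,r)" using pmax[of "(y,r-k)"] by (simp add: yr)
    with d(2)[OF k(1,2)] show False by simp
  qed
  ultimately show False using sub[OF r, of y] \<beta> by simp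
qed

text \<open>A limit in two stages: \<open>N\<close> tends to infinity for fixed
  \<open>\<delta>\<close>, and only then \<open>\<delta>\<close> tends to 0. In use
  \<open>a \<delta>\<close> is a difference quotient of \<open>rho\<close> with step
  \<open>\<delta>\<close>, and \<open>D \<delta>\<close> may blow up as \<open>\<delta>\<close>
  shrinks.\<close>

lemma tendsto_double_approx:
  fixes q :: "nat \<Rightarrow> real"
  assumes q: "\<And>\<delta>. \<delta> > 0 \<Longrightarrow> \<forall>\<^sub>F N in sequentially. \<bar>q N - a \<delta> N\<bar> \<le> C * \<delta> + D \<delta> N"
    and D: "\<And>\<delta>. \<delta> > 0 \<Longrightarrow> (\<lambda>N. D \<delta> N) \<longlonglongrightarrow> 0"
    and a: "\<And>\<delta>. \<delta> > 0 \<Longrightarrow> (\<lambda>N. a \<delta> N) \<longlonglongrightarrow> b \<delta>"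
    and b: "(b \<longlongrightarrow> l) (at_right 0)"
  shows "q \<longlonglongrightarrow> l"
proof (rule tendstoI)
  fix e :: real assume e: "e > 0"
  have "((\<lambda>\<delta>. C * \<delta>) \<longlongrightarrow> C * 0) (at_right 0)" by (intro tendsto_intros)
  then have "\<forall>\<^sub>F \<delta> in at_right 0. dist (C * \<delta>) 0 < e/4" using e by (intro tendstoD) auto
  moreover have "\<forall>\<^sub>F \<delta> in at_right 0. dist (b \<delta>) l < e/4" using e by (intro tendstoD[OF b]) auto
  ultimately have "\<forall>\<^sub>F \<delta> in at_right 0. dist (C * \<delta>) 0 < e/4 \<and> dist (b \<delta>) l < e/4 \<and> 0 < \<delta>"
    using eventually_at_right_less[of "0::real"] by eventually_elim simp
  then obtain \<delta> where \<delta>: "dist (C * \<delta>) 0 < e/4" "dist (b \<delta>) l < e/4" "0 < \<delta>"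
    using eventually_happens[of _ "at_right (0::real)"] by auto
  have "\<forall>\<^sub>F N in sequentially. dist (D \<delta> N) 0 < e/4" using e by (intro tendstoD[OF D[OF \<delta>(3)]]) auto
  moreover have "\<forall>\<^sub>F N in sequentially. dist (a \<delta> N) (b \<delta>) < e/4" using e by (intro tendstoD[OF a[OF \<delta>(3)]]) auto
  moreover note q[OF \<delta>(3)]
  ultimately show "\<forall>\<^sub>F N in sequentially. dist (q N) l < e"
  proof eventually_elim
    case (elim N)
    then show ?case using \<delta> unfolding dist_real_def by linarith
  qed
qed

lemma central_difference_tendsto:
  fixes f :: "real \<Rightarrow> real"
  assumes "(f has_real_derivative D) (at x)"
  shows "((\<lambda>\<delta>. (f (x + \<delta>) - f (x - \<delta>)) / (2 * \<delta>)) \<longlongrightarrow> D) (at_right 0)"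
proof -
  have 1: "((\<lambda>h. (f (x + h) - f x) / h) \<longlongrightarrow> D) (at 0)" using assms by (simp add: DERIV_def)
  have r: "((\<lambda>\<delta>. (f (x + \<delta>) - f x) / \<delta>) \<longlongrightarrow> D) (at_right 0)"
    by (rule filterlim_mono[OF 1 order_refl]) (simp add: at_le)
  have f: "filterlim (\<lambda>\<delta>::real. - \<delta>) (at 0) (at_right 0)"
    unfolding filterlim_at
    by (auto intro!: tendsto_eq_intros simp: eventually_at_filter)
  have "((\<lambda>\<delta>. (f (x + - \<delta>) - f x) / (- \<delta>)) \<longlongrightarrow> D) (at_right 0)"
    using filterlim_compose[OF 1 f] .
  from tendsto_mult_left[OF tendsto_add[OF r this], of "1/2"]
  have "((\<lambda>\<delta>. 1/2 * ((f (x + \<delta>) - f x) / \<delta> + (f (x + - \<delta>) - f x) / (- \<delta>))) \<longlongrightarrow> D) (at_right 0)" by simp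
  then show ?thesis
    by (rule Lim_transform_eventually) (auto simp: eventually_at_filter field_simps)
qed

text \<open>L'Hopital in \<open>\<delta>\<close> reduces the second difference of \<open>f\<close>
  to the central difference of \<open>f'\<close>.\<close>

lemma diff2_quotient_tendsto:
  fixes f f' :: "real \<Rightarrow> real"
  assumes "\<And>y. (f has_real_derivative f' y) (at y)" "(f' has_real_derivative D) (at x)"
  shows "((\<lambda>\<delta>. diff2 \<delta> f x / \<delta>\<^sup>2) \<longlongrightarrow> D) (at_right 0)"
proof (rule lhopital_right_0)
  have "((\<lambda>\<delta>. diff2 \<delta> f x) \<longlongrightarrow> f (x+0) - 2 * f x + f (x-0)) (at_right 0)"
    unfolding diff2_def
    by (intro tendsto_intros isCont_tendsto_compose[OF DERIV_isCont[OF assms(1)]])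
  then show "((\<lambda>\<delta>. diff2 \<delta> f x) \<longlongrightarrow> 0) (at_right 0)" by simp
  show "((\<lambda>\<delta>::real. \<delta>\<^sup>2) \<longlongrightarrow> 0) (at_right 0)" by (auto intro!: tendsto_eq_intros)
  show "\<forall>\<^sub>F \<delta>::real in at_right 0. \<delta>\<^sup>2 \<noteq> 0" "\<forall>\<^sub>F \<delta>::real in at_right 0. 2 * \<delta> \<noteq> 0" by (auto simp: eventually_at_filter)
  have "((\<lambda>\<delta>. diff2 \<delta> f x) has_real_derivative f' (x + \<delta>) - f' (x - \<delta>)) (at \<delta>)" for \<delta>
    unfolding diff2_def
    by (rule derivative_eq_intros DERIV_chain2[OF assms(1)] refl | simp)+
  then show "\<forall>\<^sub>F \<delta> in at_right 0. ((\<lambda>\<delta>. diff2 \<delta> f x) has_real_derivative f' (x + \<delta>) - f' (x - \<delta>)) (at \<delta>)" by simp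
  show "\<forall>\<^sub>F \<delta> in at_right 0. ((\<lambda>\<delta>::real. \<delta>\<^sup>2) has_real_derivative 2 * \<delta>) (at \<delta>)"
    by (intro always_eventually allI) (auto intro!: derivative_eq_intros)
  show "((\<lambda>\<delta>. (f' (x + \<delta>) - f' (x - \<delta>)) / (2 * \<delta>)) \<longlongrightarrow> D) (at_right 0)"
    by (rule central_difference_tendsto[OF assms(2)])
qed

section \<open>Error estimates for the discrete heat flow\<close>

locale scheme_heat = scheme +
  fixes T :: real and rho rx rxx :: "real \<times> real \<Rightarrow> real"
  assumes T_pos: "T > 0"
    and rho_x: "\<And>x t. 0 < t \<Longrightarrow> t < T \<Longrightarrow> ((\<lambda>y. rho (y,t)) has_real_derivative rx (x,t)) (at x)"
    and rho_xx: "\<And>x t. 0 < t \<Longrightarrow> t < T \<Longrightarrow> ((\<lambda>y. rx (y,t)) has_real_derivative rxx (x,t)) (at x)"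
    and rho_t: "\<And>x t. 0 < t \<Longrightarrow> t < T \<Longrightarrow> ((\<lambda>r. rho (x,r)) has_real_derivative rxx (x,t)) (at t)"
    and rho_cont: "continuous_on (UNIV \<times> {0..T}) rho"
    and rho_bound: "\<exists>B. \<forall>x. \<forall>t\<in>{0..T}. \<bar>rho (x,t)\<bar> \<le> B"
    and rho_init: "\<And>x. rho (x,0) = f0 x"
begin

lemma R_deriv_diff2: "((\<lambda>y. diff2 d (R n) y) has_real_derivative diff2 d (R1 n) x) (at x)"
   "((\<lambda>y. diff2 d (R1 n) y) has_real_derivative diff2 d (R2 n) x) (at x)"
  unfolding diff2_def
  by (rule derivative_eq_intros DERIV_chain2[OF R_deriv(1)] DERIV_chain2[OF R_deriv(2)] R_deriv refl | simp)+

text \<open>Three sources: \<open>C h\<close> from the second difference against the second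
  derivative, \<open>4 l C\<close> from the added viscosity, \<open>2 \<tau> C\<close> from
  interpolating linearly in time.\<close>

definition "err = C * (h + 4 * l + 2 * \<tau>)"

text \<open>This is the residual in the heat equation of \<open>R n + \<sigma> k D2 (R n)\<close>
  with \<open>k = (1 + 4 l) / h^2\<close>: time derivative minus second space derivative. Fourth
  derivatives of the datum enter because \<open>R4\<close> bounds \<open>D2 (R2 n)\<close>.\<close>

lemma scheme_consistency:
  assumes "0 \<le> \<sigma>" "\<sigma> \<le> \<tau>"
  shows "\<bar>(1 + 4 * l) * (diff2 h (R n) x / h\<^sup>2) - R2 n x - \<sigma> * ((1 + 4 * l) * (diff2 h (R2 n) x / h\<^sup>2))\<bar> \<le> err"
proof -
  define A B where "A = diff2 h (R n) x / h\<^sup>2" and "B = diff2 h (R2 n) x / h\<^sup>2"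
  have A: "\<bar>A - R2 n x\<bar> \<le> C * h" unfolding A_def by (rule diff2_R_approx[OF h_pos])
  have "\<bar>A\<bar> \<le> C" "\<bar>B\<bar> \<le> C" unfolding A_def B_def
    using diff2_R_bound[OF h_pos, of n x] diff2_R2_bound[OF h_pos, of n x] h_pos by (auto simp: abs_divide divide_le_eq)
  then have 1: "\<bar>4 * l * A\<bar> \<le> 4 * l * C" and "\<bar>(1 + 4 * l) * B\<bar> \<le> 2 * C"
    using l_pos l_le C unfolding abs_mult by (auto intro!: mult_mono)
  then have 2: "\<bar>\<sigma> * ((1 + 4 * l) * B)\<bar> \<le> \<tau> * (2 * C)" unfolding abs_mult[of \<sigma>] using assms by (intro mult_mono) auto
  have "(1 + 4 * l) * A - R2 n x - \<sigma> * ((1 + 4 * l) * B) = (A - R2 n x) + 4 * l * A - \<sigma> * ((1 + 4 * l) * B)"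
    by (simp add: algebra_simps)
  also have "\<bar>\<dots>\<bar> \<le> C * h + 4 * l * C + \<tau> * (2 * C)" using A 1 2 by linarith
  finally show ?thesis unfolding A_def B_def err_def by (simp add: algebra_simps)
qed

text \<open>An iterate is joined to its successor linearly in time. Plus or minus the difference to
  \<open>rho\<close> has residual at most \<open>err\<close>, so the maximum principle adds
  \<open>err (b - a)\<close> to the error present at time \<open>a\<close>. With
  \<open>b < T\<close> the equation for \<open>rho\<close> holds up to the end of the step.\<close>

lemma R_close_aux: "real n * \<tau> < T \<Longrightarrow> \<bar>R n x - rho (x, real n * \<tau>)\<bar> \<le> err * (real n * \<tau>)"
proof (induction n arbitrary: x)
  case 0 then show ?case by (simp add: rho_init)
next
  case (Suc n)
  define a b where "a = real n * \<tau>" and "b = real (Suc n) * \<tau>"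
  have ab: "0 \<le> a" "a < b" "b < T" "b - a = \<tau>" using tau_pos Suc.prems by (auto simp: a_def b_def algebra_simps)
  obtain B0 where B0: "\<And>x t. t \<in> {0..T} \<Longrightarrow> \<bar>rho (x,t)\<bar> \<le> B0" using rho_bound by blast
  have "\<bar>f0 x\<bar> \<le> B0" for x using B0[of 0 x] T_pos by (simp add: rho_init)
  then have Rb: "\<bar>R n x\<bar> \<le> B0" for x n by (intro heat_iter_bound cf)
  \<comment> \<open>With \<open>\<tau> k = cf\<close> the interpolant reaches
    \<open>R (Suc n)\<close> at \<open>t = b\<close>.\<close>
  define k where "k = (1 + 4 * l) / h\<^sup>2"
  have k: "\<tau> * k = cf" "k \<ge> 0" using h_pos l_pos by (auto simp: k_def \<tau>_def cf_def field_simps)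
  have main: "S * (R (Suc n) x - rho (x,b)) \<le> err * a + err * (b - a)" if S: "S = 1 \<or> S = -1" for S x
  proof -
    define v where "v p = S * (R n (fst p) + (snd p - a) * (k * diff2 h (R n) (fst p)) - rho p)" for p
    have contR: "continuous_on UNIV (R n)"
      by (meson DERIV_isCont R_deriv(1) continuous_at_imp_continuous_on)
    have Sb: "S * u \<le> \<bar>u\<bar>" for u using S by auto
    have "v (x,b) \<le> err * a + err * (b - a)"
    proof (rule strip_max_principle[where v=v and a=a and b=b])
      show "continuous_on (UNIV \<times> {a..b}) v" unfolding v_def diff2_def
        by (intro continuous_intros continuous_on_compose2[OF contR] continuous_on_subset[OF rho_cont]) (use ab in auto)
      show "v (x,t) \<le> 4 * B0 * (\<tau> * k) + 2 * B0" if "t \<in> {a..b}" for x t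
      proof -
        have "\<bar>diff2 h (R n) x\<bar> \<le> 4 * B0" using Rb[of n "x+h"] Rb[of n x] Rb[of n "x-h"] by (simp add: diff2_def)
        then have "\<bar>(t - a) * (k * diff2 h (R n) x)\<bar> \<le> \<tau> * (k * (4 * B0))"
          unfolding abs_mult using that ab k by (intro mult_mono) auto
        then show ?thesis using Sb[of "R n x + (t - a) * (k * diff2 h (R n) x) - rho (x,t)"] Rb[of n x] B0[of t x] that ab
          unfolding v_def by (simp add: algebra_simps)
      qed
      show "v (x,a) \<le> err * a" for x
        using Suc.IH[of x] ab Sb[of "R n x - rho (x,a)"] by (simp add: v_def a_def[symmetric])
      show "((\<lambda>y. v (y,t)) has_real_derivative S * (R1 n x + (t - a) * (k * diff2 h (R1 n) x) - rx (x,t))) (at x)"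
        if "t \<in> {a<..b}" for x t
        unfolding v_def fst_conv snd_conv
        by (rule derivative_eq_intros R_deriv R_deriv_diff2 rho_x refl | use that ab in simp)+
      show "((\<lambda>x. S * (R1 n x + (t - a) * (k * diff2 h (R1 n) x) - rx (x,t))) has_real_derivative S * (R2 n x + (t - a) * (k * diff2 h (R2 n) x) - rxx (x,t))) (at x)"
        if "t \<in> {a<..b}" for x t
        by (rule derivative_eq_intros R_deriv R_deriv_diff2 rho_xx refl | use that ab in simp)+
      show "((\<lambda>r. v (x,r)) has_real_derivative S * (k * diff2 h (R n) x - rxx (x,t))) (at t)"
        if "t \<in> {a<..b}" for x t
        unfolding v_def fst_conv snd_conv
        by (rule derivative_eq_intros rho_t refl | use that ab in simp)+
      show "S * (k * diff2 h (R n) x - rxx (x,t)) - S * (R2 n x + (t - a) * (k * diff2 h (R2 n) x) - rxx (x,t)) \<le> err"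
        if "t \<in> {a<..b}" for x t
      proof -
        have "S * (k * diff2 h (R n) x - rxx (x,t)) - S * (R2 n x + (t - a) * (k * diff2 h (R2 n) x) - rxx (x,t))
          = S * (k * diff2 h (R n) x - R2 n x - (t - a) * (k * diff2 h (R2 n) x))" by (simp add: algebra_simps)
        also have "\<dots> \<le> \<bar>k * diff2 h (R n) x - R2 n x - (t - a) * (k * diff2 h (R2 n) x)\<bar>" by (rule Sb)
        also have "\<dots> \<le> err" using scheme_consistency[of "t - a" n x] that ab by (simp add: k_def)
        finally show ?thesis .
      qed
      show "b \<in> {a..b}" using ab by simp
    qed
    moreover have "v (x,b) = S * (R (Suc n) x - rho (x,b))"
      unfolding v_def using ab(4) k(1) by (simp add: mult.assoc[symmetric])
    ultimately show ?thesis by simp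
  qed
  have "err * a + err * (b - a) = err * b" by (simp add: algebra_simps)
  then show ?case unfolding b_def[symmetric] using main[of 1 x] main[of "-1" x] by (simp add: abs_le_iff del: heat_iter.simps)
qed

lemma s_powers: "h \<le> s" "l \<le> s" "\<tau> \<le> s"
proof -
  have h: "h \<le> s" unfolding h_def using s power_decreasing[of 1 4 s] by simp
  show "h \<le> s" by (rule h)
  show "l \<le> s" unfolding l_def using s power_decreasing[of 1 2 s] by simp
  have "\<tau> \<le> h * h" using h_pos by (simp add: \<tau>_def power2_eq_square)
  also have "\<dots> \<le> h * 1" using h h_pos s by (intro mult_left_mono) auto
  finally show "\<tau> \<le> s" using h by simp
qed

lemma R_close:
  assumes "real n * \<tau> < T"
  shows "\<bar>R n x - rho (x, real n * \<tau>)\<bar> \<le> 7 * C * T * s"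
proof -
  have "err \<le> C * (7 * s)" unfolding err_def using s_powers C by (intro mult_left_mono) auto
  then have "err * (real n * \<tau>) \<le> C * (7 * s) * T" using assms tau_pos C s by (intro mult_mono) auto
  with R_close_aux[OF assms, of x] show ?thesis by (simp add: algebra_simps)
qed

text \<open>Uniform closeness of \<open>R\<close> to \<open>rho\<close> says nothing about quotients
  with the small step \<open>h\<close>. Both the \<open>h\<close>- and the
  \<open>\<delta>\<close>-quotient of \<open>R\<close> are close to \<open>R1\<close>, and at the
  fixed step \<open>\<delta>\<close> uniform closeness suffices. The same detour serves second
  differences.\<close>

lemma R1_close:
  assumes n: "real n * \<tau> < T" and d: "\<delta> > 0"
  shows "\<bar>(R n (x + h) - R n (x - h)) / (2 * h) - (rho (x + \<delta>, real n * \<tau>) - rho (x - \<delta>, real n * \<tau>)) / (2 * \<delta>)\<bar>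
    \<le> C * \<delta> + (C * s + 7 * C * T * s / \<delta>)"
proof -
  define r where "r y = rho (y, real n * \<tau>)" for y
  have "\<bar>(R n (x + \<delta>) - R n (x - \<delta>)) - (r (x + \<delta>) - r (x - \<delta>))\<bar> \<le> 2 * (7 * C * T * s)"
    using R_close[OF n, of "x+\<delta>"] R_close[OF n, of "x-\<delta>"] by (simp add: r_def)
  then have "\<bar>((R n (x + \<delta>) - R n (x - \<delta>)) - (r (x + \<delta>) - r (x - \<delta>))) / (2 * \<delta>)\<bar> \<le> 2 * (7 * C * T * s) / (2 * \<delta>)"
    using d unfolding abs_divide by (intro divide_mono) auto
  then have "\<bar>(R n (x + \<delta>) - R n (x - \<delta>)) / (2 * \<delta>) - (r (x + \<delta>) - r (x - \<delta>)) / (2 * \<delta>)\<bar> \<le> 7 * C * T * s / \<delta>"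
    by (simp add: diff_divide_distrib)
  moreover have "C * h \<le> C * s" using s_powers C by simp
  ultimately show ?thesis using diff_R_approx[OF h_pos, of n x] diff_R_approx[OF d, of n x] unfolding r_def by linarith
qed

lemma R2_close:
  assumes n: "real n * \<tau> < T" and d: "\<delta> > 0"
  shows "\<bar>diff2 h (R n) x / h\<^sup>2 - diff2 \<delta> (\<lambda>y. rho (y, real n * \<tau>)) x / \<delta>\<^sup>2\<bar>
    \<le> C * \<delta> + (C * s + 28 * C * T * s / \<delta>\<^sup>2)"
proof -
  define r where "r y = rho (y, real n * \<tau>)" for y
  have "\<bar>diff2 \<delta> (R n) x - diff2 \<delta> r x\<bar> \<le> 4 * (7 * C * T * s)"
    using R_close[OF n, of "x+\<delta>"] R_close[OF n, of "x-\<delta>"] R_close[OF n, of x] unfolding r_def diff2_def by linarith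
  then have "\<bar>(diff2 \<delta> (R n) x - diff2 \<delta> r x) / \<delta>\<^sup>2\<bar> \<le> 4 * (7 * C * T * s) / \<delta>\<^sup>2"
    using d unfolding abs_divide by (intro divide_mono) auto
  then have "\<bar>diff2 \<delta> (R n) x / \<delta>\<^sup>2 - diff2 \<delta> r x / \<delta>\<^sup>2\<bar> \<le> 28 * C * T * s / \<delta>\<^sup>2"
    by (simp add: diff_divide_distrib)
  moreover have "C * h \<le> C * s" using s_powers C by simp
  ultimately show ?thesis using diff2_R_approx[OF h_pos, of n x] diff2_R_approx[OF d, of n x] unfolding r_def by linarith
qed

section \<open>Grid functions extended to the strip\<close>

definition "node x = real_of_int \<lfloor>x / h\<rfloor> * h"
definition "tstep t = nat \<lfloor>t / \<tau>\<rfloor>"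
text \<open>Piecewise constant and hence discontinuous; the extra \<open>s\<close> in the moduli of
  continuity pays for the jumps. Rounding down keeps the sampled time below \<open>T\<close>, where
  \<open>R\<close> is compared with \<open>rho\<close>.\<close>

definition "u p = K (tstep (snd p)) (node (fst p))"

lemma node: "node x \<le> x" "x < node x + h" "\<bar>node x - x\<bar> \<le> h"
proof -
  have "real_of_int \<lfloor>x / h\<rfloor> \<le> x/h" "x/h < real_of_int \<lfloor>x / h\<rfloor> + 1" by linarith+
  then have "node x \<le> x/h * h" "x/h * h < (real_of_int \<lfloor>x / h\<rfloor> + 1) * h"
    unfolding node_def using h_pos by (intro mult_right_mono mult_strict_right_mono; simp)+
  then show "node x \<le> x" "x < node x + h" using h_pos by (auto simp: node_def algebra_simps)
  then show "\<bar>node x - x\<bar> \<le> h" by simp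
qed

lemma tstep: "t \<ge> 0 \<Longrightarrow> real (tstep t) * \<tau> \<le> t" "t \<ge> 0 \<Longrightarrow> t < real (tstep t) * \<tau> + \<tau>"
proof -
  assume t: "t \<ge> 0"
  then have "real (tstep t) = real_of_int \<lfloor>t / \<tau>\<rfloor>" using tau_pos by (simp add: tstep_def)
  then have "real (tstep t) \<le> t / \<tau>" "t / \<tau> < real (tstep t) + 1" by linarith+
  then have "real (tstep t) * \<tau> \<le> t/\<tau> * \<tau>" "t/\<tau> * \<tau> < (real (tstep t) + 1) * \<tau>"
    using tau_pos by (intro mult_right_mono mult_strict_right_mono; simp)+
  then show "real (tstep t) * \<tau> \<le> t" "t < real (tstep t) * \<tau> + \<tau>" using tau_pos by (auto simp: algebra_simps)
qed

lemma u_grid: "u (real_of_int i * h, real n * \<tau>) = K n (real_of_int i * h)"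
  using h_pos tau_pos by (simp add: u_def node_def tstep_def)

lemma slope_bound_mono: "a \<le> b \<Longrightarrow> slope_bound a \<le> slope_bound b"
  using C by (simp add: slope_bound_def)

lemma u_equicontinuous_aux:
  assumes t: "0 \<le> t" "t \<le> t'" "t' \<le> T"
  shows "\<bar>u (x',t') - u (x,t)\<bar> \<le> (C + 4 * slope_bound T) * (\<bar>x' - x\<bar> + \<bar>t' - t\<bar> + s)"
proof -
  define M where "M = slope_bound T"
  define n k where "n = tstep t" and "k = tstep t' - tstep t"
  have M: "M \<ge> 1" unfolding M_def using slope_bound_ge T_pos by simp
  have le: "tstep t \<le> tstep t'" unfolding tstep_def using t tau_pos by (intro nat_mono floor_mono divide_right_mono) auto
  have nk: "tstep t' = n + k" using le by (simp add: n_def k_def)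
  have kt: "\<tau> * real k \<le> (t' - t) + \<tau>"
    using tstep[of t] tstep[of t'] t nk by (simp add: n_def[symmetric] algebra_simps)
  have b: "slope_bound (real (n+k) * \<tau>) \<le> M" "slope_bound (real n * \<tau>) \<le> M"
    unfolding M_def using tstep(1)[of t'] tstep(1)[of t] t nk by (auto intro!: slope_bound_mono simp: n_def[symmetric])
  define j where "j = \<lfloor>x'/h\<rfloor> - \<lfloor>x/h\<rfloor>"
  have nx: "node x' = node x + real_of_int j * h" by (simp add: node_def j_def algebra_simps)
  have "\<bar>K (n+k) (node x') - K (n+k) (node x)\<bar> \<le> slope_bound (real (n+k) * \<tau>) * (h * \<bar>real_of_int j\<bar>)"
    unfolding nx by (rule K_multiple_abs)
  also have "h * \<bar>real_of_int j\<bar> = \<bar>node x' - node x\<bar>" using nx h_pos by (simp add: abs_mult)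
  also have "slope_bound (real (n+k) * \<tau>) * \<bar>node x' - node x\<bar> \<le> M * (\<bar>x' - x\<bar> + s)"
    using node[of x] node[of x'] s_powers(1) M b by (intro mult_mono) auto
  finally have 1: "\<bar>K (n+k) (node x') - K (n+k) (node x)\<bar> \<le> M * (\<bar>x' - x\<bar> + s)" .
  have 2: "C * (\<tau> * real k) \<le> C * ((t' - t) + s)" using kt s_powers(3) C by (intro mult_left_mono) auto
  have "4 * s * (\<tau> * real k) \<le> 2 * ((t' - t) + s)" using kt s_powers(3) s tau_pos by (intro mult_mono) auto
  then have 3: "slope_bound (real n * \<tau>) * (s/2 + 4 * s * (\<tau> * real k)) \<le> M * (s/2 + 2 * ((t' - t) + s))"
    using b M s tau_pos by (intro mult_mono) auto
  have "\<bar>u (x',t') - u (x,t)\<bar> \<le> M * (\<bar>x' - x\<bar> + s) + C * ((t' - t) + s) + M * (s/2 + 2 * ((t' - t) + s))"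
    unfolding u_def fst_conv snd_conv nk using 1 2 3 K_time[of n k "node x"] unfolding n_def[symmetric] by linarith
  also have "\<dots> \<le> (C + 4 * M) * (\<bar>x' - x\<bar> + \<bar>t' - t\<bar> + s)"
  proof -
    have "0 \<le> M * \<bar>x' - x\<bar>" "0 \<le> M * (t' - t)" "0 \<le> M * s" "0 \<le> C * \<bar>x' - x\<bar>" using M C s t by auto
    moreover have "(C + 4 * M) * (\<bar>x' - x\<bar> + \<bar>t' - t\<bar> + s)
      = C * \<bar>x' - x\<bar> + C * (t' - t) + C * s + 4 * (M * \<bar>x' - x\<bar>) + 4 * (M * (t' - t)) + 4 * (M * s)" using t by (simp add: algebra_simps)
    moreover have "M * (\<bar>x' - x\<bar> + s) + C * ((t' - t) + s) + M * (s/2 + 2 * ((t' - t) + s))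
      = M * \<bar>x' - x\<bar> + C * (t' - t) + C * s + 2 * (M * (t' - t)) + 7/2 * (M * s)" by (simp add: field_simps)
    ultimately show ?thesis by linarith
  qed
  finally show ?thesis by (simp add: M_def)
qed

lemma u_equicontinuous:
  assumes "t \<in> {0..T}" "t' \<in> {0..T}"
  shows "\<bar>u (x',t') - u (x,t)\<bar> \<le> (C + 4 * slope_bound T) * (\<bar>x' - x\<bar> + \<bar>t' - t\<bar> + s)"
  using u_equicontinuous_aux[of t t' x' x] u_equicontinuous_aux[of t' t x x'] assms
  by (cases "t \<le> t'") (auto simp: abs_minus_commute)

lemma u_init: "\<bar>u (x,0) - k0 x\<bar> \<le> (L + C * (\<bar>x\<bar> + 1)) * s"
proof -
  have "\<bar>k0 (node x) - k0 x\<bar> \<le> L * s"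
  proof -
    have "k0 x - k0 (node x) \<le> L * (x - node x)" "0 \<le> k0 x - k0 (node x)"
      using k0_upper[OF node(1)] order_trans[OF abs_ge_zero k0_lower[OF node(1)]] by auto
    moreover have "L * (x - node x) \<le> L * s" using L node(3)[of x] s_powers(1) by (intro mult_left_mono) auto
    ultimately show ?thesis by simp
  qed
  moreover have "\<bar>C * s * node x\<bar> \<le> C * s * (\<bar>x\<bar> + 1)"
    unfolding abs_mult using C s node(3)[of x] s_powers(1) by (intro mult_mono) auto
  moreover have "u (x,0) = k0 (node x) + C * s * node x" by (simp add: u_def tstep_def)
  ultimately show ?thesis by (simp add: algebra_simps)
qed

lemma K_multiple_R: "j \<ge> 0 \<Longrightarrow> \<bar>R n (x + real_of_int j * h) - R n x\<bar> \<le> K n (x + real_of_int j * h) - K n x"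
proof (induction j rule: int_ge_induct)
  case (step j)
  have e: "x + real_of_int (j+1) * h = (x + real_of_int j * h) + h" by (simp add: algebra_simps)
  show ?case using step theta_ge(2)[of n "x + real_of_int j * h"] unfolding e \<theta>_def m_def by linarith
qed simp

text \<open>Domination holds exactly between nodes for \<open>R\<close>; each endpoint then costs
  \<open>7 C T s\<close> for replacing \<open>R\<close> by \<open>rho\<close> and \<open>C s\<close>
  for moving to the node.\<close>

lemma u_diff_ge:
  assumes xy: "x \<le> y" and t: "0 \<le> t" "t < T"
  shows "u (y,t) - u (x,t) \<ge> \<bar>rho (y, real (tstep t) * \<tau>) - rho (x, real (tstep t) * \<tau>)\<bar> - (14 * C * T * s + 2 * C * s)"
proof -
  define n where "n = tstep t"
  have n: "real n * \<tau> < T" using tstep(1)[OF t(1)] t by (simp add: n_def)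
  define j where "j = \<lfloor>y/h\<rfloor> - \<lfloor>x/h\<rfloor>"
  have j: "j \<ge> 0" unfolding j_def using xy h_pos by (simp add: floor_mono divide_right_mono)
  have nx: "node y = node x + real_of_int j * h" by (simp add: node_def j_def algebra_simps)
  have cl: "\<bar>R n (node z) - rho (z, real n * \<tau>)\<bar> \<le> C * s + 7 * C * T * s" for z
  proof -
    have "\<bar>R n (node z) - R n z\<bar> \<le> C * \<bar>node z - z\<bar>" by (rule R_lip)
    also have "\<dots> \<le> C * s" using C node(3)[of z] s_powers by (intro mult_left_mono) auto
    finally show ?thesis using R_close[OF n, of z] by linarith
  qed
  have "\<bar>R n (node y) - R n (node x)\<bar> \<le> K n (node y) - K n (node x)"
    unfolding nx by (rule K_multiple_R[OF j])
  then show ?thesis using cl[of x] cl[of y] unfolding u_def fst_conv snd_conv n_def[symmetric] by linarith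
qed

end

section \<open>The limit of the scheme\<close>

text \<open>The factor \<open>S\<close> treats touching from above (\<open>S = 1\<close>) and from
  below (\<open>S = -1\<close>) together. The scheme commutes with adding the constant
  \<open>c\<close>, so monotonicity compares \<open>K\<close> with \<open>g + c\<close>; this
  requires increments at least \<open>2 e\<close> also for \<open>g\<close>, which is what
  \<open>C s \<le> D\<close> says. Division by \<open>\<tau>\<close> produces the discrete equation
  for \<open>g\<close>.\<close>

lemma (in scheme) touching_step:
  assumes S: "S = 1 \<or> S = -1"
    and touch: "\<And>y. y \<in> {x, x + h, x - h} \<Longrightarrow> S * (K n y - g y) \<le> S * (K (Suc n) x - a)"
    and D: "D = (g (x + h) - g (x - h)) / (2 * h)" "C * s \<le> D"
  shows "S * ((a - g x) / \<tau> - 4 * s\<^sup>2 * (diff2 h g x / h\<^sup>2)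
     - (diff2 h (R n) x / h\<^sup>2) * ((R n (x + h) - R n (x - h)) / (2 * h)) / D) \<le> 0"
proof -
  define G where "G = diff2 h (R n) x * (R n (x + h) - R n (x - h))"
  have G: "\<bar>G\<bar> \<le> 16 * l * e\<^sup>2" unfolding G_def R_flux by (rule m_square_diff_bound)
  define c where "c = K (Suc n) x - a"
  have K2: "2 * e \<le> K n (x + h) - K n (x - h)" using theta_ge(1)[of n x] theta_ge(1)[of n "x-h"] by (simp add: \<theta>_def)
  have "C * s * (2 * h) \<le> D * (2 * h)" using D(2) h_pos by (intro mult_right_mono) auto
  then have g2: "2 * e \<le> g (x + h) - g (x - h)" using D(1) h_pos by (simp add: e_def mult_ac)
  have Ks: "K (Suc n) x = K n x + l * (K n (x+h) - 2 * K n x + K n (x-h)) + 1/4 * (G / (K n (x + h) - K n (x - h)))"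
    by (simp add: K.simps(2) G_def diff2_def)
  define \<Sigma> where "\<Sigma> = g x + l * diff2 h g x + 1/4 * (G / (g (x + h) - g (x - h)))"
  have t3: "S * (K n x - g x) \<le> S * c" "S * (K n (x+h) - g (x+h)) \<le> S * c" "S * (K n (x-h) - g (x-h)) \<le> S * c"
    using touch by (auto simp: c_def)
  have "S * (a - \<Sigma>) \<le> 0"
  proof (cases "S = 1")
    case True
    have "K (Suc n) x \<le> (g x + c) + l * ((g (x+h) + c) - 2 * (g x + c) + (g (x-h) + c)) + 1/4 * (G / ((g (x+h) + c) - (g (x-h) + c)))"
      unfolding Ks by (rule diff2_quotient_monotone[OF e_pos less_imp_le[OF l_pos] l_le G K2]) (use t3 True g2 in auto)
    then show ?thesis using True by (simp add: \<Sigma>_def c_def diff2_def algebra_simps)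
  next
    case False
    then have S: "S = -1" using S by simp
    have "(g x + c) + l * ((g (x+h) + c) - 2 * (g x + c) + (g (x-h) + c)) + 1/4 * (G / ((g (x+h) + c) - (g (x-h) + c))) \<le> K (Suc n) x"
      unfolding Ks by (rule diff2_quotient_monotone[OF e_pos less_imp_le[OF l_pos] l_le G]) (use t3 S g2 K2 in auto)
    then show ?thesis using S by (simp add: \<Sigma>_def c_def diff2_def algebra_simps)
  qed
  moreover have "(a - \<Sigma>) / \<tau> = (a - g x) / \<tau> - 4 * s\<^sup>2 * (diff2 h g x / h\<^sup>2)
     - (diff2 h (R n) x / h\<^sup>2) * ((R n (x + h) - R n (x - h)) / (2 * h)) / D"
  proof -
    have "l * diff2 h g x / \<tau> = 4 * s\<^sup>2 * (diff2 h g x / h\<^sup>2)" by (simp add: l_def \<tau>_def)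
    moreover have "1/4 * (G / (g (x + h) - g (x - h))) / \<tau> = (diff2 h (R n) x / h\<^sup>2) * ((R n (x + h) - R n (x - h)) / (2 * h)) / D"
    proof -
      have gD: "g (x + h) - g (x - h) = 2 * h * D" using D(1) h_pos by simp
      have "D > 0" using D(2) C s by (smt (verit) mult_pos_pos)
      then show ?thesis unfolding gD G_def \<tau>_def using h_pos by (simp add: divide_simps)
    qed
    moreover have "(a - \<Sigma>) / \<tau> = (a - g x) / \<tau> - l * diff2 h g x / \<tau> - 1/4 * (G / (g (x + h) - g (x - h))) / \<tau>"
      unfolding \<Sigma>_def by (simp add: diff_divide_distrib add_divide_distrib)
    ultimately show ?thesis by simp
  qed
  ultimately show ?thesis using tau_pos by (metis divide_nonpos_pos times_divide_eq_right)
qed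

text \<open>Collects what passing to the limit needs from a sequence of schemes. \<open>P\<close>
  and \<open>Q\<close> are the discrete first and second space derivatives of \<open>rho\<close>;
  their limits are stated along an arbitrary strictly increasing \<open>k\<close>, since
  subsequences are extracted twice.\<close>

locale approximation =
  fixes s h \<tau> :: "nat \<Rightarrow> real" and K P Q :: "nat \<Rightarrow> nat \<Rightarrow> real \<Rightarrow> real"
    and u :: "nat \<Rightarrow> real \<times> real \<Rightarrow> real"
    and rho rx rxx :: "real \<times> real \<Rightarrow> real" and k0 :: "real \<Rightarrow> real" and T \<Lambda> B C :: real
  assumes T_pos: "T > 0" and \<Lambda>: "\<Lambda> \<ge> 0" and B: "B \<ge> 0"
    and s_bounds: "\<And>N. 0 < s N" "\<And>N. s N \<le> 1" and s_lim: "s \<longlonglongrightarrow> 0"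
    and h_bounds: "\<And>N. 0 < h N" "\<And>N. h N \<le> s N" and tau_bounds: "\<And>N. 0 < \<tau> N" "\<And>N. \<tau> N \<le> s N"
    and u_grid: "\<And>N i n. u N (real_of_int i * h N, real n * \<tau> N) = K N n (real_of_int i * h N)"
    and u_equi: "\<And>N x x' t t'. t \<in> {0..T} \<Longrightarrow> t' \<in> {0..T} \<Longrightarrow>
        \<bar>u N (x',t') - u N (x,t)\<bar> \<le> \<Lambda> * (\<bar>x' - x\<bar> + \<bar>t' - t\<bar> + s N)"
    and u_init: "\<And>N x. \<bar>u N (x,0) - k0 x\<bar> \<le> B * (\<bar>x\<bar> + 1) * s N"
    and u_diff: "\<And>N x y t. x \<le> y \<Longrightarrow> 0 \<le> t \<Longrightarrow> t < T \<Longrightarrow>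
        \<exists>t'. 0 \<le> t' \<and> t' \<le> t \<and> t - t' \<le> s N \<and> \<bar>rho (y,t') - rho (x,t')\<bar> - B * s N \<le> u N (y,t) - u N (x,t)"
    and touching: "\<And>N S n x g a D. S = 1 \<or> S = -1 \<Longrightarrow>
        (\<And>y. y \<in> {x, x + h N, x - h N} \<Longrightarrow> S * (K N n y - g y) \<le> S * (K N (Suc n) x - a)) \<Longrightarrow>
        D = (g (x + h N) - g (x - h N)) / (2 * h N) \<Longrightarrow> C * s N \<le> D \<Longrightarrow>
        S * ((a - g x) / \<tau> N - 4 * (s N)\<^sup>2 * (diff2 (h N) g x / (h N)\<^sup>2) - Q N n x * P N n x / D) \<le> 0"
    and P_lim: "\<And>k n X x t. strict_mono k \<Longrightarrow> X \<longlonglongrightarrow> x \<Longrightarrow> (\<lambda>N. real (n N) * \<tau> (k N)) \<longlonglongrightarrow> t \<Longrightarrow> 0 < t \<Longrightarrow> t < T \<Longrightarrow>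
        (\<lambda>N. P (k N) (n N) (X N)) \<longlonglongrightarrow> rx (x,t)"
    and Q_lim: "\<And>k n X x t. strict_mono k \<Longrightarrow> X \<longlonglongrightarrow> x \<Longrightarrow> (\<lambda>N. real (n N) * \<tau> (k N)) \<longlonglongrightarrow> t \<Longrightarrow> 0 < t \<Longrightarrow> t < T \<Longrightarrow>
        (\<lambda>N. Q (k N) (n N) (X N)) \<longlonglongrightarrow> rxx (x,t)"
    and rho_cont: "continuous_on (UNIV \<times> {0..T}) rho"
    and rho_x: "\<And>x t. 0 < t \<Longrightarrow> t < T \<Longrightarrow> ((\<lambda>y. rho (y,t)) has_real_derivative rx (x,t)) (at x)"
    and rx_cont: "continuous_on (UNIV \<times> {0<..<T}) rx"
    and rxx_cont: "continuous_on (UNIV \<times> {0<..<T}) rxx"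
begin

text \<open>Arzela-Ascoli for discontinuous functions: a diagonal subsequence converges at rational
  points, and equicontinuity up to \<open>s N\<close>, which tends to 0, spreads the Cauchy property
  to the whole strip.\<close>

lemma exists_limit:
  "\<exists>k \<kappa>. strict_mono k \<and> (\<forall>x. \<forall>t\<in>{0..T}. (\<lambda>N. u (k N) (x,t)) \<longlonglongrightarrow> \<kappa> (x,t))"
proof -
  define D where "D = (\<rat> :: real set) \<times> (\<rat> \<inter> {0..T})"
  \<comment> \<open>The \<open>u N\<close> may be unbounded on the strip; dividing by this weight
    gives the single bound 1 required for extracting the subsequence.\<close>
  define w where "w p = \<bar>k0 (fst p)\<bar> + B * (\<bar>fst p\<bar> + 1) + \<Lambda> * (T + 1) + 1" for p :: "real \<times> real"
  have w1: "w p \<ge> 1" for p using B \<Lambda> T_pos by (simp add: w_def)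
  have cD: "countable D" unfolding D_def by (intro countable_SIGMA countable_Int1 countable_rat) 
  have bnd: "norm (u N p / w p) \<le> 1" if "p \<in> D" for N p
  proof -
    obtain x t where p: "p = (x,t)" "t \<in> {0..T}" using \<open>p \<in> D\<close> by (auto simp: D_def)
    have "\<bar>u N (x,t) - u N (x,0)\<bar> \<le> \<Lambda> * (\<bar>x - x\<bar> + \<bar>t - 0\<bar> + s N)" using u_equi[of 0 t N x x] p T_pos by auto
    also have "\<dots> \<le> \<Lambda> * (T + 1)" using p s_bounds(2)[of N] \<Lambda> by (intro mult_left_mono) auto
    finally have 1: "\<bar>u N (x,t) - u N (x,0)\<bar> \<le> \<Lambda> * (T + 1)" .
    have "\<bar>u N (x,0) - k0 x\<bar> \<le> B * (\<bar>x\<bar> + 1) * s N" by (rule u_init)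
    also have "\<dots> \<le> B * (\<bar>x\<bar> + 1) * 1" using s_bounds(2)[of N] B by (intro mult_left_mono) auto
    finally have "\<bar>u N p\<bar> \<le> w p" using 1 unfolding w_def p by simp
    then show ?thesis using w1[of p] by (simp add: divide_le_eq)
  qed
  obtain k where k: "strict_mono k" "\<And>p. p \<in> D \<Longrightarrow> \<exists>l. (\<lambda>N. u (k N) p / w p) \<longlonglongrightarrow> l"
    by (rule function_convergent_subsequence[OF cD, of "\<lambda>N p. u N p / w p" 1]) (use bnd in auto)
  have conv: "convergent (\<lambda>N. u (k N) (x,t))" if t: "t \<in> {0..T}" for x t
  proof -
    have "Cauchy (\<lambda>N. u (k N) (x,t))"
    proof (rule metric_CauchyI)
      fix e :: real assume e: "e > 0"
      define d where "d = e / (8 * (\<Lambda> + 1))"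
      have d: "d > 0" "\<Lambda> * d \<le> e / 8" using e \<Lambda> by (auto simp: d_def field_simps)
      obtain x' where x': "x' \<in> \<rat>" "x < x'" "x' < x + d" using Rats_dense_in_real[of x "x+d"] d by auto
      have "max 0 (t - d) < min T (t + d)" using t d T_pos by auto
      then obtain t' where t': "t' \<in> \<rat>" "max 0 (t - d) < t'" "t' < min T (t + d)" using Rats_dense_in_real by blast
      define p where "p = (x',t')"
      have pD: "p \<in> D" using x' t' by (auto simp: D_def p_def)
      from k(2)[OF this] obtain l where "(\<lambda>N. u (k N) p / w p) \<longlonglongrightarrow> l" by blast
      then have "(\<lambda>N. u (k N) p / w p * w p) \<longlonglongrightarrow> l * w p" by (intro tendsto_intros)
      then have "(\<lambda>N. u (k N) p) \<longlonglongrightarrow> l * w p" using w1[of p] by simp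
      then have "Cauchy (\<lambda>N. u (k N) p)" using convergent_Cauchy convergent_def by blast
      then obtain M1 where M1: "\<And>m n. m \<ge> M1 \<Longrightarrow> n \<ge> M1 \<Longrightarrow> dist (u (k m) p) (u (k n) p) < e/8"
        using metric_CauchyD[of _ "e/8"] e by (metis divide_pos_pos zero_less_numeral)
      have "(\<lambda>N. s (k N)) \<longlonglongrightarrow> 0" using LIMSEQ_subseq_LIMSEQ[OF s_lim k(1)] by (simp add: o_def)
      then obtain M2 where M2: "\<And>m. m \<ge> M2 \<Longrightarrow> s (k m) < d"
        using order_tendstoD(2)[of _ 0 sequentially d] d by (auto simp: eventually_sequentially)
      have close: "\<bar>u (k m) (x,t) - u (k m) p\<bar> \<le> 3 * (e/8)" if m: "m \<ge> M2" for m
      proof -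
        have "\<bar>u (k m) (x,t) - u (k m) p\<bar> \<le> \<Lambda> * (\<bar>x - x'\<bar> + \<bar>t - t'\<bar> + s (k m))"
          unfolding p_def using t t' by (intro u_equi) auto
        also have "\<dots> \<le> \<Lambda> * (d + d + d)" using x' t' M2[OF m] \<Lambda> by (intro mult_left_mono) auto
        also have "\<dots> \<le> 3 * (e/8)" using d(2) by (simp add: algebra_simps)
        finally show ?thesis .
      qed
      show "\<exists>M. \<forall>m\<ge>M. \<forall>n\<ge>M. dist (u (k m) (x,t)) (u (k n) (x,t)) < e"
      proof (intro exI[of _ "max M1 M2"] allI impI)
        fix m n assume mn: "m \<ge> max M1 M2" "n \<ge> max M1 M2"
        then have "\<bar>u (k m) p - u (k n) p\<bar> < e/8" using M1[of m n] by (simp add: dist_real_def)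
        then show "dist (u (k m) (x,t)) (u (k n) (x,t)) < e"
          using close[of m] close[of n] mn e unfolding dist_real_def by linarith
      qed
    qed
    then show ?thesis by (simp add: Cauchy_convergent)
  qed
  then show ?thesis using k(1)
    by (intro exI[of _ k] exI[of _ "\<lambda>p. lim (\<lambda>N. u (k N) p)"]) (auto simp: convergent_LIMSEQ_iff)
qed

end

lemma norm2_Pair: "(norm (p - q :: real \<times> real))\<^sup>2 = (fst p - fst q)\<^sup>2 + (snd p - snd q)\<^sup>2"
  by (cases p; cases q) (simp add: norm_Pair)

locale approximation_limit = approximation +
  fixes k :: "nat \<Rightarrow> nat" and \<kappa> :: "real \<times> real \<Rightarrow> real"
  assumes k: "strict_mono k"
    and lim: "\<And>x t. t \<in> {0..T} \<Longrightarrow> (\<lambda>N. u (k N) (x,t)) \<longlonglongrightarrow> \<kappa> (x,t)"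
begin

lemma s_k: "(\<lambda>N. s (k N)) \<longlonglongrightarrow> 0"
  using LIMSEQ_subseq_LIMSEQ[OF s_lim k] by (simp add: o_def)

lemma kappa_lip_sum:
  assumes "t \<in> {0..T}" "t' \<in> {0..T}"
  shows "\<bar>\<kappa> (x',t') - \<kappa> (x,t)\<bar> \<le> \<Lambda> * (\<bar>x' - x\<bar> + \<bar>t' - t\<bar>)"
proof (rule LIMSEQ_le)
  show "(\<lambda>N. \<bar>u (k N) (x',t') - u (k N) (x,t)\<bar>) \<longlonglongrightarrow> \<bar>\<kappa> (x',t') - \<kappa> (x,t)\<bar>"
    by (intro tendsto_intros lim assms)
  have "(\<lambda>N. \<Lambda> * (\<bar>x' - x\<bar> + \<bar>t' - t\<bar> + s (k N))) \<longlonglongrightarrow> \<Lambda> * (\<bar>x' - x\<bar> + \<bar>t' - t\<bar> + 0)"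
    by (intro tendsto_intros s_k)
  then show "(\<lambda>N. \<Lambda> * (\<bar>x' - x\<bar> + \<bar>t' - t\<bar> + s (k N))) \<longlonglongrightarrow> \<Lambda> * (\<bar>x' - x\<bar> + \<bar>t' - t\<bar>)" by simp
  show "\<exists>N. \<forall>n\<ge>N. \<bar>u (k n) (x',t') - u (k n) (x,t)\<bar> \<le> \<Lambda> * (\<bar>x' - x\<bar> + \<bar>t' - t\<bar> + s (k n))"
    using u_equi assms by blast
qed

lemma kappa_lipschitz: "(2 * \<Lambda>)-lipschitz_on (UNIV \<times> {0..T}) \<kappa>"
proof (rule lipschitz_onI)
  fix p q :: "real \<times> real" assume "p \<in> UNIV \<times> {0..T}" "q \<in> UNIV \<times> {0..T}"
  then have "\<bar>\<kappa> p - \<kappa> q\<bar> \<le> \<Lambda> * (\<bar>fst p - fst q\<bar> + \<bar>snd p - snd q\<bar>)"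
    using kappa_lip_sum[of "snd q" "snd p" "fst p" "fst q"] by auto
  also have "\<dots> \<le> \<Lambda> * (dist p q + dist p q)"
    using dist_fst_le[of p q] dist_snd_le[of p q] \<Lambda> by (intro mult_left_mono add_mono) (auto simp: dist_real_def)
  finally show "dist (\<kappa> p) (\<kappa> q) \<le> 2 * \<Lambda> * dist p q" by (simp add: dist_real_def)
qed (use \<Lambda> in simp)

lemma kappa_init: "\<kappa> (x,0) = k0 x"
proof (rule LIMSEQ_unique)
  show "(\<lambda>N. u (k N) (x,0)) \<longlonglongrightarrow> \<kappa> (x,0)" using T_pos by (intro lim) auto
  have "(\<lambda>N. B * (\<bar>x\<bar> + 1) * s (k N)) \<longlonglongrightarrow> B * (\<bar>x\<bar> + 1) * 0" by (intro tendsto_intros s_k)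
  then have "(\<lambda>N. u (k N) (x,0) - k0 x) \<longlonglongrightarrow> 0"
    by (intro Lim_null_comparison[of "\<lambda>N. u (k N) (x,0) - k0 x"]) (auto simp: u_init)
  then show "(\<lambda>N. u (k N) (x,0)) \<longlonglongrightarrow> k0 x" by (simp add: LIM_zero_iff)
qed

text \<open>The time level \<open>t'\<close> at which \<open>rho\<close> is sampled lags behind
  \<open>t\<close> by at most \<open>s\<close>, so continuity of \<open>rho\<close> removes the lag.
  This is the integrated form of \<open>kappa_x \<ge> |rho_x|\<close>.\<close>

lemma kappa_diff_ge:
  assumes xy: "x \<le> y" and t: "0 \<le> t" "t < T"
  shows "\<bar>rho (y,t) - rho (x,t)\<bar> \<le> \<kappa> (y,t) - \<kappa> (x,t)"
proof -
  have "\<forall>N. \<exists>t'. 0 \<le> t' \<and> t' \<le> t \<and> t - t' \<le> s (k N) \<and> \<bar>rho (y,t') - rho (x,t')\<bar> - B * s (k N) \<le> u (k N) (y,t) - u (k N) (x,t)"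
    using u_diff[OF xy t] by blast
  then obtain t' where t': "\<And>N. 0 \<le> t' N" "\<And>N. t' N \<le> t" "\<And>N. t - t' N \<le> s (k N)"
    "\<And>N. \<bar>rho (y,t' N) - rho (x,t' N)\<bar> - B * s (k N) \<le> u (k N) (y,t) - u (k N) (x,t)" by metis
  have "(\<lambda>N. t' N - t) \<longlonglongrightarrow> 0"
    by (rule Lim_null_comparison[OF _ s_k]) (use t' in \<open>auto simp: abs_le_iff intro: order_trans[OF _ less_imp_le[OF s_bounds(1)]]\<close>)
  then have tl: "t' \<longlonglongrightarrow> t" by (simp add: LIM_zero_iff)
  have t'T: "t' N \<le> T" for N using t'(2)[of N] t by linarith
  have rl: "(\<lambda>N. rho (z, t' N)) \<longlonglongrightarrow> rho (z,t)" for z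
    using t t' t'T by (intro continuous_on_tendsto_compose[OF rho_cont] tendsto_intros tl) auto
  show ?thesis
  proof (rule LIMSEQ_le)
    have "(\<lambda>N. \<bar>rho (y,t' N) - rho (x,t' N)\<bar> - B * s (k N)) \<longlonglongrightarrow> \<bar>rho (y,t) - rho (x,t)\<bar> - B * 0"
      by (intro tendsto_intros rl s_k)
    then show "(\<lambda>N. \<bar>rho (y,t' N) - rho (x,t' N)\<bar> - B * s (k N)) \<longlonglongrightarrow> \<bar>rho (y,t) - rho (x,t)\<bar>" by simp
    show "(\<lambda>N. u (k N) (y,t) - u (k N) (x,t)) \<longlonglongrightarrow> \<kappa> (y,t) - \<kappa> (x,t)"
      using t by (intro tendsto_intros lim) auto
  qed (use t' in blast)
qed

text \<open>Equicontinuity up to \<open>s\<close> upgrades pointwise convergence to convergence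
  along moving points, as needed for the maximisers on the grid.\<close>

lemma lim_moving:
  assumes p: "p \<longlonglongrightarrow> (x,t)" and ps: "\<And>N. snd (p N) \<in> {0..T}" and t: "t \<in> {0..T}" and m: "strict_mono m"
  shows "(\<lambda>N. u (k (m N)) (p N)) \<longlonglongrightarrow> \<kappa> (x,t)"
proof -
  have sm: "(\<lambda>N. s (k (m N))) \<longlonglongrightarrow> 0" using LIMSEQ_subseq_LIMSEQ[OF s_k m] by (simp add: o_def)
  have 1: "(\<lambda>N. u (k (m N)) (x,t)) \<longlonglongrightarrow> \<kappa> (x,t)" using LIMSEQ_subseq_LIMSEQ[OF lim[OF t] m] by (simp add: o_def)
  have fs: "(\<lambda>N. fst (p N)) \<longlonglongrightarrow> x" "(\<lambda>N. snd (p N)) \<longlonglongrightarrow> t" using tendsto_fst[OF p] tendsto_snd[OF p] by auto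
  have "(\<lambda>N. \<Lambda> * (\<bar>fst (p N) - x\<bar> + \<bar>snd (p N) - t\<bar> + s (k (m N)))) \<longlonglongrightarrow> \<Lambda> * (\<bar>x - x\<bar> + \<bar>t - t\<bar> + 0)"
    by (intro tendsto_intros fs sm)
  then have "(\<lambda>N. u (k (m N)) (p N) - u (k (m N)) (x,t)) \<longlonglongrightarrow> 0"
  proof (intro Lim_null_comparison[of "\<lambda>N. u (k (m N)) (p N) - u (k (m N)) (x,t)"] always_eventually allI)
    fix N show "norm (u (k (m N)) (p N) - u (k (m N)) (x,t)) \<le> \<Lambda> * (\<bar>fst (p N) - x\<bar> + \<bar>snd (p N) - t\<bar> + s (k (m N)))"
      using u_equi[OF t ps, of "k (m N)" "fst (p N)" N x] by simp
  qed simp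
  from tendsto_add[OF this 1] show ?thesis by simp
qed

end

section \<open>Viscosity inequalities for the limit\<close>

context approximation_limit
begin

text \<open>Increments of \<open>\<kappa>\<close> dominate those of \<open>rho\<close>. Moving right
  for \<open>S = 1\<close> and left for \<open>S = -1\<close> is the direction in which touching
  bounds the increment of \<open>\<kappa>\<close> by that of \<open>\<psi>\<close>.\<close>

lemma quadratic_test_gradient:
  fixes A \<alpha> \<beta> r x0 t0 S :: real
  defines "\<psi> \<equiv> \<lambda>p. A * ((fst p - \<alpha>)\<^sup>2 + (snd p - \<beta>)\<^sup>2)"
  assumes S: "S = 1 \<or> S = -1" and t0: "0 < t0" "t0 < T" and r: "r > 0"
    and mx: "\<And>p. p \<in> ball (x0,t0) r \<Longrightarrow> S * (\<kappa> p - \<psi> p) \<le> S * (\<kappa> (x0,t0) - \<psi> (x0,t0))"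
  shows "\<bar>rx (x0,t0)\<bar> \<le> 2 * A * (x0 - \<alpha>)"
proof (rule tendsto_le[OF trivial_limit_at_right_real])
  define \<rho> where "\<rho> y = rho (y,t0)" for y
  have d: "(\<rho> has_real_derivative rx (x0,t0)) (at x0)" unfolding \<rho>_def using rho_x t0 by simp
  then have 1: "((\<lambda>h. (\<rho> (x0 + h) - \<rho> x0) / h) \<longlongrightarrow> rx (x0,t0)) (at 0)" by (simp add: DERIV_def)
  have f: "filterlim (\<lambda>\<eta>::real. S * \<eta>) (at 0) (at_right 0)"
    unfolding filterlim_at using S by (auto intro!: tendsto_eq_intros simp: eventually_at_filter)
  show "((\<lambda>\<eta>. \<bar>(\<rho> (x0 + S * \<eta>) - \<rho> x0) / (S * \<eta>)\<bar>) \<longlongrightarrow> \<bar>rx (x0,t0)\<bar>) (at_right 0)"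
    by (intro tendsto_intros filterlim_compose[OF 1 f])
  have "((\<lambda>\<eta>. 2 * A * (x0 - \<alpha>) + S * A * \<eta>) \<longlongrightarrow> 2 * A * (x0 - \<alpha>) + S * A * 0) (at_right 0)"
    by (intro tendsto_intros)
  then show "((\<lambda>\<eta>. 2 * A * (x0 - \<alpha>) + S * A * \<eta>) \<longlongrightarrow> 2 * A * (x0 - \<alpha>)) (at_right 0)" by simp
  have main: "\<bar>(\<rho> (x0 + S * \<eta>) - \<rho> x0) / (S * \<eta>)\<bar> \<le> 2 * A * (x0 - \<alpha>) + S * A * \<eta>" if \<eta>: "0 < \<eta>" "\<eta> < r" for \<eta>
  proof -
    define y where "y = x0 + S * \<eta>"
    have "(y,t0) \<in> ball (x0,t0) r" using \<eta> S by (auto simp: y_def dist_Pair_Pair dist_real_def)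
    from mx[OF this] have "S * (\<kappa> (y,t0) - \<kappa> (x0,t0)) \<le> S * (\<psi> (y,t0) - \<psi> (x0,t0))" by (simp add: algebra_simps)
    also have "S * (\<psi> (y,t0) - \<psi> (x0,t0)) = (S * S) * \<eta> * (2 * A * (x0 - \<alpha>) + S * A * \<eta>)"
      by (simp add: \<psi>_def y_def power2_eq_square algebra_simps)
    finally have 2: "S * (\<kappa> (y,t0) - \<kappa> (x0,t0)) \<le> \<eta> * (2 * A * (x0 - \<alpha>) + S * A * \<eta>)" using S by auto
    have "\<bar>\<rho> y - \<rho> x0\<bar> \<le> S * (\<kappa> (y,t0) - \<kappa> (x0,t0))"
    proof (cases "S = 1")
      case True then show ?thesis using kappa_diff_ge[of x0 y t0] \<eta> t0 by (simp add: y_def \<rho>_def)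
    next
      case False
      then show ?thesis using S kappa_diff_ge[of y x0 t0] \<eta> t0 by (auto simp: y_def \<rho>_def abs_minus_commute)
    qed
    with 2 have "\<bar>\<rho> y - \<rho> x0\<bar> / \<eta> \<le> 2 * A * (x0 - \<alpha>) + S * A * \<eta>" using \<eta> by (simp add: pos_divide_le_eq mult.commute)
    moreover have "\<bar>S * \<eta>\<bar> = \<eta>" using S \<eta> by auto
    ultimately show ?thesis unfolding abs_divide y_def by simp
  qed
  have "\<forall>\<^sub>F \<eta> in at_right 0. \<eta> \<in> {0<..<r}" by (rule eventually_at_right_real[OF r])
  then show "\<forall>\<^sub>F \<eta> in at_right 0. \<bar>(\<rho> (x0 + S * \<eta>) - \<rho> x0) / (S * \<eta>)\<bar> \<le> 2 * A * (x0 - \<alpha>) + S * A * \<eta>"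
    by eventually_elim (use main in auto)
qed

lemma finite_grid:
  assumes "h N > 0" "\<tau> N > 0"
  shows "finite {(i::int, n::nat). (real_of_int i * h N, real n * \<tau> N) \<in> cball p r}"
proof (rule finite_subset)
  define a b where "a = (\<bar>fst p\<bar> + r) / h N" and "b = (\<bar>snd p\<bar> + r) / \<tau> N"
  show "{(i::int, n::nat). (real_of_int i * h N, real n * \<tau> N) \<in> cball p r} \<subseteq> {-\<lceil>a\<rceil>..\<lceil>a\<rceil>} \<times> {..nat \<lceil>b\<rceil>}"
  proof
    fix ij :: "int \<times> nat" assume ij: "ij \<in> {(i, n). (real_of_int i * h N, real n * \<tau> N) \<in> cball p r}"
    obtain i n where in_eq: "ij = (i, n)" by force
    with ij have "(real_of_int i * h N, real n * \<tau> N) \<in> cball p r" by simp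
    then have "\<bar>fst p - real_of_int i * h N\<bar> \<le> r" "\<bar>snd p - real n * \<tau> N\<bar> \<le> r"
      using dist_fst_le[of p "(real_of_int i * h N, real n * \<tau> N)"] dist_snd_le[of p "(real_of_int i * h N, real n * \<tau> N)"]
      by (auto simp: dist_real_def)
    then have "\<bar>real_of_int i * h N\<bar> \<le> \<bar>fst p\<bar> + r" "real n * \<tau> N \<le> \<bar>snd p\<bar> + r" by linarith+
    then have 1: "\<bar>real_of_int i\<bar> \<le> a" and 2: "real n \<le> b" unfolding a_def b_def using assms by (auto simp: pos_le_divide_eq abs_mult)
    have "-\<lceil>a\<rceil> \<le> i" "i \<le> \<lceil>a\<rceil>" using 1 by linarith+
    moreover have "n \<le> nat \<lceil>b\<rceil>" using 2 by linarith
    ultimately show "ij \<in> {-\<lceil>a\<rceil>..\<lceil>a\<rceil>} \<times> {..nat \<lceil>b\<rceil>}" by (simp add: in_eq)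
  qed
qed simp

text \<open>For a quadratic the difference quotients in the scheme are explicit and its second
  difference quotient is constant, so consistency of the test function needs no remainder
  estimate.\<close>

lemma quadratic_test:
  fixes A \<alpha> \<beta> r x0 t0 S :: real
  defines "\<psi> \<equiv> \<lambda>p. A * ((fst p - \<alpha>)\<^sup>2 + (snd p - \<beta>)\<^sup>2)"
  assumes S: "S = 1 \<or> S = -1" and t0: "0 < t0" "t0 < T" and r: "r > 0"
    and mx: "\<And>p. p \<in> ball (x0,t0) r \<Longrightarrow> S * (\<kappa> p - \<psi> p) \<le> S * (\<kappa> (x0,t0) - \<psi> (x0,t0))"
  shows "S * ((2 * A * (x0 - \<alpha>)) * (2 * A * (t0 - \<beta>)) - rx (x0,t0) * rxx (x0,t0)) \<le> 0"
proof -
  define px where "px = 2 * A * (x0 - \<alpha>)"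
  define pt where "pt = 2 * A * (t0 - \<beta>)"
  have rpx: "\<bar>rx (x0,t0)\<bar> \<le> px"
    unfolding px_def by (rule quadratic_test_gradient[OF S t0 r]) (use mx in \<open>simp add: \<psi>_def\<close>)
  show ?thesis
  proof (cases "px = 0")
    case True
    then show ?thesis using rpx unfolding px_def[symmetric] by simp
  next
    case False
    then have px: "px > 0" using rpx by linarith
    define z where "z = (x0,t0)"
    define R where "R = min r (min t0 (T - t0)) / 2"
    have R: "R > 0" "R < r" "R < t0" "R < T - t0" using r t0 by (auto simp: R_def min_def field_simps)
    have strip: "snd p \<in> {0..T}" if "p \<in> cball z R" for p
      using dist_snd_le[of z p] that R by (auto simp: z_def dist_real_def abs_le_iff)
    \<comment> \<open>The added square makes the touching point a strict extremum, so that the grid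
      maximisers can only accumulate at \<open>z\<close>.\<close>
    define \<phi> where "\<phi> p = \<psi> p + S * ((fst p - x0)\<^sup>2 + (snd p - t0)\<^sup>2)" for p
    have SS: "S * S = 1" using S by auto
    have \<phi>: "S * (\<kappa> p - \<phi> p) = S * (\<kappa> p - \<psi> p) - ((fst p - x0)\<^sup>2 + (snd p - t0)\<^sup>2)" for p
    proof -
      have "S * (\<kappa> p - \<phi> p) = S * (\<kappa> p - \<psi> p) - (S * S) * ((fst p - x0)\<^sup>2 + (snd p - t0)\<^sup>2)"
        by (simp add: \<phi>_def algebra_simps)
      then show ?thesis by (simp add: SS)
    qed
    define pt' where "pt' N i n = (real_of_int i * h (k N), real n * \<tau> (k N))" for N and i :: int and n :: nat
    define G where "G N = {(i, n). pt' N i n \<in> cball z R}" for N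
    have finG: "finite (G N)" for N
      unfolding G_def pt'_def using finite_grid[of "k N"] h_bounds(1) tau_bounds(1) by simp
    have hk: "(\<lambda>N. h (k N)) \<longlonglongrightarrow> 0" and tk: "(\<lambda>N. \<tau> (k N)) \<longlonglongrightarrow> 0"
      by (rule Lim_null_comparison[OF _ s_k]; use h_bounds tau_bounds in \<open>auto intro!: always_eventually simp: less_imp_le\<close>)+
    define ci where "ci N = \<lfloor>x0 / h (k N)\<rfloor>" for N
    define cn where "cn N = nat \<lfloor>t0 / \<tau> (k N)\<rfloor>" for N
    \<comment> \<open>Grid points tending to \<open>z\<close>: they keep \<open>G N\<close> nonempty
      and serve as competitors for the maximisers.\<close>
    define c where "c N = pt' N (ci N) (cn N)" for N
    have c1: "\<bar>fst (c N) - x0\<bar> \<le> h (k N)" for N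
    proof -
      have "real_of_int (ci N) \<le> x0 / h (k N)" "x0 / h (k N) < real_of_int (ci N) + 1" unfolding ci_def by linarith+
      then have "real_of_int (ci N) * h (k N) \<le> x0" "x0 < (real_of_int (ci N) + 1) * h (k N)"
        using h_bounds(1)[of "k N"] by (auto simp: pos_le_divide_eq pos_divide_less_eq)
      then show ?thesis by (simp add: c_def pt'_def algebra_simps)
    qed
    have c2: "\<bar>snd (c N) - t0\<bar> \<le> \<tau> (k N)" for N
    proof -
      have "t0 / \<tau> (k N) \<ge> 0" using t0 tau_bounds(1)[of "k N"] by simp
      then have "real (cn N) = real_of_int \<lfloor>t0 / \<tau> (k N)\<rfloor>" by (simp add: cn_def)
      then have "real (cn N) \<le> t0 / \<tau> (k N)" "t0 / \<tau> (k N) < real (cn N) + 1" by linarith+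
      then have "real (cn N) * \<tau> (k N) \<le> t0" "t0 < (real (cn N) + 1) * \<tau> (k N)"
        using tau_bounds(1)[of "k N"] by (auto simp: pos_le_divide_eq pos_divide_less_eq)
      then show ?thesis by (simp add: c_def pt'_def algebra_simps)
    qed
    have cx: "(\<lambda>N. fst (c N)) \<longlonglongrightarrow> x0" "(\<lambda>N. snd (c N)) \<longlonglongrightarrow> t0"
      by (rule LIM_zero_cancel, rule Lim_null_comparison[OF _ hk] Lim_null_comparison[OF _ tk], use c1 c2 in simp)+
    then have cz: "c \<longlonglongrightarrow> z" using tendsto_Pair[OF cx] by (simp add: z_def)
    have "\<forall>\<^sub>F N in sequentially. c N \<in> cball z R"
      using tendstoD[OF cz R(1)] by eventually_elim (simp add: dist_commute)
    then obtain N0 where N0: "\<And>N. N \<ge> N0 \<Longrightarrow> c N \<in> cball z R" by (auto simp: eventually_sequentially)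
    define k' where "k' N = k (N + N0)" for N
    define f where "f N ij = S * (u (k N) (pt' N (fst ij) (snd ij)) - \<phi> (pt' N (fst ij) (snd ij)))" for N ij
    have "\<exists>ij. ij \<in> G N \<and> (\<forall>ij'\<in>G N. f N ij' \<le> f N ij)" if "N \<ge> N0" for N
    proof -
      have "(ci N, cn N) \<in> G N" using N0[OF that] by (simp add: G_def c_def)
      then have ne: "f N ` G N \<noteq> {}" by blast
      have "Max (f N ` G N) \<in> f N ` G N" using finG ne by (intro Max_in) auto
      then obtain ij where "ij \<in> G N" "f N ij = Max (f N ` G N)" by auto
      then show ?thesis using finG by (intro exI[of _ ij]) auto
    qed
    then obtain w where w: "\<And>N. N \<ge> N0 \<Longrightarrow> w N \<in> G N" "\<And>N ij. N \<ge> N0 \<Longrightarrow> ij \<in> G N \<Longrightarrow> f N ij \<le> f N (w N)" by metis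
    define Z where "Z N = pt' (N + N0) (fst (w (N + N0))) (snd (w (N + N0)))" for N
    have Zc: "Z N \<in> cball z R" for N
      using w(1)[of "N + N0"] by (auto simp: Z_def G_def case_prod_beta)
    obtain z' m where m: "z' \<in> cball z R" "strict_mono m" "(Z \<circ> m) \<longlonglongrightarrow> z'"
      using compact_cball[of z R] Zc unfolding compact_def by blast
    define M where "M N = m N + N0" for N
    have M: "strict_mono M" using m(2) by (simp add: M_def strict_mono_def)
    have MN0: "M N \<ge> N0" for N by (simp add: M_def)
    define i where "i N = fst (w (M N))" for N
    define n where "n N = snd (w (M N))" for N
    define p where "p N = pt' (M N) (i N) (n N)" for N
    have pz': "p \<longlonglongrightarrow> z'" using m(3) by (simp add: p_def[abs_def] Z_def M_def i_def n_def o_def)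
    have pc: "p N \<in> cball z R" for N using Zc[of "m N"] by (simp add: p_def Z_def M_def i_def n_def)
    have pmax: "S * (u (k (M N)) (pt' (M N) j l) - \<phi> (pt' (M N) j l)) \<le> S * (u (k (M N)) (p N) - \<phi> (p N))"
      if "pt' (M N) j l \<in> cball z R" for N j l
      using w(2)[OF MN0[of N], of "(j,l)"] that by (simp add: f_def G_def p_def i_def n_def)
    have \<phi>cont: "isCont \<phi> q" for q
      unfolding \<phi>_def \<psi>_def by (intro continuous_intros)
    have z't: "snd z' \<in> {0..T}" using strip m(1) by blast
    have zt: "t0 \<in> {0..T}" using t0 by simp
    have "S * (\<kappa> z - \<phi> z) \<le> S * (\<kappa> z' - \<phi> z')"
    proof (rule LIMSEQ_le)
      have cM: "(\<lambda>N. c (M N)) \<longlonglongrightarrow> z" using LIMSEQ_subseq_LIMSEQ[OF cz M] by (simp add: o_def)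
      have "(\<lambda>N. u (k (M N)) (c (M N))) \<longlonglongrightarrow> \<kappa> (x0,t0)"
        by (rule lim_moving[OF _ _ zt M]) (use cM N0[OF MN0] strip in \<open>auto simp: z_def\<close>)
      then show "(\<lambda>N. S * (u (k (M N)) (c (M N)) - \<phi> (c (M N)))) \<longlonglongrightarrow> S * (\<kappa> z - \<phi> z)"
        by (intro tendsto_intros isCont_tendsto_compose[OF \<phi>cont] cM) (simp add: z_def)
      have "(\<lambda>N. u (k (M N)) (p N)) \<longlonglongrightarrow> \<kappa> (fst z', snd z')"
        by (rule lim_moving[OF _ _ z't M]) (use pz' pc strip in auto)
      then show "(\<lambda>N. S * (u (k (M N)) (p N) - \<phi> (p N))) \<longlonglongrightarrow> S * (\<kappa> z' - \<phi> z')"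
        by (intro tendsto_intros isCont_tendsto_compose[OF \<phi>cont] pz') simp
      show "\<exists>N. \<forall>n\<ge>N. S * (u (k (M n)) (c (M n)) - \<phi> (c (M n))) \<le> S * (u (k (M n)) (p n) - \<phi> (p n))"
        using pmax N0[OF MN0] by (auto simp: c_def)
    qed
    moreover have "S * (\<kappa> z' - \<psi> z') \<le> S * (\<kappa> z - \<psi> z)"
      unfolding z_def by (rule mx) (use m(1) R(2) in \<open>auto simp: z_def\<close>)
    ultimately have "(fst z' - x0)\<^sup>2 + (snd z' - t0)\<^sup>2 \<le> 0" unfolding \<phi> by (simp add: z_def)
    then have "fst z' = x0" "snd z' = t0" by (auto simp: sum_power2_le_zero_iff)
    then have "z' = z" by (simp add: z_def prod_eq_iff)
    then have pz: "p \<longlonglongrightarrow> z" using pz' by simp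
    have kM: "strict_mono (\<lambda>N. k (M N))" using k M by (simp add: strict_mono_def)
    define x where "x N = fst (p N)" for N
    define H where "H N = h (k (M N))" for N
    define \<tau>' where "\<tau>' N = \<tau> (k (M N))" for N
    define s' where "s' N = s (k (M N))" for N
    have xl: "x \<longlonglongrightarrow> x0" using tendsto_fst[OF pz] by (simp add: x_def[abs_def] z_def)
    have tl: "(\<lambda>N. real (n N) * \<tau>' N) \<longlonglongrightarrow> t0" using tendsto_snd[OF pz] by (simp add: p_def pt'_def \<tau>'_def z_def)
    have Hl: "H \<longlonglongrightarrow> 0" and \<tau>l: "\<tau>' \<longlonglongrightarrow> 0" and sl: "s' \<longlonglongrightarrow> 0"
      using LIMSEQ_subseq_LIMSEQ[OF hk M] LIMSEQ_subseq_LIMSEQ[OF tk M] LIMSEQ_subseq_LIMSEQ[OF s_k M]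
      by (simp_all add: o_def H_def[abs_def] \<tau>'_def[abs_def] s'_def[abs_def])
    \<comment> \<open>The maximiser plays the new time level of the scheme and \<open>n'\<close> the
      old one; \<open>n N\<close> is eventually positive because its time tends to
      \<open>t0 > 0\<close>.\<close>
    define n' where "n' N = n N - 1" for N
    have tpos: "\<forall>\<^sub>F N in sequentially. real (n N) * \<tau>' N > 0" using order_tendstoD(1)[OF tl t0(1)] .
    have nS: "\<forall>\<^sub>F N in sequentially. n N = Suc (n' N)"
      using tpos
    proof eventually_elim
      case (elim N)
      then have "n N \<noteq> 0" by (auto simp: zero_less_mult_iff)
      then show ?case by (simp add: n'_def)
    qed
    have "(\<lambda>N. real (n N) * \<tau>' N - \<tau>' N) \<longlonglongrightarrow> t0 - 0" by (intro tendsto_intros tl \<tau>l)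
    moreover have "\<forall>\<^sub>F N in sequentially. real (n N) * \<tau>' N - \<tau>' N = real (n' N) * \<tau>' N"
      using nS by eventually_elim (simp add: algebra_simps)
    ultimately have tl': "(\<lambda>N. real (n' N) * \<tau>' N) \<longlonglongrightarrow> t0" by (simp add: tendsto_cong)
    define D where "D N = 2 * A * (x N - \<alpha>) + 2 * S * (x N - x0)" for N
    have "D \<longlonglongrightarrow> 2 * A * (x0 - \<alpha>) + 2 * S * (x0 - x0)" unfolding D_def by (intro tendsto_intros xl)
    then have Dl: "D \<longlonglongrightarrow> px" by (simp add: px_def)
    \<comment> \<open>The exact backward time quotient of \<open>\<phi>\<close> at the maximiser,
      just as \<open>D\<close> is its exact central quotient in space at time level
      \<open>n'\<close>.\<close>
    define E where "E N = A * (2 * (real (n N) * \<tau>' N - \<beta>) - \<tau>' N) + S * (2 * (real (n N) * \<tau>' N - t0) - \<tau>' N)" for N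
    have "E \<longlonglongrightarrow> A * (2 * (t0 - \<beta>) - 0) + S * (2 * (t0 - t0) - 0)" unfolding E_def by (intro tendsto_intros tl \<tau>l)
    then have El: "E \<longlonglongrightarrow> pt" by (simp add: pt_def algebra_simps)
    have "(\<lambda>N. C * s' N - D N) \<longlonglongrightarrow> C * 0 - px" by (intro tendsto_intros sl Dl)
    \<comment> \<open>Here \<open>px > 0\<close> is used: the slope of the test function eventually
      exceeds the vanishing floor \<open>C s'\<close>.\<close>
    then have Dbig: "\<forall>\<^sub>F N in sequentially. C * s' N - D N < 0" using px by (intro order_tendstoD) auto
    have nb: "\<forall>\<^sub>F N in sequentially. (x N + d * H N, real (n' N) * \<tau>' N) \<in> cball z R" for d
    proof -
      have "(\<lambda>N. (x N + d * H N, real (n' N) * \<tau>' N)) \<longlonglongrightarrow> (x0 + d * 0, t0)"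
        by (intro tendsto_intros xl Hl tl')
      then have "(\<lambda>N. (x N + d * H N, real (n' N) * \<tau>' N)) \<longlonglongrightarrow> z" by (simp add: z_def)
      from tendstoD[OF this R(1)] show ?thesis by eventually_elim (simp add: dist_commute)
    qed
    have ineq: "\<forall>\<^sub>F N in sequentially. S * (E N - 4 * (s' N)\<^sup>2 * (2 * (A + S))
       - Q (k (M N)) (n' N) (x N) * P (k (M N)) (n' N) (x N) / D N) \<le> 0"
      using nS Dbig nb[of 0] nb[of 1] nb[of "-1"]
    proof eventually_elim
      case (elim N)
      let ?k = "k (M N)"
      have Hp: "H N > 0" and \<tau>p: "\<tau>' N > 0" using h_bounds tau_bounds by (auto simp: H_def \<tau>'_def)
      define g where "g y = \<phi> (y, real (n' N) * \<tau>' N)" for y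
      define a where "a = \<phi> (p N)"
      have pN: "p N = (x N, real (n N) * \<tau>' N)" by (simp add: x_def p_def pt'_def \<tau>'_def)
      have xi: "x N = real_of_int (i N) * h ?k" by (simp add: x_def p_def pt'_def)
      have uK: "u ?k (p N) = K ?k (Suc (n' N)) (x N)"
        unfolding p_def pt'_def u_grid elim(1) xi ..
      have nbr: "S * (K ?k (n' N) (real_of_int j * h ?k) - g (real_of_int j * h ?k)) \<le> S * (K ?k (Suc (n' N)) (x N) - a)"
        if "(real_of_int j * h ?k, real (n' N) * \<tau>' N) \<in> cball z R" for j
        using pmax[of N j "n' N"] that unfolding uK a_def g_def by (simp add: pt'_def u_grid \<tau>'_def)
      have e1: "x N + h ?k = real_of_int (i N + 1) * h ?k" "x N - h ?k = real_of_int (i N - 1) * h ?k"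
        by (auto simp: xi algebra_simps)
      have t3: "S * (K ?k (n' N) y - g y) \<le> S * (K ?k (Suc (n' N)) (x N) - a)" if "y \<in> {x N, x N + h ?k, x N - h ?k}" for y
      proof -
        have "(y, real (n' N) * \<tau>' N) \<in> cball z R" using that elim by (auto simp: H_def)
        moreover have "\<exists>j. y = real_of_int j * h ?k"
          using \<open>y \<in> {x N, x N + h ?k, x N - h ?k}\<close> unfolding e1 unfolding xi by blast
        ultimately show ?thesis using nbr by blast
      qed
      have D1: "D N = (g (x N + h ?k) - g (x N - h ?k)) / (2 * h ?k)"
        using Hp unfolding H_def by (simp add: D_def g_def \<phi>_def \<psi>_def field_simps power2_eq_square)
      have D2: "C * s ?k \<le> D N" using elim(2) by (simp add: s'_def)
      from touching[OF S t3 D1 D2]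
      have "S * ((a - g (x N)) / \<tau> ?k - 4 * (s ?k)\<^sup>2 * (diff2 (h ?k) g (x N) / (h ?k)\<^sup>2) - Q ?k (n' N) (x N) * P ?k (n' N) (x N) / D N) \<le> 0" .
      moreover have "(a - g (x N)) / \<tau> ?k = E N"
      proof -
        have "real (n N) * \<tau>' N = real (n' N) * \<tau>' N + \<tau>' N" using elim(1) by (simp add: algebra_simps)
        then show ?thesis using \<tau>p unfolding a_def g_def pN E_def \<phi>_def \<psi>_def
          by (simp add: \<tau>'_def[symmetric] field_simps power2_eq_square)
      qed
      moreover have "diff2 (h ?k) g (x N) / (h ?k)\<^sup>2 = 2 * (A + S)"
        using Hp unfolding H_def by (simp add: diff2_def g_def \<phi>_def \<psi>_def field_simps power2_eq_square)
      ultimately show ?case by (simp add: s'_def)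
    qed
    have "S * (pt - 4 * 0\<^sup>2 * (2 * (A + S)) - rxx (x0,t0) * rx (x0,t0) / px) \<le> 0"
    proof (rule tendsto_upperbound[OF _ ineq])
      have "(\<lambda>N. P (k (M N)) (n' N) (x N)) \<longlonglongrightarrow> rx (x0,t0)" "(\<lambda>N. Q (k (M N)) (n' N) (x N)) \<longlonglongrightarrow> rxx (x0,t0)"
        using P_lim[OF kM xl _ t0] Q_lim[OF kM xl _ t0] tl' by (auto simp: \<tau>'_def)
      then show "(\<lambda>N. S * (E N - 4 * (s' N)\<^sup>2 * (2 * (A + S)) - Q (k (M N)) (n' N) (x N) * P (k (M N)) (n' N) (x N) / D N))
        \<longlonglongrightarrow> S * (pt - 4 * 0\<^sup>2 * (2 * (A + S)) - rxx (x0,t0) * rx (x0,t0) / px)"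
        using px by (intro tendsto_intros El sl Dl) auto
    qed simp
    then have "px * (S * (pt - rxx (x0,t0) * rx (x0,t0) / px)) \<le> 0"
      using px by (simp add: mult_nonneg_nonpos)
    also have "px * (S * (pt - rxx (x0,t0) * rx (x0,t0) / px)) = S * (px * pt - rx (x0,t0) * rxx (x0,t0))"
      using px by (simp add: field_simps)
    finally show ?thesis by (simp add: px_def pt_def)
  qed
qed

text \<open>Doubling of variables replaces a \<open>C\<^sup>1\<close> test function by a quadratic one: at a maximum of
  \<open>S (\<kappa> p - \<phi> q) - |p - q|\<^sup>2 / (2\<delta>) - |q - z|\<^sup>2\<close> the quadratic term tests \<open>\<kappa>\<close> in \<open>p\<close>,
  and its gradient is that of \<open>\<phi>\<close> at \<open>q\<close> up to a term vanishing with \<open>\<delta>\<close>.\<close>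
lemma doubling:
  fixes z :: "real \<times> real" and \<delta> :: real
  assumes S: "S = 1 \<or> S = -1" and r: "r > 0" and sub: "cball z r \<subseteq> UNIV \<times> {0<..<T}"
    and d: "\<And>q. q \<in> cball z r \<Longrightarrow> (\<phi> has_derivative D q) (at q)"
    and mx: "\<And>q. q \<in> cball z r \<Longrightarrow> S * (\<kappa> q - \<phi> q) \<le> S * (\<kappa> z - \<phi> z)"
    and \<delta>: "\<delta> > 0" "2 * \<delta> * (2 * \<Lambda>) + sqrt (2 * \<delta>) * (2 * \<Lambda>) < r"
  shows "\<exists>a b. a \<in> ball z r \<and> b \<in> ball z r \<and> dist a z \<le> 2 * \<delta> * (2 * \<Lambda>) + sqrt (2 * \<delta>) * (2 * \<Lambda>) \<and> dist b z \<le> sqrt (2 * \<delta>) * (2 * \<Lambda>) \<and>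
    S * ((D b (1,0) + 2 * S * (fst b - fst z)) * (D b (0,1) + 2 * S * (snd b - snd z)) - rx a * rxx a) \<le> 0"
proof -
  define L where "L = 2 * \<Lambda>"
  have L: "L \<ge> 0" using \<Lambda> by (simp add: L_def)
  have SS: "S * S = 1" using S by auto
  define \<Psi> where "\<Psi> p q = S * (\<kappa> p - \<phi> q) - (norm (p - q))\<^sup>2 / (2 * \<delta>) - (norm (q - z))\<^sup>2" for p q
  have \<phi>c: "continuous_on (cball z r) \<phi>"
    using d by (meson continuous_at_imp_continuous_on has_derivative_continuous)
  have \<kappa>c: "continuous_on (cball z r) \<kappa>"
    by (rule continuous_on_subset[OF lipschitz_on_continuous_on[OF kappa_lipschitz]]) (use sub in force)
  have "continuous_on (cball z r \<times> cball z r) (\<lambda>w. \<Psi> (fst w) (snd w))"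
    unfolding \<Psi>_def
    by (intro continuous_intros continuous_on_compose2[OF \<phi>c] continuous_on_compose2[OF \<kappa>c]) (use \<delta> in auto)
  moreover have "(z,z) \<in> cball z r \<times> cball z r" using r by simp
  ultimately obtain w where w: "w \<in> cball z r \<times> cball z r"
    "\<And>w'. w' \<in> cball z r \<times> cball z r \<Longrightarrow> \<Psi> (fst w') (snd w') \<le> \<Psi> (fst w) (snd w)"
    using continuous_attains_sup[OF compact_Times[OF compact_cball[of z r] compact_cball[of z r]], of "\<lambda>w. \<Psi> (fst w) (snd w)"]
    by blast
  define a b where "a = fst w" and "b = snd w"
  have ab: "a \<in> cball z r" "b \<in> cball z r" using w(1) by (auto simp: a_def b_def mem_Times_iff)
  have max: "\<Psi> p q \<le> \<Psi> a b" if "p \<in> cball z r" "q \<in> cball z r" for p q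
    using w(2)[of "(p,q)"] that by (simp add: a_def b_def)
  define \<rho> where "\<rho> = norm (a - b)"
  have "\<bar>\<kappa> a - \<kappa> b\<bar> \<le> L * \<rho>"
    using lipschitz_onD[OF kappa_lipschitz, of a b] ab sub by (force simp: L_def \<rho>_def dist_norm)
  then have "S * (\<kappa> a - \<kappa> b) \<le> L * \<rho>" using S by auto
  then have "S * (\<kappa> a - \<phi> b) \<le> S * (\<kappa> z - \<phi> z) + L * \<rho>"
    using mx[OF ab(2)] by (simp add: algebra_simps)
  moreover have "S * (\<kappa> z - \<phi> z) \<le> \<Psi> a b" using max[of z z] r by (simp add: \<Psi>_def)
  \<comment> \<open>Comparison with the pair \<open>(z, z)\<close> leaves only
    \<open>L \<rho>\<close> to pay for both penalties, whence
    \<open>\<rho> \<le> 2 \<delta> L\<close> and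
    \<open>|b - z|^2 \<le> 2 \<delta> L^2\<close>.\<close>
  ultimately have key: "\<rho>\<^sup>2 / (2 * \<delta>) + (norm (b - z))\<^sup>2 \<le> L * \<rho>" unfolding \<Psi>_def \<rho>_def by linarith
  have \<rho>0: "\<rho> \<ge> 0" by (simp add: \<rho>_def)
  have "\<rho>\<^sup>2 / (2 * \<delta>) \<le> L * \<rho>" using key zero_le_power2[of "norm (b - z)"] by linarith
  then have "\<rho> * \<rho> \<le> (2 * \<delta> * L) * \<rho>" using \<delta>(1) by (simp add: field_simps power2_eq_square)
  then have \<rho>: "\<rho> \<le> 2 * \<delta> * L" using \<rho>0 \<delta>(1) L by (cases "\<rho> = 0") auto
  have "\<rho>\<^sup>2 / (2 * \<delta>) \<ge> 0" using \<delta>(1) by simp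
  then have "(norm (b - z))\<^sup>2 \<le> L * \<rho>" using key by linarith
  also have "\<dots> \<le> L * (2 * \<delta> * L)" using \<rho> L by (intro mult_left_mono)
  also have "\<dots> = (sqrt (2 * \<delta>) * L)\<^sup>2" using \<delta>(1) by (simp add: power_mult_distrib power2_eq_square)
  finally have bz: "dist b z \<le> sqrt (2 * \<delta>) * L"
    unfolding dist_norm by (rule power2_le_imp_le) (use \<delta>(1) L in auto)
  have az: "dist a z \<le> 2 * \<delta> * L + sqrt (2 * \<delta>) * L"
    using dist_triangle[of a z b] bz \<rho> by (simp add: \<rho>_def dist_norm)
  have ab': "a \<in> ball z r" "b \<in> ball z r"
  proof -
    have "0 \<le> 2 * \<delta> * L" using \<delta>(1) L by simp
    then show "a \<in> ball z r" "b \<in> ball z r"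
      using az bz \<delta>(2) unfolding L_def[symmetric] mem_ball dist_commute[of z] by linarith+
  qed
  \<comment> \<open>\<open>b\<close> is an interior maximum of \<open>\<Psi> a\<close>; the
    vanishing derivative identifies the slope of the quadratic penalty with the gradient of
    \<open>\<phi>\<close>, up to a multiple of \<open>b - z\<close>.\<close>
  have stat: "S * D b v = (inner (a - b) v) / \<delta> - 2 * inner (b - z) v" for v
  proof -
    obtain \<epsilon> where \<epsilon>: "\<epsilon> > 0" "ball b \<epsilon> \<subseteq> ball z r" by (rule openE[OF open_ball ab'(2)])
    have "(\<Psi> a has_derivative (\<lambda>v. S * (0 - D b v) - (inner (a - b) (0 - v) + inner (0 - v) (a - b)) / (2 * \<delta>)
        - (inner (b - z) (v - 0) + inner (v - 0) (b - z)))) (at b)"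
    proof -
      have 1: "((\<lambda>x. inner (a - x) (a - x)) has_derivative (\<lambda>v. inner (a - b) (0 - v) + inner (0 - v) (a - b))) (at b)"
        "((\<lambda>x. inner (x - z) (x - z)) has_derivative (\<lambda>v. inner (b - z) (v - 0) + inner (v - 0) (b - z))) (at b)"
        by (rule has_derivative_inner has_derivative_diff has_derivative_const has_derivative_ident)+
      show ?thesis unfolding \<Psi>_def power2_norm_eq_inner
        by (intro has_derivative_diff has_derivative_mult_right has_derivative_const d[OF ab(2)] 1
            bounded_linear.has_derivative[OF bounded_linear_divide 1(1)])
    qed
    moreover have "\<Psi> a q \<le> \<Psi> a b" if "q \<in> ball b \<epsilon>" for q using max[of a q] ab \<epsilon>(2) that by force
    ultimately have "(\<lambda>v. S * (0 - D b v) - (inner (a - b) (0 - v) + inner (0 - v) (a - b)) / (2 * \<delta>)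
        - (inner (b - z) (v - 0) + inner (v - 0) (b - z))) = (\<lambda>v. 0)"
      using \<epsilon>(1) by (intro differential_zero_maxmin[of b "ball b \<epsilon>" "\<Psi> a"]) auto
    then have "S * (0 - D b v) - (inner (a - b) (0 - v) + inner (0 - v) (a - b)) / (2 * \<delta>)
        - (inner (b - z) (v - 0) + inner (v - 0) (b - z)) = 0" by metis
    then show ?thesis using \<delta>(1) by (simp add: inner_commute field_simps)
  qed
  obtain a1 a2 b1 b2 where abp: "a = (a1,a2)" "b = (b1,b2)" by (cases a; cases b)
  have a2: "0 < a2" "a2 < T" using ab(1) sub by (auto simp: abp)
  obtain \<epsilon> where \<epsilon>: "\<epsilon> > 0" "ball a \<epsilon> \<subseteq> ball z r" by (rule openE[OF open_ball ab'(1)])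
  \<comment> \<open>The test function is \<open>S / (2 \<delta>) |p - b|^2\<close>; its product with
    \<open>S\<close> is the penalty because \<open>S * S = 1\<close>.\<close>
  have "S * ((2 * (S / (2 * \<delta>)) * (a1 - b1)) * (2 * (S / (2 * \<delta>)) * (a2 - b2)) - rx (a1,a2) * rxx (a1,a2)) \<le> 0"
  proof (rule quadratic_test[OF S a2 \<epsilon>(1)])
    fix p assume "p \<in> ball (a1,a2) \<epsilon>"
    then have "p \<in> cball z r" using \<epsilon>(2) by (auto simp: abp)
    from max[OF this ab(2)] have "S * \<kappa> p - (norm (p - b))\<^sup>2 / (2 * \<delta>) \<le> S * \<kappa> a - (norm (a - b))\<^sup>2 / (2 * \<delta>)"
      by (simp add: \<Psi>_def algebra_simps)
    moreover have "S * (\<kappa> q - S / (2 * \<delta>) * ((fst q - b1)\<^sup>2 + (snd q - b2)\<^sup>2)) = S * \<kappa> q - (norm (q - b))\<^sup>2 / (2 * \<delta>)" for q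
    proof -
      have "S * (\<kappa> q - S / (2 * \<delta>) * ((fst q - b1)\<^sup>2 + (snd q - b2)\<^sup>2)) = S * \<kappa> q - (S * S) * ((fst q - b1)\<^sup>2 + (snd q - b2)\<^sup>2) / (2 * \<delta>)"
        by (simp add: right_diff_distrib mult.assoc)
      then show ?thesis by (simp add: SS norm2_Pair abp)
    qed
    ultimately show "S * (\<kappa> p - S / (2 * \<delta>) * ((fst p - b1)\<^sup>2 + (snd p - b2)\<^sup>2))
      \<le> S * (\<kappa> (a1,a2) - S / (2 * \<delta>) * ((fst (a1,a2) - b1)\<^sup>2 + (snd (a1,a2) - b2)\<^sup>2))"
      by (simp only: abp(1)[symmetric])
  qed
  moreover have "2 * (S / (2 * \<delta>)) * (a1 - b1) = D b (1,0) + 2 * S * (fst b - fst z)"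
  proof -
    have "S * (S * D b (1,0)) = S * ((a1 - b1) / \<delta> - 2 * (b1 - fst z))" unfolding stat by (simp add: abp inner_prod_def)
    then show ?thesis using SS \<delta>(1) by (simp add: abp mult.assoc[symmetric] right_diff_distrib diff_divide_distrib)
  qed
  moreover have "2 * (S / (2 * \<delta>)) * (a2 - b2) = D b (0,1) + 2 * S * (snd b - snd z)"
  proof -
    have "S * (S * D b (0,1)) = S * ((a2 - b2) / \<delta> - 2 * (b2 - snd z))" unfolding stat by (simp add: abp inner_prod_def)
    then show ?thesis using SS \<delta>(1) by (simp add: abp mult.assoc[symmetric] right_diff_distrib diff_divide_distrib)
  qed
  ultimately have "S * ((D b (1,0) + 2 * S * (fst b - fst z)) * (D b (0,1) + 2 * S * (snd b - snd z)) - rx a * rxx a) \<le> 0"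
    by (simp only: abp(1)[symmetric])
  then show ?thesis using ab' az bz unfolding L_def[symmetric] by blast
qed

text \<open>As \<open>\<delta>\<close> tends to 0 both points of the doubling argument tend to
  \<open>z\<close>, and continuity of the partial derivatives of \<open>\<phi>\<close> and of
  \<open>rx\<close>, \<open>rxx\<close> carries the inequality over.\<close>

lemma C1_test:
  fixes z :: "real \<times> real"
  assumes S: "S = 1 \<or> S = -1" and e: "e > 0" and sub: "ball z e \<subseteq> UNIV \<times> {0<..<T}"
    and C1: "C1_on (ball z e) \<phi> D"
    and mx: "\<And>q. q \<in> ball z e \<Longrightarrow> S * (\<kappa> q - \<phi> q) \<le> S * (\<kappa> z - \<phi> z)"
  shows "S * (D z (1,0) * D z (0,1) - rx z * rxx z) \<le> 0"
proof -
  define r where "r = e / 2"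
  have r: "r > 0" "cball z r \<subseteq> ball z e" using e by (auto simp: r_def)
  define \<delta> where "\<delta> N = 1 / real (Suc N)" for N
  have \<delta>l: "\<delta> \<longlonglongrightarrow> 0" unfolding \<delta>_def by (rule lim_1_over_n[THEN LIMSEQ_Suc])
  define b1 b2 where "b1 N = 2 * \<delta> N * (2 * \<Lambda>) + sqrt (2 * \<delta> N) * (2 * \<Lambda>)" and "b2 N = sqrt (2 * \<delta> N) * (2 * \<Lambda>)" for N
  have "b1 \<longlonglongrightarrow> 2 * 0 * (2 * \<Lambda>) + sqrt (2 * 0) * (2 * \<Lambda>)" unfolding b1_def by (intro tendsto_intros \<delta>l)
  then have b1l: "b1 \<longlonglongrightarrow> 0" by simp
  have "b2 \<longlonglongrightarrow> sqrt (2 * 0) * (2 * \<Lambda>)" unfolding b2_def by (intro tendsto_intros \<delta>l)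
  then have b2l: "b2 \<longlonglongrightarrow> 0" by simp
  obtain N0 where N0: "\<And>N. N \<ge> N0 \<Longrightarrow> b1 N < r" using order_tendstoD(2)[OF b1l r(1)] by (auto simp: eventually_sequentially)
  have ex: "\<exists>a b. a \<in> ball z r \<and> b \<in> ball z r \<and> dist a z \<le> b1 N \<and> dist b z \<le> b2 N \<and>
      S * ((D b (1,0) + 2 * S * (fst b - fst z)) * (D b (0,1) + 2 * S * (snd b - snd z)) - rx a * rxx a) \<le> 0" if "N \<ge> N0" for N
    unfolding b1_def b2_def
  proof (rule doubling[OF S r(1)])
    show "cball z r \<subseteq> UNIV \<times> {0<..<T}" using r sub by blast
    show "(\<phi> has_derivative D q) (at q)" if "q \<in> cball z r" for q using C1 r that by (auto simp: C1_on_def)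
    show "S * (\<kappa> q - \<phi> q) \<le> S * (\<kappa> z - \<phi> z)" if "q \<in> cball z r" for q by (rule mx) (use r that in blast)
    show "\<delta> N > 0" by (simp add: \<delta>_def)
    show "2 * \<delta> N * (2 * \<Lambda>) + sqrt (2 * \<delta> N) * (2 * \<Lambda>) < r" using N0[OF that] by (simp add: b1_def)
  qed
  then have "\<forall>N. \<exists>a b. a \<in> ball z r \<and> b \<in> ball z r \<and> dist a z \<le> b1 (N + N0) \<and> dist b z \<le> b2 (N + N0) \<and>
      S * ((D b (1,0) + 2 * S * (fst b - fst z)) * (D b (0,1) + 2 * S * (snd b - snd z)) - rx a * rxx a) \<le> 0" by simp
  then obtain a b where ab: "\<And>N. a N \<in> ball z r" "\<And>N. b N \<in> ball z r" "\<And>N. dist (a N) z \<le> b1 (N + N0)" "\<And>N. dist (b N) z \<le> b2 (N + N0)"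
    "\<And>N. S * ((D (b N) (1,0) + 2 * S * (fst (b N) - fst z)) * (D (b N) (0,1) + 2 * S * (snd (b N) - snd z)) - rx (a N) * rxx (a N)) \<le> 0"
    by metis
  have al: "a \<longlonglongrightarrow> z"
  proof (rule LIM_zero_cancel, rule Lim_null_comparison)
    show "\<forall>\<^sub>F N in sequentially. norm (a N - z) \<le> b1 (N + N0)" using ab(3) by (simp add: dist_norm)
    show "(\<lambda>N. b1 (N + N0)) \<longlonglongrightarrow> 0" using b1l by (rule LIMSEQ_ignore_initial_segment)
  qed
  have bl: "b \<longlonglongrightarrow> z"
  proof (rule LIM_zero_cancel, rule Lim_null_comparison)
    show "\<forall>\<^sub>F N in sequentially. norm (b N - z) \<le> b2 (N + N0)" using ab(4) by (simp add: dist_norm)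
    show "(\<lambda>N. b2 (N + N0)) \<longlonglongrightarrow> 0" using b2l by (rule LIMSEQ_ignore_initial_segment)
  qed
  have ze: "z \<in> ball z e" using e by simp
  have Dl: "(\<lambda>N. D (b N) v) \<longlonglongrightarrow> D z v" if "v = (1,0) \<or> v = (0,1)" for v
  proof -
    have "b N \<in> ball z e" for N using ab(2)[of N] r(2) ball_subset_cball by blast
    moreover have "continuous_on (ball z e) (\<lambda>q. D q v)" using that C1 by (auto simp: C1_on_def)
    ultimately show ?thesis using continuous_on_tendsto_compose[OF _ bl ze, of "\<lambda>q. D q v"] by auto
  qed
  have zs: "z \<in> UNIV \<times> {0<..<T}" using ze sub by blast
  have as: "a N \<in> UNIV \<times> {0<..<T}" for N
    using ab(1)[of N] r(2) sub ball_subset_cball[of z r] by blast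
  have rl: "(\<lambda>N. rx (a N)) \<longlonglongrightarrow> rx z" "(\<lambda>N. rxx (a N)) \<longlonglongrightarrow> rxx z"
    using continuous_on_tendsto_compose[OF rx_cont al zs] continuous_on_tendsto_compose[OF rxx_cont al zs] as by auto
  have "S * ((D z (1,0) + 2 * S * (fst z - fst z)) * (D z (0,1) + 2 * S * (snd z - snd z)) - rx z * rxx z) \<le> 0"
  proof (rule LIMSEQ_le_const2)
    show "(\<lambda>N. S * ((D (b N) (1,0) + 2 * S * (fst (b N) - fst z)) * (D (b N) (0,1) + 2 * S * (snd (b N) - snd z)) - rx (a N) * rxx (a N)))
      \<longlonglongrightarrow> S * ((D z (1,0) + 2 * S * (fst z - fst z)) * (D z (0,1) + 2 * S * (snd z - snd z)) - rx z * rxx z)"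
      by (intro tendsto_intros Dl rl bl) auto
  qed (use ab(5) in blast)
  then show ?thesis by simp
qed

theorem kappa_viscosity_solution:
  "viscosity_solution (QT T) (\<lambda>(x,t) (p1,p2). p1 * p2 - rx (x,t) * rxx (x,t)) \<kappa>"
proof -
  have QT: "QT T = UNIV \<times> {0<..<T}" by (simp add: QT_def)
  have c: "continuous_on (QT T) \<kappa>"
    by (rule continuous_on_subset[OF lipschitz_on_continuous_on[OF kappa_lipschitz]]) (auto simp: QT)
  have "D z (1,0) * D z (0,1) - rx z * rxx z \<le> 0"
    if "z \<in> QT T \<and> e > 0 \<and> ball z e \<subseteq> QT T \<and> C1_on (ball z e) \<phi> D \<and> (\<forall>q\<in>ball z e. \<kappa> q - \<phi> q \<le> \<kappa> z - \<phi> z)" for \<phi> D z e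
    using C1_test[of 1 e z \<phi> D] that by (simp add: QT)
  moreover have "D z (1,0) * D z (0,1) - rx z * rxx z \<ge> 0"
    if "z \<in> QT T \<and> e > 0 \<and> ball z e \<subseteq> QT T \<and> C1_on (ball z e) \<phi> D \<and> (\<forall>q\<in>ball z e. \<kappa> q - \<phi> q \<ge> \<kappa> z - \<phi> z)" for \<phi> D z e
  proof -
    have "-1 * (\<kappa> q - \<phi> q) \<le> -1 * (\<kappa> z - \<phi> z)" if "q \<in> ball z e" for q
    proof -
      have "\<kappa> z - \<phi> z \<le> \<kappa> q - \<phi> q" using that \<open>z \<in> QT T \<and> _\<close> by blast
      then show ?thesis by simp
    qed
    then show ?thesis using C1_test[of "-1" e z \<phi> D] that by (simp add: QT)
  qed
  ultimately show ?thesis using c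
    unfolding viscosity_solution_def viscosity_subsolution_def viscosity_supersolution_def by (auto simp: case_prod_beta)
qed

end

section \<open>Existence\<close>

text \<open>Fubini on the slope gaps: with jointly continuous quotients the exceptional set is a
  countable union of Borel sets in the plane, and each of its horizontal slices is null by the
  one-variable result.\<close>

lemma AE_partial_derivative_exists:
  fixes F :: "real \<times> real \<Rightarrow> real"
  assumes cont: "continuous_on UNIV F" and lip: "\<And>t. L-lipschitz_on UNIV (\<lambda>x. F (x,t))"
  shows "AE z in lborel. \<exists>D. ((\<lambda>y. F (y, snd z)) has_real_derivative D) (at (fst z))"
proof -
  define lo where "lo p = {z. fst z \<in> slope_below (\<lambda>y. F (y, snd z)) p}" for p
  define up where "up q = {z. fst z \<in> slope_above (\<lambda>y. F (y, snd z)) q}" for q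
  define N where "N = (\<Union>(p,q)\<in>{(p,q). p \<in> \<rat> \<and> q \<in> \<rat> \<and> p < q}. lo p \<inter> up q)"
  have quot: "continuous_on UNIV (\<lambda>z. (F (fst z + h, snd z) - F (fst z, snd z)) / h)" if "h \<noteq> 0" for h
    using that by (intro continuous_intros continuous_on_compose2[OF cont]) auto
  have "lo p = (\<Inter>n. \<Union>h\<in>{h. 0 < \<bar>h\<bar> \<and> \<bar>h\<bar> < inverse (Suc n)}. {z. (F (fst z + h, snd z) - F (fst z, snd z)) / h < p})" for p
    by (auto simp: lo_def slope_below_def)
  also have "\<dots> p \<in> sets borel" for p
    by (intro sets.countable_INT image_subsetI borel_open open_UN ballI open_Collect_less quot continuous_on_const) auto
  finally have lo: "lo p \<in> sets borel" for p .
  have "up q = (\<Inter>n. \<Union>h\<in>{h. 0 < \<bar>h\<bar> \<and> \<bar>h\<bar> < inverse (Suc n)}. {z. q < (F (fst z + h, snd z) - F (fst z, snd z)) / h})" for q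
    by (auto simp: up_def slope_above_def)
  also have "\<dots> q \<in> sets borel" for q
    by (intro sets.countable_INT image_subsetI borel_open open_UN ballI open_Collect_less quot continuous_on_const) auto
  finally have up: "up q \<in> sets borel" for q .
  have "countable ((\<rat>::real set) \<times> (\<rat>::real set))" using countable_rat by (intro countable_SIGMA)
  then have cnt: "countable {(p,q). (p::real) \<in> \<rat> \<and> q \<in> \<rat> \<and> p < q}" by (rule countable_subset[rotated]) auto
  have N: "N \<in> sets borel" unfolding N_def
    by (intro sets.countable_UN'[OF cnt]) (use lo up in auto)
  have sec: "emeasure lborel ((\<lambda>x. (x,t)) -` N) = 0" for t
  proof -
    have "(\<lambda>x. (x,t)) -` N = (\<Union>(p,q)\<in>{(p,q). p \<in> \<rat> \<and> q \<in> \<rat> \<and> p < q}. slope_below (\<lambda>y. F (y,t)) p \<inter> slope_above (\<lambda>y. F (y,t)) q)"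
      by (auto simp: N_def lo_def up_def) blast
    then show ?thesis using Union_slope_gap_null[OF lip[of t]] by (simp add: null_sets_def)
  qed
  have "emeasure lborel N = emeasure (lborel \<Otimes>\<^sub>M lborel) N" by (simp add: lborel_prod)
  also have "\<dots> = (\<integral>\<^sup>+t. emeasure lborel ((\<lambda>x. (x,t)) -` N) \<partial>lborel)"
    by (rule lborel_pair.emeasure_pair_measure_alt2) (unfold lborel_prod, use N in simp)
  also have "\<dots> = 0" by (simp add: sec)
  finally have null: "N \<in> null_sets lborel" using N by (simp add: null_sets_def)
  show ?thesis
  proof (rule AE_I'[OF null])
    show "{z \<in> space lborel. \<not> (\<exists>D. ((\<lambda>y. F (y, snd z)) has_real_derivative D) (at (fst z)))} \<subseteq> N"
    proof
      fix z assume z: "z \<in> {z \<in> space lborel. \<not> (\<exists>D. ((\<lambda>y. F (y, snd z)) has_real_derivative D) (at (fst z)))}"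
      show "z \<in> N"
      proof (rule ccontr)
        assume "z \<notin> N"
        then have "fst z \<notin> slope_below (\<lambda>y. F (y, snd z)) p \<inter> slope_above (\<lambda>y. F (y, snd z)) q"
          if "p \<in> \<rat>" "q \<in> \<rat>" "p < q" for p q
          using that by (auto simp: N_def lo_def up_def)
        from differentiable_if_no_slope_gap[OF lip this] z show False by blast
      qed
    qed
  qed
qed

text \<open>Clamping time to \<open>[0, T]\<close> extends \<open>\<kappa>\<close> to the plane with
  unchanged horizontal slices in the strip.\<close>

lemma AE_partial_derivative_strip:
  fixes \<kappa> :: "real \<times> real \<Rightarrow> real"
  assumes lip: "L-lipschitz_on (UNIV \<times> {0..T}) \<kappa>" and T: "T > 0"
  shows "AE z in lborel. z \<in> UNIV \<times> {0<..<T} \<longrightarrow> (\<exists>D. ((\<lambda>y. \<kappa> (y, snd z)) has_real_derivative D) (at (fst z)))"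
proof -
  define F where "F z = \<kappa> (fst z, max 0 (min T (snd z)))" for z :: "real \<times> real"
  have "continuous_on UNIV F" unfolding F_def
    by (intro continuous_on_compose2[OF lipschitz_on_continuous_on[OF lip]] continuous_intros) (use T in auto)
  moreover have "L-lipschitz_on UNIV (\<lambda>x. F (x,t))" for t
  proof (rule lipschitz_onI)
    fix x y :: real
    show "dist (F (x,t)) (F (y,t)) \<le> L * dist x y"
      using lipschitz_onD[OF lip, of "(x, max 0 (min T t))" "(y, max 0 (min T t))"] T by (simp add: F_def dist_Pair_Pair)
  qed (use lip in \<open>simp add: lipschitz_on_def\<close>)
  ultimately have "AE z in lborel. \<exists>D. ((\<lambda>y. F (y, snd z)) has_real_derivative D) (at (fst z))"
    by (rule AE_partial_derivative_exists)
  then show ?thesis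
  proof eventually_elim
    case (elim z)
    have "(\<lambda>y. F (y, snd z)) = (\<lambda>y. \<kappa> (y, snd z))" if "z \<in> UNIV \<times> {0<..<T}"
      using that by (auto simp: F_def)
    then show ?case using elim by auto
  qed
qed

lemma deriv_ge_of_diff_ge:
  fixes f g :: "real \<Rightarrow> real"
  assumes f: "(f has_real_derivative D) (at x)" and g: "(g has_real_derivative G) (at x)"
    and le: "\<And>y. x \<le> y \<Longrightarrow> \<bar>g y - g x\<bar> \<le> f y - f x"
  shows "\<bar>G\<bar> \<le> D"
proof (rule tendsto_le[OF trivial_limit_at_right_real])
  have 1: "((\<lambda>h. (f (x + h) - f x) / h) \<longlongrightarrow> D) (at 0)" "((\<lambda>h. (g (x + h) - g x) / h) \<longlongrightarrow> G) (at 0)"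
    using f g by (auto simp: DERIV_def)
  show "((\<lambda>h. (f (x + h) - f x) / h) \<longlongrightarrow> D) (at_right 0)"
    by (rule filterlim_mono[OF 1(1) order_refl]) (simp add: at_le)
  show "((\<lambda>h. \<bar>(g (x + h) - g x) / h\<bar>) \<longlongrightarrow> \<bar>G\<bar>) (at_right 0)"
    by (rule tendsto_rabs, rule filterlim_mono[OF 1(2) order_refl]) (simp add: at_le)
  show "\<forall>\<^sub>F h in at_right 0. \<bar>(g (x + h) - g x) / h\<bar> \<le> (f (x + h) - f x) / h"
    unfolding eventually_at_filter
    by (rule always_eventually) (use le in \<open>auto simp: abs_divide intro!: divide_right_mono\<close>)
qed

lemma approximation_of_schemes:
  assumes sch: "\<And>s. 0 < s \<Longrightarrow> s \<le> 1/2 \<Longrightarrow> scheme_heat s C L f0 f1 f2 f3 f4 k0 T rho rx rxx"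
    and rx_cont: "continuous_on (UNIV \<times> {0<..<T}) rx" and rxx_cont: "continuous_on (UNIV \<times> {0<..<T}) rxx"
  shows "\<exists>s h \<tau> K P Q u \<Lambda> B. approximation s h \<tau> K P Q u rho rx rxx k0 T \<Lambda> B C"
proof -
  define s where "s N = 1 / real (N + 2)" for N
  have s: "0 < s N" "s N \<le> 1/2" for N by (auto simp: s_def field_simps)
  have sc: "scheme_heat (s N) C L f0 f1 f2 f3 f4 k0 T rho rx rxx" for N by (rule sch[OF s])
  have sc': "scheme (s N) C L f0 f1 f2 f3 f4 k0" for N using sc[of N] by (simp add: scheme_heat_def)
  have C: "C \<ge> 1" and L: "L \<ge> 0" using sc'[of 0] by (auto simp: scheme_def)
  note ax = sc[of 0, unfolded scheme_heat_def scheme_heat_axioms_def]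
  have T: "T > 0" using ax by blast
  have rho_x: "((\<lambda>y. rho (y,t)) has_real_derivative rx (x,t)) (at x)" if "0 < t" "t < T" for x t using ax that by blast
  have rho_xx: "((\<lambda>y. rx (y,t)) has_real_derivative rxx (x,t)) (at x)" if "0 < t" "t < T" for x t using ax that by blast
  have rho_cont: "continuous_on (UNIV \<times> {0..T}) rho" using ax by blast
  have sl: "s \<longlonglongrightarrow> 0"
    unfolding s_def using LIMSEQ_ignore_initial_segment[OF lim_1_over_n, of 2] by simp
  define h where "h N = scheme.h (s N)" for N
  define \<tau> where "\<tau> N = scheme.\<tau> (s N)" for N
  define R where "R N n = heat_iter (h N) (scheme.cf (s N)) n f0" for N n
  define K where "K N = scheme.K (s N) C f0 k0" for N
  define P where "P N n x = (R N n (x + h N) - R N n (x - h N)) / (2 * h N)" for N n x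
  define Q where "Q N n x = diff2 (h N) (R N n) x / (h N)\<^sup>2" for N n x
  define u where "u N = scheme_heat.u (s N) C f0 k0" for N
  define \<Lambda> where "\<Lambda> = C + 4 * scheme.slope_bound C L T"
  define B where "B = L + C + 14 * C * T + 2 * C"
  have ht: "0 < h N" "h N \<le> s N" "0 < \<tau> N" "\<tau> N \<le> s N" for N
    using scheme.h_pos[OF sc'] scheme.tau_pos[OF sc'] scheme_heat.s_powers[OF sc] by (auto simp: h_def \<tau>_def)
  have rho_lim: "(\<lambda>N. rho (X N, real (n N) * \<tau> (k N))) \<longlonglongrightarrow> rho (x,t)"
    if "X \<longlonglongrightarrow> x" "(\<lambda>N. real (n N) * \<tau> (k N)) \<longlonglongrightarrow> t" "0 < t" "t < T" for k n X x t
  proof -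
    have "\<forall>\<^sub>F N in sequentially. real (n N) * \<tau> (k N) < T" using order_tendstoD(2)[OF that(2) that(4)] .
    then have "\<forall>\<^sub>F N in sequentially. (X N, real (n N) * \<tau> (k N)) \<in> UNIV \<times> {0..T}"
      by eventually_elim (use ht in \<open>auto simp: less_imp_le\<close>)
    then show ?thesis using that by (intro continuous_on_tendsto_compose[OF rho_cont] tendsto_Pair) auto
  qed
  have D0: "(\<lambda>N. C * s (k N) + c * s (k N) / d) \<longlonglongrightarrow> 0" if "strict_mono k" for k c and d :: real
  proof -
    have "(\<lambda>N. s (k N)) \<longlonglongrightarrow> 0" using LIMSEQ_subseq_LIMSEQ[OF sl that] by (simp add: o_def)
    then have "(\<lambda>N. C * s (k N) + c * s (k N) * (1/d)) \<longlonglongrightarrow> C * 0 + c * 0 * (1/d)" by (intro tendsto_intros)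
    then show ?thesis by simp
  qed
  have P_lim: "(\<lambda>N. P (k N) (n N) (X N)) \<longlonglongrightarrow> rx (x,t)"
    if k: "strict_mono k" and X: "X \<longlonglongrightarrow> x" and n: "(\<lambda>N. real (n N) * \<tau> (k N)) \<longlonglongrightarrow> t" and t: "0 < t" "t < T" for k n X x t
  proof (rule tendsto_double_approx)
    show "((\<lambda>\<delta>. (rho (x + \<delta>, t) - rho (x - \<delta>, t)) / (2 * \<delta>)) \<longlongrightarrow> rx (x,t)) (at_right 0)"
      by (rule central_difference_tendsto[OF rho_x[OF t]])
    fix \<delta> :: real assume \<delta>: "\<delta> > 0"
    show "(\<lambda>N. C * s (k N) + 7 * C * T * s (k N) / \<delta>) \<longlonglongrightarrow> 0" by (rule D0[OF k])
    show "(\<lambda>N. (rho (X N + \<delta>, real (n N) * \<tau> (k N)) - rho (X N - \<delta>, real (n N) * \<tau> (k N))) / (2 * \<delta>)) \<longlonglongrightarrow> (rho (x + \<delta>, t) - rho (x - \<delta>, t)) / (2 * \<delta>)"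
      by (intro tendsto_divide tendsto_diff rho_lim tendsto_add tendsto_const X n t) (use \<delta> in auto)
    have "\<forall>\<^sub>F N in sequentially. real (n N) * \<tau> (k N) < T" using order_tendstoD(2)[OF n t(2)] .
    then show "\<forall>\<^sub>F N in sequentially. \<bar>P (k N) (n N) (X N) - (rho (X N + \<delta>, real (n N) * \<tau> (k N)) - rho (X N - \<delta>, real (n N) * \<tau> (k N))) / (2 * \<delta>)\<bar>
       \<le> C * \<delta> + (C * s (k N) + 7 * C * T * s (k N) / \<delta>)"
      by eventually_elim (use scheme_heat.R1_close[OF sc _ \<delta>] in \<open>simp add: P_def R_def h_def \<tau>_def\<close>)
  qed
  have Q_lim: "(\<lambda>N. Q (k N) (n N) (X N)) \<longlonglongrightarrow> rxx (x,t)"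
    if k: "strict_mono k" and X: "X \<longlonglongrightarrow> x" and n: "(\<lambda>N. real (n N) * \<tau> (k N)) \<longlonglongrightarrow> t" and t: "0 < t" "t < T" for k n X x t
  proof (rule tendsto_double_approx)
    show "((\<lambda>\<delta>. diff2 \<delta> (\<lambda>y. rho (y,t)) x / \<delta>\<^sup>2) \<longlongrightarrow> rxx (x,t)) (at_right 0)"
      by (rule diff2_quotient_tendsto[OF rho_x[OF t] rho_xx[OF t]])
    fix \<delta> :: real assume \<delta>: "\<delta> > 0"
    show "(\<lambda>N. C * s (k N) + 28 * C * T * s (k N) / \<delta>\<^sup>2) \<longlonglongrightarrow> 0" by (rule D0[OF k])
    show "(\<lambda>N. diff2 \<delta> (\<lambda>y. rho (y, real (n N) * \<tau> (k N))) (X N) / \<delta>\<^sup>2) \<longlonglongrightarrow> diff2 \<delta> (\<lambda>y. rho (y,t)) x / \<delta>\<^sup>2"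
      unfolding diff2_def
      by (intro tendsto_divide tendsto_diff tendsto_add tendsto_mult rho_lim tendsto_const X n t) (use \<delta> in auto)
    have "\<forall>\<^sub>F N in sequentially. real (n N) * \<tau> (k N) < T" using order_tendstoD(2)[OF n t(2)] .
    then show "\<forall>\<^sub>F N in sequentially. \<bar>Q (k N) (n N) (X N) - diff2 \<delta> (\<lambda>y. rho (y, real (n N) * \<tau> (k N))) (X N) / \<delta>\<^sup>2\<bar>
       \<le> C * \<delta> + (C * s (k N) + 28 * C * T * s (k N) / \<delta>\<^sup>2)"
      by eventually_elim (use scheme_heat.R2_close[OF sc _ \<delta>] in \<open>simp add: Q_def R_def h_def \<tau>_def\<close>)
  qed
  have "approximation s h \<tau> K P Q u rho rx rxx k0 T \<Lambda> B C"
  proof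
    show "T > 0" by (rule T)
    show "\<Lambda> \<ge> 0" using scheme.slope_bound_ge[OF sc', where t=T] T C by (simp add: \<Lambda>_def)
    show "B \<ge> 0" using C L T by (simp add: B_def)
    show "0 < s N" "s N \<le> 1" for N using s[of N] by auto
    show "s \<longlonglongrightarrow> 0" by (rule sl)
    show "0 < h N" "h N \<le> s N" "0 < \<tau> N" "\<tau> N \<le> s N" for N by (rule ht)+
    show "u N (real_of_int i * h N, real n * \<tau> N) = K N n (real_of_int i * h N)" for N i n
      unfolding u_def h_def \<tau>_def K_def by (rule scheme_heat.u_grid[OF sc])
    show "\<bar>u N (x',t') - u N (x,t)\<bar> \<le> \<Lambda> * (\<bar>x' - x\<bar> + \<bar>t' - t\<bar> + s N)" if "t \<in> {0..T}" "t' \<in> {0..T}" for N x x' t t'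
      unfolding u_def \<Lambda>_def by (rule scheme_heat.u_equicontinuous[OF sc that])
    show "\<bar>u N (x,0) - k0 x\<bar> \<le> B * (\<bar>x\<bar> + 1) * s N" for N x
    proof -
      have "\<bar>u N (x,0) - k0 x\<bar> \<le> (L + C * (\<bar>x\<bar> + 1)) * s N" unfolding u_def by (rule scheme_heat.u_init[OF sc])
      also have "\<dots> \<le> B * (\<bar>x\<bar> + 1) * s N"
      proof (rule mult_right_mono)
        have "B * (\<bar>x\<bar> + 1) = L + L * \<bar>x\<bar> + C * (\<bar>x\<bar> + 1) + (14 * C * T + 2 * C) * (\<bar>x\<bar> + 1)" by (simp add: B_def algebra_simps)
        moreover have "0 \<le> L * \<bar>x\<bar>" "0 \<le> (14 * C * T + 2 * C) * (\<bar>x\<bar> + 1)" using L C T by auto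
        ultimately show "L + C * (\<bar>x\<bar> + 1) \<le> B * (\<bar>x\<bar> + 1)" by linarith
      qed (use s[of N] in simp)
      finally show ?thesis .
    qed
    show "\<exists>t'. 0 \<le> t' \<and> t' \<le> t \<and> t - t' \<le> s N \<and> \<bar>rho (y,t') - rho (x,t')\<bar> - B * s N \<le> u N (y,t) - u N (x,t)"
      if "x \<le> y" "0 \<le> t" "t < T" for N x y t
    proof -
      define t' where "t' = real (scheme_heat.tstep (s N) t) * scheme.\<tau> (s N)"
      have "0 \<le> t'" using ht(3)[of N] by (simp add: t'_def \<tau>_def)
      moreover have "t' \<le> t" "t < t' + \<tau> N" using scheme_heat.tstep[OF sc that(2), of N] by (auto simp: t'_def \<tau>_def)
      moreover have "\<bar>rho (y,t') - rho (x,t')\<bar> - (14 * C * T * s N + 2 * C * s N) \<le> u N (y,t) - u N (x,t)"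
        unfolding u_def t'_def using scheme_heat.u_diff_ge[OF sc that] by simp
      moreover have "14 * C * T * s N + 2 * C * s N \<le> B * s N"
        unfolding B_def distrib_right using s[of N] L C by simp
      ultimately show ?thesis using ht(4)[of N] by (intro exI[of _ t'] conjI) linarith+
    qed
    show "S * ((a - g x) / \<tau> N - 4 * (s N)\<^sup>2 * (diff2 (h N) g x / (h N)\<^sup>2) - Q N n x * P N n x / D) \<le> 0"
      if "S = 1 \<or> S = -1" "\<And>y. y \<in> {x, x + h N, x - h N} \<Longrightarrow> S * (K N n y - g y) \<le> S * (K N (Suc n) x - a)"
        "D = (g (x + h N) - g (x - h N)) / (2 * h N)" "C * s N \<le> D" for N S n x g a D
      unfolding \<tau>_def h_def Q_def P_def R_def
      by (rule scheme.touching_step[OF sc' that(1)]) (use that in \<open>simp_all only: K_def h_def\<close>)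
  qed (fact P_lim Q_lim rho_cont rho_x rx_cont rxx_cont)+
  then show ?thesis by blast
qed

section \<open>From the data of the theorem to the scheme\<close>

lemma smooth_compact_support_bound:
  assumes "smooth_real f" "compact_support f"
  shows "\<exists>B. \<forall>x. \<bar>(deriv ^^ n) f x\<bar> \<le> B"
proof -
  define S where "S = closure {x. f x \<noteq> 0}"
  have S: "compact S" using assms(2) by (simp add: compact_support_def S_def)
  have "open (- S)" by (simp add: S_def open_Compl)
  \<comment> \<open>The complement of the support is open, so vanishing there is inherited by every
    derivative; on the compact support continuity gives the bound.\<close>
  have out: "(deriv ^^ n) f x = 0" if "x \<in> - S" for x n
    using that
  proof (induction n arbitrary: x)
    case 0 then show ?case using closure_subset[of "{x. f x \<noteq> 0}"] by (auto simp: S_def)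
  next
    case (Suc n)
    have "((deriv ^^ n) f has_real_derivative 0) (at x)"
      by (rule has_field_derivative_transform_within_open[OF DERIV_const[of 0] \<open>open (- S)\<close> Suc.prems]) (simp add: Suc.IH)
    then show ?case by (simp add: DERIV_imp_deriv)
  qed
  have "continuous_on S ((deriv ^^ n) f)"
    using assms(1) by (intro continuous_at_imp_continuous_on ballI differentiable_imp_continuous_within) (auto simp: smooth_real_def)
  then have "bounded ((deriv ^^ n) f ` S)" using S by (intro compact_imp_bounded compact_continuous_image)
  then obtain B where B: "\<And>x. x \<in> S \<Longrightarrow> \<bar>(deriv ^^ n) f x\<bar> \<le> B" by (auto simp: bounded_iff)
  have "\<bar>(deriv ^^ n) f x\<bar> \<le> \<bar>B\<bar>" for x
    using B[of x] out[of x n] by (cases "x \<in> S") auto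
  then show ?thesis by blast
qed

lemma smooth_real_has_derivative:
  assumes "smooth_real f"
  shows "((deriv ^^ n) f has_real_derivative (deriv ^^ Suc n) f x) (at x)"
  using assms by (simp add: smooth_real_def DERIV_deriv_iff_real_differentiable)

text \<open>Both \<open>f - g\<close> and \<open>f + g\<close> have nonnegative derivative almost
  everywhere, hence are monotone. The hypothesis quantifies over derivatives of \<open>f\<close>;
  their existence almost everywhere is what gives it content.\<close>

lemma lipschitz_AE_deriv_ge_imp_diff_ge:
  fixes f g :: "real \<Rightarrow> real"
  assumes f: "L-lipschitz_on UNIV f" and g: "\<And>x. (g has_real_derivative g' x) (at x)" "\<And>x. \<bar>g' x\<bar> \<le> C"
    and ae: "AE x in lborel. \<forall>D. (f has_real_derivative D) (at x) \<longrightarrow> D \<ge> \<bar>g' x\<bar>" and xy: "x \<le> y"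
  shows "\<bar>g y - g x\<bar> \<le> f y - f x"
proof -
  have "C \<ge> 0" using g(2)[of 0] by linarith
  then have gl: "C-lipschitz_on UNIV g"
    using abs_diff_le_of_deriv_bound[of g g' C] g by (intro lipschitz_onI) (auto simp: dist_real_def)
  have "mono (\<lambda>x. f x - g x)"
  proof (rule lipschitz_AE_deriv_nonneg_imp_mono[OF lipschitz_on_diff[OF f gl]])
    show "AE x in lborel. \<exists>D\<ge>0. ((\<lambda>x. f x - g x) has_real_derivative D) (at x)"
      using ae lipschitz_AE_differentiable[OF f]
    proof eventually_elim
      case (elim x)
      then obtain D where D: "(f has_real_derivative D) (at x)" "D \<ge> \<bar>g' x\<bar>" by blast
      have "((\<lambda>x. f x - g x) has_real_derivative (D - g' x)) (at x)" by (intro DERIV_diff D(1) g)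
      then show ?case using D(2) by (intro exI[of _ "D - g' x"]) auto
    qed
  qed
  moreover have "mono (\<lambda>x. f x + g x)"
  proof (rule lipschitz_AE_deriv_nonneg_imp_mono[OF lipschitz_on_add[OF f gl]])
    show "AE x in lborel. \<exists>D\<ge>0. ((\<lambda>x. f x + g x) has_real_derivative D) (at x)"
      using ae lipschitz_AE_differentiable[OF f]
    proof eventually_elim
      case (elim x)
      then obtain D where D: "(f has_real_derivative D) (at x)" "D \<ge> \<bar>g' x\<bar>" by blast
      have "((\<lambda>x. f x + g x) has_real_derivative (D + g' x)) (at x)" by (intro DERIV_add D(1) g)
      then show ?case using D(2) by (intro exI[of _ "D + g' x"]) auto
    qed
  qed
  ultimately show ?thesis using xy by (force dest: monoD simp: abs_le_iff)
qed

theorem theorem1p6: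
  fixes T :: real and kappa0 rho0 :: "real \<Rightarrow> real"
    and rho rx rxx :: "real \<times> real \<Rightarrow> real"
  assumes T_pos: "T > 0"
    and kappa0_lip: "\<exists>L. L-lipschitz_on UNIV kappa0"
    and rho0_smooth: "smooth_real rho0"
    and rho0_supp: "compact_support rho0"
    and init_ineq: "AE x in lborel. \<forall>D. (kappa0 has_real_derivative D) (at x) \<longrightarrow> D \<ge> \<bar>deriv rho0 x\<bar>"
    \<comment> \<open>rho is the (bounded classical) solution of the heat equation with rho(.,0) = rho0;
        rx = rho_x and rxx = rho_xx\<close>
    and rho_x: "\<And>x t. (x,t) \<in> QT T \<Longrightarrow> ((\<lambda>y. rho (y,t)) has_real_derivative rx (x,t)) (at x)"
    and rho_xx: "\<And>x t. (x,t) \<in> QT T \<Longrightarrow> ((\<lambda>y. rx (y,t)) has_real_derivative rxx (x,t)) (at x)"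
    and rho_heat: "\<And>x t. (x,t) \<in> QT T \<Longrightarrow> ((\<lambda>s. rho (x,s)) has_real_derivative rxx (x,t)) (at t)"
    and rho_cont: "continuous_on (QT_closed T) rho"
    and rx_cont: "continuous_on (QT T) rx"
    and rxx_cont: "continuous_on (QT T) rxx"
    and rho_bdd: "bounded (rho ` QT_closed T)"
    and rho_init: "\<And>x. rho (x,0) = rho0 x"
  shows "\<exists>kappa :: real \<times> real \<Rightarrow> real.
           (\<exists>L. L-lipschitz_on (QT_closed T) kappa) \<and>
           viscosity_solution (QT T) (\<lambda>(x,t) (p1,p2). p1 * p2 - rx (x,t) * rxx (x,t)) kappa \<and>
           (\<forall>x. kappa (x,0) = kappa0 x) \<and>
           (AE z in lborel. z \<in> QT_closed T \<longrightarrow>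
              (\<exists>D. ((\<lambda>y. kappa (y, snd z)) has_real_derivative D) (at (fst z)) \<and> D \<ge> \<bar>rx z\<bar>))"
proof -
  define f where "f n = (deriv ^^ n) rho0" for n
  have f_deriv: "(f n has_real_derivative f (Suc n) x) (at x)" for n x
    unfolding f_def by (rule smooth_real_has_derivative[OF rho0_smooth])
  have f0: "f 0 = rho0" and f1: "f (Suc 0) = deriv rho0" by (simp_all add: f_def)
  have "\<forall>n. \<exists>B. \<forall>x. \<bar>f n x\<bar> \<le> B"
    unfolding f_def using smooth_compact_support_bound[OF rho0_smooth rho0_supp] by blast
  then obtain Bd where Bd: "\<And>n x. \<bar>f n x\<bar> \<le> Bd n" by metis
  \<comment> \<open>One constant for the first four derivatives of the datum; the summand 1 provides
    \<open>C \<ge> 1\<close>.\<close>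
  define C where "C = 1 + Bd 1 + Bd 2 + Bd 3 + Bd 4"
  have Bd0: "Bd n \<ge> 0" for n using Bd[of n 0] by linarith
  have C: "C \<ge> 1" "\<bar>f 1 x\<bar> \<le> C" "\<bar>f 2 x\<bar> \<le> C" "\<bar>f 3 x\<bar> \<le> C" "\<bar>f 4 x\<bar> \<le> C" for x
    using Bd0[of 1] Bd0[of 2] Bd0[of 3] Bd0[of 4] Bd[of 1 x] Bd[of 2 x] Bd[of 3 x] Bd[of 4 x] unfolding C_def by linarith+
  obtain L where L: "L-lipschitz_on UNIV kappa0" using kappa0_lip by blast
  have lower: "\<bar>f 0 y - f 0 x\<bar> \<le> kappa0 y - kappa0 x" if "x \<le> y" for x y
    using lipschitz_AE_deriv_ge_imp_diff_ge[OF L, of "f 0" "f 1" C] f_deriv[of 0] C(2) init_ineq that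
    by (simp add: f1)
  have sch: "scheme_heat s C L (f 0) (f 1) (f 2) (f 3) (f 4) kappa0 T rho rx rxx" if "0 < s" "s \<le> 1/2" for s
  proof
    show "0 \<le> L" using L by (simp add: lipschitz_on_def)
    show "(f 0 has_real_derivative f 1 x) (at x)" "(f 1 has_real_derivative f 2 x) (at x)"
      "(f 2 has_real_derivative f 3 x) (at x)" "(f 3 has_real_derivative f 4 x) (at x)" for x
      using f_deriv[of 0 x] f_deriv[of 1 x] f_deriv[of 2 x] f_deriv[of 3 x] by (simp_all add: eval_nat_numeral)
    show "kappa0 y - kappa0 x \<le> L * (y - x)" if "x \<le> y" for x y
      using lipschitz_onD[OF L, of x y] that by (simp add: dist_real_def)
    show "\<exists>B. \<forall>x. \<forall>t\<in>{0..T}. \<bar>rho (x,t)\<bar> \<le> B" using rho_bdd by (auto simp: bounded_iff QT_closed_def)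
    show "continuous_on (UNIV \<times> {0..T}) rho" using rho_cont by (simp add: QT_closed_def)
    show "((\<lambda>y. rho (y,t)) has_real_derivative rx (x,t)) (at x)" "((\<lambda>y. rx (y,t)) has_real_derivative rxx (x,t)) (at x)"
      "((\<lambda>r. rho (x,r)) has_real_derivative rxx (x,t)) (at t)" if "0 < t" "t < T" for x t
      using that rho_x[of x t] rho_xx[of x t] rho_heat[of x t] by (auto simp: QT_def)
    show "rho (x,0) = f 0 x" for x by (simp add: rho_init f0)
  qed (use that C lower T_pos in auto)
  have cont: "continuous_on (UNIV \<times> {0<..<T}) rx" "continuous_on (UNIV \<times> {0<..<T}) rxx"
    using rx_cont rxx_cont by (auto simp: QT_def)
  obtain s h \<tau> K P Q u \<Lambda> B where "approximation s h \<tau> K P Q u rho rx rxx kappa0 T \<Lambda> B C"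
    using approximation_of_schemes[OF sch cont] by blast
  then interpret approximation s h \<tau> K P Q u rho rx rxx kappa0 T \<Lambda> B C .
  obtain k \<kappa> where k: "strict_mono k" "\<And>x t. t \<in> {0..T} \<Longrightarrow> (\<lambda>N. u (k N) (x,t)) \<longlonglongrightarrow> \<kappa> (x,t)"
    using exists_limit by blast
  interpret approximation_limit s h \<tau> K P Q u rho rx rxx kappa0 T \<Lambda> B C k \<kappa>
    by unfold_locales (use k in auto)
  have lip: "(2 * \<Lambda>)-lipschitz_on (QT_closed T) \<kappa>" using kappa_lipschitz by (simp add: QT_closed_def)
  \<comment> \<open>The lines \<open>t = 0\<close> and \<open>t = T\<close> are null, so the claim
    on the closed strip reduces to the open one, where \<open>rx\<close> is the derivative of
    \<open>rho\<close>.\<close>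
  have "AE z in lborel. z \<notin> (UNIV :: real set) \<times> {0::real}" "AE z in lborel. z \<notin> (UNIV :: real set) \<times> {T}"
  proof -
    have "emeasure lborel ((UNIV :: real set) \<times> {c}) = 0" for c :: real
      unfolding lborel_prod[symmetric] by (subst lborel.emeasure_pair_measure_Times) auto
    moreover have "(UNIV :: real set) \<times> {c} \<in> sets borel" for c :: real
      by (intro borel_closed closed_Times) auto
    ultimately have null: "(UNIV :: real set) \<times> {c} \<in> null_sets lborel" for c :: real
      by (intro null_setsI) auto
    show "AE z in lborel. z \<notin> (UNIV :: real set) \<times> {0::real}" by (rule AE_not_in[OF null])
    show "AE z in lborel. z \<notin> (UNIV :: real set) \<times> {T}" by (rule AE_not_in[OF null])
  qed
  moreover have "AE z in lborel. z \<in> UNIV \<times> {0<..<T} \<longrightarrow> (\<exists>D. ((\<lambda>y. \<kappa> (y, snd z)) has_real_derivative D) (at (fst z)))"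
    by (rule AE_partial_derivative_strip[OF kappa_lipschitz T_pos])
  ultimately have "AE z in lborel. z \<in> QT_closed T \<longrightarrow>
      (\<exists>D. ((\<lambda>y. \<kappa> (y, snd z)) has_real_derivative D) (at (fst z)) \<and> D \<ge> \<bar>rx z\<bar>)"
  proof eventually_elim
    case (elim z)
    show ?case
    proof
      assume "z \<in> QT_closed T"
      then have z: "z \<in> UNIV \<times> {0<..<T}" using elim(1,2) by (cases z) (auto simp: QT_closed_def)
      then obtain D where D: "((\<lambda>y. \<kappa> (y, snd z)) has_real_derivative D) (at (fst z))" using elim(3) by blast
      have "\<bar>rx (fst z, snd z)\<bar> \<le> D"
        by (rule deriv_ge_of_diff_ge[OF D rho_x]) (use z kappa_diff_ge in \<open>auto simp: QT_def\<close>)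
      then show "\<exists>D. ((\<lambda>y. \<kappa> (y, snd z)) has_real_derivative D) (at (fst z)) \<and> D \<ge> \<bar>rx z\<bar>" using D by auto
    qed
  qed
  then show ?thesis using lip kappa_viscosity_solution kappa_init by blast
qed

end
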